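(* Let $\mathcal{P}=\mathcal{P}(\mathbb{C}^2\otimes\mathbb{C}^2\otimes\mathbb{C}^3)=\mathbb{C}[x_{ijk}: i,j\in\{1,2\},\,k\in\{1,2,3\}]$ with the action of $G=GL_2(\mathbb{C})\times GL_2(\mathbb{C})\times GL_3(\mathbb{C})$ described in the context, let $N\subset G$ be the product of the three groups of unipotent upper triangular matrices, and let $\mathcal{A}_{223}=\mathcal{P}^N$. Let $x_{111},d_{12},d_{13},d_{23},f_3,u,f_4,v,v^*$ be the explicit highest weight vectors given in the context. Then there are highest weight vectors $f_5,\varphi,\psi,\psi^*\in\mathcal{P}$, with leading coefficient $1$ and with the following weights and leading monomials: - $f_5$: weight $(3,2\,|\,3,2\,|\,2,2,1)$, leading monomial $x_{111}^2x_{122}x_{212}x_{223}$; - $\varphi$: weight $(3,3\,|\,3,3\,|\,2,2,2)$, leading monomial $x_{111}^2x_{122}x_{212}x_{223}^2$; - $\psi$: weight $(3,3\,|\,4,2\,|\,3,2,1)$, leading monomial $x_{111}^3x_{212}x_{222}x_{223}$; - $\psi^*$: weight $(4,2\,|\,3,3\,|\,3,2,1)$, leading monomial $x_{111}^3x_{122}x_{222}x_{223}$; such that the following hold. (i) The algebra $\mathcal{A}_{223}$ is generated by the thirteen elements $x_{111},d_{12},d_{13},d_{23},f_3,u,f_4,v,v^*,f_5,\varphi,\psi,\psi^*$. (ii) These generators satisfy 20 relations of the following form, where $m\equiv m'$ means that $m$ and $m'$ have the same leading monomial and $m-m'$ equals a linear combination of monomials in the thirteen generators whose leading monomials are strictly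 smaller than that of $m$: R1: $f_3^2\equiv x_{111}^2f_4$; R2: $d_{23}v\equiv x_{111}f_5$; R3: $d_{13}v^*\equiv x_{111}f_5$; R4: $f_3v\equiv x_{111}\psi$; R5: $f_3v^*\equiv x_{111}\psi^*$; R6: $f_3f_5\equiv d_{23}\psi$; R7: $d_{13}\psi^*\equiv d_{23}\psi$; R8: $vv^*\equiv x_{111}^2\varphi$; R9: $vf_5\equiv x_{111}d_{13}\varphi$; R10: $v^*f_5\equiv x_{111}d_{23}\varphi$; R11: $f_3\psi\equiv x_{111}f_4v$; R12: $f_3\psi^*\equiv x_{111}f_4v^*$; R13: $f_5^2\equiv d_{13}d_{23}\varphi$; R14: $v^*\psi\equiv x_{111}f_3\varphi$; R15: $v\psi^*\equiv x_{111}f_3\varphi$; R16: $f_5\psi\equiv d_{13}f_3\varphi$; R17: $f_5\psi^*\equiv d_{23}f_3\varphi$; R18: $\psi^2\equiv f_4v^2$; R19: $(\psi^* )^2\equiv f_4(v^* )^2$; R20: $\psi\psi^*\equiv x_{111}^2f_4\varphi$; and the ideal of all relations among the thirteen generators (the kernel of the natural map from the polynomial ring in 13 variables to $\mathcal{A}_{223}$) is generated by these 20 relations. (iii) The following monomials in the generators (all exponents being nonnegative integers, subject to the indicated restrictions) together form a vector space basis of $\mathcal{A}_{223}$: 1. $x_{111}^a d_{12}^b d_{13}^c d_{23}^d f_3\, u^f f_4^g\varphi^k$; 2. $x_{111}^a d_{12}^b d_{13}^c d_{23}^d u^f f_4^g f_5\,\varphi^k$; 3. $x_{111}^a d_{12}^b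 d_{13}^c u^f f_4^g v^h\varphi^k\psi^l$ with $h\ge 1$, $l\in\{0,1\}$; 4. $x_{111}^a d_{12}^b d_{23}^d u^f f_4^g (v^* )^i\varphi^k(\psi^* )^m$ with $i\ge 1$, $m\in\{0,1\}$; 5. $x_{111}^a d_{12}^b d_{13}^c d_{23}^d u^f f_4^g\varphi^k\psi^l$ with $c\ge 1$, $l\in\{0,1\}$; 6. $x_{111}^a d_{12}^b d_{23}^d u^f f_4^g\varphi^k\psi$; 7. $x_{111}^a d_{12}^b d_{23}^d u^f f_4^g\varphi^k(\psi^* )^m$ with $m\in\{0,1\}$.
   Context: Action: $G=GL_2\times GL_2\times GL_3$ acts on $\mathcal{P}$ by algebra automorphisms so that the linear span of the variables $x_{ijk}$ is the $G$-module $\mathbb{C}^2\otimes\mathbb{C}^2\otimes\mathbb{C}^3$ with $x_{ijk}$ corresponding to $e_i\otimes e_j\otimes e_k$. Thus, at the Lie algebra level, the matrix unit $e_{ab}^{(r)}$ of the $r$-th factor acts as the derivation of $\mathcal{P}$ which sends a variable with $r$-th index $b$ to the variable with $r$-th index replaced by $a$, and sends variables with $r$-th index different from $b$ to $0$. An element is $N$-invariant iff it is annihilated by $e_{12}^{(1)},e_{12}^{(2)},e_{12}^{(3)},e_{23}^{(3)}$. A highest weight vector is a nonzero $N$-invariant weight vector. The weight of a monomial is $(\lambda_1,\lambda_2\,|\,\mu_1,\mu_2\,|\,\nu_1,\nu_2,\nu_3)$, where $\lambda_a$ (resp. $\mu_a$, $\nu_a$) is the number of variables, counted with multiplicity, with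 first (resp. second, third) index equal to $a$. Monomial order: variables are ordered lexicographically by indices with $1$ higher than $2$ higher than $3$, i.e. $x_{111}>x_{112}>x_{113}>x_{121}>x_{122}>\dots>x_{223}$, and monomials are ordered lexicographically with respect to this order of the variables. The leading monomial of a nonzero polynomial is its largest monomial, and the leading coefficient is the coefficient of that monomial. Explicit generators: $d_{12}=x_{111}x_{221}-x_{121}x_{211}$, $d_{13}=x_{111}x_{212}-x_{112}x_{211}$, $d_{23}=x_{111}x_{122}-x_{112}x_{121}$; $f_3=x_{111}^2x_{222}-x_{111}x_{112}x_{221}-x_{111}x_{121}x_{212}-x_{111}x_{122}x_{211}+2x_{112}x_{121}x_{211}$; $u=\det\begin{pmatrix} x_{111} & x_{112} & x_{113} \\ x_{121} & x_{122} & x_{123} \\ x_{211} & x_{212} & x_{213} \end{pmatrix}$; $f_4=x_{111}^2x_{222}^2-2x_{111}x_{112}x_{221}x_{222}-2x_{111}x_{121}x_{212}x_{222}-2x_{111}x_{122}x_{211}x_{222}+4x_{111}x_{122}x_{212}x_{221}+x_{112}^2x_{221}^2+4x_{112}x_{121}x_{211}x_{222}-2x_{112}x_{121}x_{212}x_{221}-2x_{112}x_{122}x_{211}x_{221}+x_{121}^2x_{212}^2-2x_{121}x_{122}x_{211}x_{212}+x_{122}^2x_{211}^2$; $v=\det\begin{pmatrix} 0 & x_{111} & x_{112} & x_{113} \\ 0 & x_{211} & x_{212} & x_{213} \\ x_{111} & x_{121} & x_{122} & x_{123} \\ x_{211} & x_{221} & x_{222} & x_{223} \end{pmatrix}$,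 $\quad v^*=\det\begin{pmatrix} 0 & x_{111} & x_{112} & x_{113} \\ 0 & x_{121} & x_{122} & x_{123} \\ x_{111} & x_{211} & x_{212} & x_{213} \\ x_{121} & x_{221} & x_{222} & x_{223} \end{pmatrix}$. *)

theory Defs
  imports "HOL-Analysis.Determinants" "HOL-Library.Poly_Mapping"
begin

section \<open>Polynomials in several variables\<close>

text \<open>A monomial is its exponent function \<open>'v \<Rightarrow>\<^sub>0 nat\<close>; the product of monomials is the sum of
  exponents.\<close>

type_synonym 'v monomial = "'v \<Rightarrow>\<^sub>0 nat"
type_synonym 'v cpoly = "'v monomial \<Rightarrow>\<^sub>0 complex"

definition const_poly :: "complex \<Rightarrow> 'v cpoly" where
  "const_poly c = Poly_Mapping.single 0 c"

definition var :: "'v \<Rightarrow> 'v cpoly" where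
  "var v = Poly_Mapping.single (Poly_Mapping.single v 1) 1"

definition monomial_poly :: "'v monomial \<Rightarrow> 'v cpoly" where
  "monomial_poly m = Poly_Mapping.single m 1"

definition cscale :: "complex \<Rightarrow> 'v cpoly \<Rightarrow> 'v cpoly" where
  "cscale c p = const_poly c * p"

text \<open>The algebra homomorphism that is determined by the images \<open>\<sigma> v\<close> of the variables.\<close>

definition subst :: "('v \<Rightarrow> 'w cpoly) \<Rightarrow> 'v cpoly \<Rightarrow> 'w cpoly" where
  "subst \<sigma> p =
     (\<Sum>m\<in>Poly_Mapping.keys p. const_poly (Poly_Mapping.lookup p m) *
        (\<Prod>v\<in>Poly_Mapping.keys m. \<sigma> v ^ Poly_Mapping.lookup m v))"

definition is_subalgebra :: "'v cpoly set \<Rightarrow> bool" where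
  "is_subalgebra S \<longleftrightarrow> 1 \<in> S \<and> (\<forall>c. \<forall>p\<in>S. cscale c p \<in> S) \<and>
     (\<forall>p\<in>S. \<forall>q\<in>S. p + q \<in> S \<and> p * q \<in> S)"

definition ideal_generated :: "'v cpoly set \<Rightarrow> 'v cpoly set" where
  "ideal_generated S = module.span (*) S"


section \<open>The variables and the monomial order\<close>

text \<open>The numerals 1, 2 of type \<open>2\<close> and 1, 2, 3 of type \<open>3\<close> are the indices. In these types
  \<open>2 = 0\<close> and \<open>3 = 0\<close> respectively, so their built-in order is not the order of the indices; the
  latter is given by the following two functions.\<close>

datatype idx = Idx (idx1: 2) (idx2: 2) (idx3: 3)

definition pos2 :: "2 \<Rightarrow> nat" where
  "pos2 i = (if i = 1 then 1 else 2)"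

definition pos3 :: "3 \<Rightarrow> nat" where
  "pos3 k = (if k = 1 then 1 else if k = 2 then 2 else 3)"

lemma pos2_inj: "pos2 i = pos2 j \<longleftrightarrow> i = j"
  using exhaust_2[of i] exhaust_2[of j] by (auto simp: pos2_def)

lemma pos3_inj: "pos3 i = pos3 j \<longleftrightarrow> i = j"
  using exhaust_3[of i] exhaust_3[of j] by (auto simp: pos3_def)

text \<open>The lexicographic order of the indices. So \<open>111\<close> is the least index, while \<open>xvar 1 1 1\<close> is meant
  to be the highest variable: the order on \<open>idx monomial\<close> from \<open>Poly_Mapping\<close> compares two exponent
  functions at the least index at which they differ, and hence is the lexicographic monomial order
  for \<open>xvar 1 1 1 > xvar 1 1 2 > xvar 1 1 3 > xvar 1 2 1 > \<dots> > xvar 2 2 3\<close>.\<close>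

instantiation idx :: linorder
begin

definition less_idx :: "idx \<Rightarrow> idx \<Rightarrow> bool" where
  "v < w \<longleftrightarrow> pos2 (idx1 v) < pos2 (idx1 w) \<or>
     idx1 v = idx1 w \<and> (pos2 (idx2 v) < pos2 (idx2 w) \<or>
     idx2 v = idx2 w \<and> pos3 (idx3 v) < pos3 (idx3 w))"

definition less_eq_idx :: "idx \<Rightarrow> idx \<Rightarrow> bool" where
  "v \<le> w \<longleftrightarrow> v < w \<or> v = (w :: idx)"

instance
proof
  fix u v w :: idx
  show "(v < w) = (v \<le> w \<and> \<not> w \<le> v)"
    by (auto simp: less_eq_idx_def less_idx_def)
  show "v \<le> v"
    by (simp add: less_eq_idx_def)
  show "u \<le> v \<Longrightarrow> v \<le> w \<Longrightarrow> u \<le> w"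
    by (auto simp: less_eq_idx_def less_idx_def)
  show "v \<le> w \<Longrightarrow> w \<le> v \<Longrightarrow> v = w"
    by (auto simp: less_eq_idx_def less_idx_def)
  show "v \<le> w \<or> w \<le> v"
    unfolding less_eq_idx_def less_idx_def
    by (cases v; cases w) (auto simp: pos2_inj[symmetric] pos3_inj[symmetric])
qed

end

type_synonym poly223 = "idx cpoly"

definition xvar :: "2 \<Rightarrow> 2 \<Rightarrow> 3 \<Rightarrow> poly223" where
  "xvar i j k = var (Idx i j k)"

text \<open>The exponent function of the monomial \<open>xvar i j k\<close>.\<close>

definition xmon :: "2 \<Rightarrow> 2 \<Rightarrow> 3 \<Rightarrow> idx monomial" where
  "xmon i j k = Poly_Mapping.single (Idx i j k) 1"

text \<open>Both are meaningful only for \<open>p \<noteq> 0\<close>.\<close>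

definition leading_monomial :: "poly223 \<Rightarrow> idx monomial" where
  "leading_monomial p = Max (Poly_Mapping.keys p)"

definition leading_coeff :: "poly223 \<Rightarrow> complex" where
  "leading_coeff p = Poly_Mapping.lookup p (leading_monomial p)"


section \<open>Group action, invariants and highest weight vectors\<close>

text \<open>\<open>(g, h, k)\<close> acts by the algebra endomorphism of the polynomial ring that restricts to
  \<open>g \<otimes> h \<otimes> k\<close> on the span of the variables, where \<open>g e\<^sub>i = (\<Sum>a. g\<^sub>a\<^sub>i e\<^sub>a)\<close> and likewise for
  \<open>h\<close> and \<open>k\<close>. For invertible \<open>g\<close>, \<open>h\<close>, \<open>k\<close> this is the action of \<open>GL\<^sub>2 \<times> GL\<^sub>2 \<times> GL\<^sub>3\<close>.\<close>

type_synonym mat223 = "(complex^2^2) \<times> (complex^2^2) \<times> (complex^3^3)"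

fun act :: "mat223 \<Rightarrow> poly223 \<Rightarrow> poly223" where
  "act (g, h, k) p =
     subst (\<lambda>v. \<Sum>a\<in>UNIV. \<Sum>b\<in>UNIV. \<Sum>c\<in>UNIV.
       cscale (g $ a $ idx1 v * h $ b $ idx2 v * k $ c $ idx3 v) (xvar a b c)) p"

definition unipotent_upper2 :: "complex^2^2 \<Rightarrow> bool" where
  "unipotent_upper2 g \<longleftrightarrow> g $ 1 $ 1 = 1 \<and> g $ 2 $ 2 = 1 \<and> g $ 2 $ 1 = 0"

definition unipotent_upper3 :: "complex^3^3 \<Rightarrow> bool" where
  "unipotent_upper3 g \<longleftrightarrow> g $ 1 $ 1 = 1 \<and> g $ 2 $ 2 = 1 \<and> g $ 3 $ 3 = 1 \<and>
     g $ 2 $ 1 = 0 \<and> g $ 3 $ 1 = 0 \<and> g $ 3 $ 2 = 0"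

definition N223 :: "mat223 set" where
  "N223 = {(g, h, k). unipotent_upper2 g \<and> unipotent_upper2 h \<and> unipotent_upper3 k}"

definition A223 :: "poly223 set" where
  "A223 = {p. \<forall>n\<in>N223. act n p = p}"

type_synonym weight223 = "(nat \<times> nat) \<times> (nat \<times> nat) \<times> (nat \<times> nat \<times> nat)"

definition monomial_weight :: "idx monomial \<Rightarrow> weight223" where
  "monomial_weight m =
    (let l = \<lambda>a. \<Sum>j\<in>UNIV. \<Sum>k\<in>UNIV. Poly_Mapping.lookup m (Idx a j k);
         r = \<lambda>a. \<Sum>i\<in>UNIV. \<Sum>k\<in>UNIV. Poly_Mapping.lookup m (Idx i a k);
         s = \<lambda>a. \<Sum>i\<in>UNIV. \<Sum>j\<in>UNIV. Poly_Mapping.lookup m (Idx i j a)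
     in ((l 1, l 2), (r 1, r 2), (s 1, s 2, s 3)))"

text \<open>A weight vector of weight \<open>w\<close> is a linear combination of monomials of weight \<open>w\<close>.\<close>

definition highest_weight_vector :: "weight223 \<Rightarrow> poly223 \<Rightarrow> bool" where
  "highest_weight_vector w p \<longleftrightarrow>
     p \<noteq> 0 \<and> p \<in> A223 \<and> (\<forall>m\<in>Poly_Mapping.keys p. monomial_weight m = w)"


section \<open>The explicit highest weight vectors\<close>

definition d12 :: poly223 where
  "d12 = xvar 1 1 1 * xvar 2 2 1 - xvar 1 2 1 * xvar 2 1 1"

definition d13 :: poly223 where
  "d13 = xvar 1 1 1 * xvar 2 1 2 - xvar 1 1 2 * xvar 2 1 1"

definition d23 :: poly223 where
  "d23 = xvar 1 1 1 * xvar 1 2 2 - xvar 1 1 2 * xvar 1 2 1"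

definition f3 :: poly223 where
  "f3 = (xvar 1 1 1)^2 * xvar 2 2 2 - xvar 1 1 1 * xvar 1 1 2 * xvar 2 2 1 - xvar 1 1 1 * xvar 1 2 1 * xvar 2 1 2
      - xvar 1 1 1 * xvar 1 2 2 * xvar 2 1 1 + 2 * xvar 1 1 2 * xvar 1 2 1 * xvar 2 1 1"

definition u_det :: poly223 where
  "u_det = det (vector [vector [xvar 1 1 1, xvar 1 1 2, xvar 1 1 3],
                    vector [xvar 1 2 1, xvar 1 2 2, xvar 1 2 3],
                    vector [xvar 2 1 1, xvar 2 1 2, xvar 2 1 3]] :: poly223^3^3)"

definition f4 :: poly223 where
  "f4 = (xvar 1 1 1)^2 * (xvar 2 2 2)^2
      - 2 * xvar 1 1 1 * xvar 1 1 2 * xvar 2 2 1 * xvar 2 2 2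
      - 2 * xvar 1 1 1 * xvar 1 2 1 * xvar 2 1 2 * xvar 2 2 2
      - 2 * xvar 1 1 1 * xvar 1 2 2 * xvar 2 1 1 * xvar 2 2 2
      + 4 * xvar 1 1 1 * xvar 1 2 2 * xvar 2 1 2 * xvar 2 2 1
      + (xvar 1 1 2)^2 * (xvar 2 2 1)^2
      + 4 * xvar 1 1 2 * xvar 1 2 1 * xvar 2 1 1 * xvar 2 2 2
      - 2 * xvar 1 1 2 * xvar 1 2 1 * xvar 2 1 2 * xvar 2 2 1
      - 2 * xvar 1 1 2 * xvar 1 2 2 * xvar 2 1 1 * xvar 2 2 1
      + (xvar 1 2 1)^2 * (xvar 2 1 2)^2
      - 2 * xvar 1 2 1 * xvar 1 2 2 * xvar 2 1 1 * xvar 2 1 2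
      + (xvar 1 2 2)^2 * (xvar 2 1 1)^2"

definition v_det :: poly223 where
  "v_det = det (vector [vector [0,       xvar 1 1 1, xvar 1 1 2, xvar 1 1 3],
                    vector [0,       xvar 2 1 1, xvar 2 1 2, xvar 2 1 3],
                    vector [xvar 1 1 1, xvar 1 2 1, xvar 1 2 2, xvar 1 2 3],
                    vector [xvar 2 1 1, xvar 2 2 1, xvar 2 2 2, xvar 2 2 3]] :: poly223^4^4)"

definition v_star_det :: poly223 where
  "v_star_det = det (vector [vector [0,       xvar 1 1 1, xvar 1 1 2, xvar 1 1 3],
                         vector [0,       xvar 1 2 1, xvar 1 2 2, xvar 1 2 3],
                         vector [xvar 1 1 1, xvar 2 1 1, xvar 2 1 2, xvar 2 1 3],
                         vector [xvar 1 2 1, xvar 2 2 1, xvar 2 2 2, xvar 2 2 3]] :: poly223^4^4)"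


section \<open>Relations and monomials in the thirteen generators\<close>

datatype gen = GX | GD12 | GD13 | GD23 | GF3 | GU | GF4 | GV | GVs | GF5 | GPhi | GPsi | GPsis

fun generator :: "poly223 \<Rightarrow> poly223 \<Rightarrow> poly223 \<Rightarrow> poly223 \<Rightarrow> gen \<Rightarrow> poly223" where
  "generator f5 \<phi> \<psi> \<psi>s GX = xvar 1 1 1"
| "generator f5 \<phi> \<psi> \<psi>s GD12 = d12"
| "generator f5 \<phi> \<psi> \<psi>s GD13 = d13"
| "generator f5 \<phi> \<psi> \<psi>s GD23 = d23"
| "generator f5 \<phi> \<psi> \<psi>s GF3 = f3"
| "generator f5 \<phi> \<psi> \<psi>s GU = u_det"
| "generator f5 \<phi> \<psi> \<psi>s GF4 = f4"
| "generator f5 \<phi> \<psi> \<psi>s GV = v_det"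
| "generator f5 \<phi> \<psi> \<psi>s GVs = v_star_det"
| "generator f5 \<phi> \<psi> \<psi>s GF5 = f5"
| "generator f5 \<phi> \<psi> \<psi>s GPhi = \<phi>"
| "generator f5 \<phi> \<psi> \<psi>s GPsi = \<psi>"
| "generator f5 \<phi> \<psi> \<psi>s GPsis = \<psi>s"

text \<open>For a choice \<open>\<gamma>\<close> of generators, \<open>equiv_mod_tail \<gamma> m m' t\<close> says that \<open>m \<equiv> m'\<close>, where \<open>t\<close> is the
  linear combination of monomials in the generators that equals \<open>m - m'\<close> in the polynomial ring.
  So \<open>m - m' - t\<close> is the relation expressed by \<open>m \<equiv> m'\<close>.\<close>

definition equiv_mod_tail ::
  "(gen \<Rightarrow> poly223) \<Rightarrow> gen cpoly \<Rightarrow> gen cpoly \<Rightarrow> gen cpoly \<Rightarrow> bool" where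
  "equiv_mod_tail \<gamma> m m' t \<longleftrightarrow>
     leading_monomial (subst \<gamma> m) = leading_monomial (subst \<gamma> m') \<and>
     subst \<gamma> m - subst \<gamma> m' = subst \<gamma> t \<and>
     (\<forall>n\<in>Poly_Mapping.keys t. leading_monomial (subst \<gamma> (monomial_poly n)) < leading_monomial (subst \<gamma> m))"

definition relation_heads :: "(gen cpoly \<times> gen cpoly) list" where
  "relation_heads =
   [(var GF3 ^ 2,          var GX ^ 2 * var GF4),
    (var GD23 * var GV,    var GX * var GF5),
    (var GD13 * var GVs,   var GX * var GF5),
    (var GF3 * var GV,     var GX * var GPsi),
    (var GF3 * var GVs,    var GX * var GPsis),
    (var GF3 * var GF5,    var GD23 * var GPsi),
    (var GD13 * var GPsis, var GD23 * var GPsi),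
    (var GV * var GVs,     var GX ^ 2 * var GPhi),
    (var GV * var GF5,     var GX * var GD13 * var GPhi),
    (var GVs * var GF5,    var GX * var GD23 * var GPhi),
    (var GF3 * var GPsi,   var GX * var GF4 * var GV),
    (var GF3 * var GPsis,  var GX * var GF4 * var GVs),
    (var GF5 ^ 2,          var GD13 * var GD23 * var GPhi),
    (var GVs * var GPsi,   var GX * var GF3 * var GPhi),
    (var GV * var GPsis,   var GX * var GF3 * var GPhi),
    (var GF5 * var GPsi,   var GD13 * var GF3 * var GPhi),
    (var GF5 * var GPsis,  var GD23 * var GF3 * var GPhi),
    (var GPsi ^ 2,         var GF4 * var GV ^ 2),
    (var GPsis ^ 2,        var GF4 * var GVs ^ 2),
    (var GPsi * var GPsis, var GX ^ 2 * var GF4 * var GPhi)]"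

definition basis_monomials :: "gen cpoly set" where
  "basis_monomials =
     {var GX ^ a * var GD12 ^ b * var GD13 ^ c * var GD23 ^ d * var GF3 * var GU ^ f *
        var GF4 ^ g * var GPhi ^ k | a b c d f g k. True} \<union>
     {var GX ^ a * var GD12 ^ b * var GD13 ^ c * var GD23 ^ d * var GU ^ f * var GF4 ^ g *
        var GF5 * var GPhi ^ k | a b c d f g k. True} \<union>
     {var GX ^ a * var GD12 ^ b * var GD13 ^ c * var GU ^ f * var GF4 ^ g * var GV ^ h *
        var GPhi ^ k * var GPsi ^ l | a b c f g h k l. h \<ge> 1 \<and> l \<in> {0, 1}} \<union>
     {var GX ^ a * var GD12 ^ b * var GD23 ^ d * var GU ^ f * var GF4 ^ g * var GVs ^ i *
        var GPhi ^ k * var GPsis ^ m | a b d f g i k m. i \<ge> 1 \<and> m \<in> {0, 1}} \<union>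
     {var GX ^ a * var GD12 ^ b * var GD13 ^ c * var GD23 ^ d * var GU ^ f * var GF4 ^ g *
        var GPhi ^ k * var GPsi ^ l | a b c d f g k l. c \<ge> 1 \<and> l \<in> {0, 1}} \<union>
     {var GX ^ a * var GD12 ^ b * var GD23 ^ d * var GU ^ f * var GF4 ^ g *
        var GPhi ^ k * var GPsi | a b d f g k. True} \<union>
     {var GX ^ a * var GD12 ^ b * var GD23 ^ d * var GU ^ f * var GF4 ^ g *
        var GPhi ^ k * var GPsis ^ m | a b d f g k m. m \<in> {0, 1}}"

end

theory Submission
  imports Defs
begin

text \<open>The group \<open>N\<close> moves a point with \<open>x\<^sub>1\<^sub>1\<^sub>1 d\<^sub>2\<^sub>3 \<noteq> 0\<close> to a point whose coordinates are rational functions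
  of \<open>x\<^sub>1\<^sub>1\<^sub>1, d\<^sub>1\<^sub>2, d\<^sub>1\<^sub>3, d\<^sub>2\<^sub>3, f\<^sub>3, u, v*\<close> with denominators \<open>x\<^sub>1\<^sub>1\<^sub>1\<close> and \<open>d\<^sub>2\<^sub>3\<close>. Hence for every invariant \<open>p\<close> some
  \<open>x\<^sub>1\<^sub>1\<^sub>1\<^sup>2\<^sup>N d\<^sub>2\<^sub>3\<^sup>N p\<close> lies in the algebra generated by these elements and \<open>v\<close>, and two saturation arguments
  remove the factors. Modulo \<open>d\<^sub>2\<^sub>3\<close>, restriction to a coordinate subspace sends the monomials in the eight
  elements without the factor \<open>f\<^sub>3 u = d\<^sub>1\<^sub>3 v* - d\<^sub>2\<^sub>3 v\<close> to distinct monomials, so \<open>d\<^sub>2\<^sub>3\<close> can be divided out.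
  Modulo \<open>x\<^sub>1\<^sub>1\<^sub>1\<close>, restriction to another coordinate subspace gives the monomials in the thirteen generators
  that contain no left-hand side of a relation distinct leading monomials, so \<open>x\<^sub>1\<^sub>1\<^sub>1\<close> can be divided out as
  well, and these monomials are linearly independent. Rewriting by the relations terminates in such
  monomials, which are exactly those of the seven families; this yields the basis, the generators and the
  relation ideal at once.

  The four new generators are quotients:
  \<open>x\<^sub>1\<^sub>1\<^sub>1 f\<^sub>5 = d\<^sub>2\<^sub>3 v + u f\<^sub>3 / 2\<close>, \<open>x\<^sub>1\<^sub>1\<^sub>1 \<psi> = f\<^sub>3 v - 2 d\<^sub>1\<^sub>2 d\<^sub>1\<^sub>3 u\<close>, \<open>x\<^sub>1\<^sub>1\<^sub>1 \<psi>* = f\<^sub>3 v* + 2 d\<^sub>1\<^sub>2 d\<^sub>2\<^sub>3 u\<close> and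
  \<open>x\<^sub>1\<^sub>1\<^sub>1\<^sup>2 \<phi> = v v* - d\<^sub>1\<^sub>2 u\<^sup>2\<close>. With \<open>x\<^sub>1\<^sub>1\<^sub>1\<^sup>2 f\<^sub>4 = f\<^sub>3\<^sup>2 + 4 d\<^sub>1\<^sub>2 d\<^sub>1\<^sub>3 d\<^sub>2\<^sub>3\<close>, every relation follows by cancelling \<open>x\<^sub>1\<^sub>1\<^sub>1\<close>.\<close>

section \<open>Substitution\<close>

lemma poly_mapping_sum_single:
  fixes p :: "'a \<Rightarrow>\<^sub>0 'b::comm_monoid_add"
  shows "(\<Sum>m\<in>Poly_Mapping.keys p. Poly_Mapping.single m (Poly_Mapping.lookup p m)) = p"
proof (rule poly_mapping_eqI)
  fix k
  have "(\<Sum>m\<in>Poly_Mapping.keys p. Poly_Mapping.lookup p m when m = k) = Poly_Mapping.lookup p k"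
    by (simp add: when_def sum.delta in_keys_iff)
  then show "Poly_Mapping.lookup (\<Sum>m\<in>Poly_Mapping.keys p. Poly_Mapping.single m (Poly_Mapping.lookup p m)) k
      = Poly_Mapping.lookup p k"
    by (simp add: lookup_sum lookup_single)
qed

lemma const_poly_simps:
  "const_poly 0 = 0" "const_poly 1 = 1"
  "const_poly (a + b) = const_poly a + const_poly b"
  "const_poly (a - b) = const_poly a - const_poly b"
  "const_poly (a * b) = const_poly a * const_poly b"
  "const_poly (- a) = - const_poly a"
  by (simp_all add: const_poly_def single_add single_diff mult_single single_uminus)

lemma const_poly_numeral: "const_poly (numeral n) = numeral n"
  by (simp add: const_poly_def)

lemma const_poly_power: "const_poly (a ^ n) = const_poly a ^ n"
  by (induction n) (simp_all add: const_poly_simps)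

lemma const_poly_eq_0_iff: "const_poly a = 0 \<longleftrightarrow> a = 0"
  by (metis const_poly_def const_poly_simps(1) lookup_single_eq)

definition mono_value :: "('v \<Rightarrow> 'w cpoly) \<Rightarrow> 'v monomial \<Rightarrow> 'w cpoly" where
  "mono_value \<sigma> m = (\<Prod>v\<in>Poly_Mapping.keys m. \<sigma> v ^ Poly_Mapping.lookup m v)"

lemma mono_value_superset:
  assumes "finite V" "Poly_Mapping.keys m \<subseteq> V"
  shows "mono_value \<sigma> m = (\<Prod>v\<in>V. \<sigma> v ^ Poly_Mapping.lookup m v)"
  unfolding mono_value_def using assms by (intro prod.mono_neutral_left) (auto simp: in_keys_iff)

lemma mono_value_add: "mono_value \<sigma> (m + n) = mono_value \<sigma> m * mono_value \<sigma> n"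
proof -
  let ?V = "Poly_Mapping.keys m \<union> Poly_Mapping.keys n"
  have "Poly_Mapping.keys (m + n) \<subseteq> ?V" by (rule keys_add)
  then show ?thesis
    by (simp add: mono_value_superset[of ?V] lookup_add power_add prod.distrib)
qed

lemma mono_value_0 [simp]: "mono_value \<sigma> 0 = 1"
  by (simp add: mono_value_def)

lemma mono_value_single: "mono_value \<sigma> (Poly_Mapping.single v k) = \<sigma> v ^ k"
  by (simp add: mono_value_def)

lemma subst_alt:
  "subst \<sigma> p = (\<Sum>m\<in>Poly_Mapping.keys p. const_poly (Poly_Mapping.lookup p m) * mono_value \<sigma> m)"
  by (simp add: subst_def mono_value_def)

lemma subst_add: "subst \<sigma> (p + q) = subst \<sigma> p + subst \<sigma> q"
  unfolding subst_alt
  \<comment> \<open>Cancellation may make the support of \<open>p + q\<close> smaller than the union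
    of the supports; the summand is additive in the coefficient and vanishes at 0, so the sum is the
    same.\<close>
  by (rule setsum_keys_plus_distrib[where f = "\<lambda>m c. const_poly c * mono_value \<sigma> m"])
    (simp_all add: const_poly_simps algebra_simps)

lemma subst_0 [simp]: "subst \<sigma> 0 = 0"
  by (simp add: subst_alt)

lemma subst_single: "subst \<sigma> (Poly_Mapping.single m c) = const_poly c * mono_value \<sigma> m"
  by (simp add: subst_alt const_poly_simps)

lemma subst_sum: "subst \<sigma> (sum f A) = (\<Sum>a\<in>A. subst \<sigma> (f a))"
  by (induction A rule: infinite_finite_induct) (simp_all add: subst_add)

text \<open>A polynomial is the sum of its terms. Zero counts as a term with coefficient 0, so there
  is no separate base case.\<close>

lemma cpoly_induct_single [case_names single add]:
  assumes "\<And>m c. Q (Poly_Mapping.single m c)" "\<And>p q. Q p \<Longrightarrow> Q q \<Longrightarrow> Q (p + q)"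
  shows "Q (p :: 'v cpoly)"
proof -
  have "Q 0" using assms(1)[of undefined 0] by simp
  then have "Q (\<Sum>m\<in>A. Poly_Mapping.single m (Poly_Mapping.lookup p m))" for A
    by (induction A rule: infinite_finite_induct) (simp_all add: assms)
  from this[of "Poly_Mapping.keys p"] show ?thesis by (simp add: poly_mapping_sum_single)
qed

lemma subst_mult: "subst \<sigma> (p * q) = subst \<sigma> p * subst \<sigma> q"
proof (induction p rule: cpoly_induct_single)
  case (single m c)
  show ?case
  proof (induction q rule: cpoly_induct_single)
    case (single n d)
    then show ?case by (simp add: mult_single subst_single mono_value_add const_poly_simps)
  qed (simp add: subst_add distrib_left)
qed (simp add: subst_add distrib_right)

lemma subst_const [simp]: "subst \<sigma> (const_poly c) = const_poly c"
  unfolding const_poly_def[of c] subst_single by (simp add: const_poly_def)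

lemma subst_1 [simp]: "subst \<sigma> 1 = 1"
  using subst_const[of \<sigma> 1] by (simp add: const_poly_simps)

lemma subst_numeral [simp]: "subst \<sigma> (numeral n) = numeral n"
  using subst_const[of \<sigma> "numeral n"] by (simp add: const_poly_numeral)

lemma subst_var [simp]: "subst \<sigma> (var v) = \<sigma> v"
  by (simp add: var_def subst_single mono_value_single const_poly_simps)

lemma subst_uminus: "subst \<sigma> (- p) = - subst \<sigma> p"
  using subst_add[of \<sigma> p "- p"] by (simp add: eq_neg_iff_add_eq_0 add.commute)

lemma subst_diff: "subst \<sigma> (p - q) = subst \<sigma> p - subst \<sigma> q"
  using subst_add[of \<sigma> p "- q"] by (simp add: subst_uminus)

lemma subst_power: "subst \<sigma> (p ^ n) = subst \<sigma> p ^ n"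
  by (induction n) (simp_all add: subst_mult)

lemmas subst_hom = subst_add subst_diff subst_uminus subst_mult subst_power subst_sum

lemma var_power: "var v ^ k = Poly_Mapping.single (Poly_Mapping.single v k) 1"
  by (induction k) (simp_all add: var_def mult_single single_add[symmetric])

lemma single_eq_mono_value: "Poly_Mapping.single m c = const_poly c * mono_value var m"
proof -
  have "(\<Prod>v\<in>A. Poly_Mapping.single (f v) (1::complex)) = Poly_Mapping.single (\<Sum>v\<in>A. f v) 1"
    if "finite A" for A and f :: "'a \<Rightarrow> 'a monomial"
    using that by induction (simp_all add: mult_single)
  then have "mono_value var m = Poly_Mapping.single m 1"
    by (simp add: mono_value_def var_power poly_mapping_sum_single)
  then show ?thesis by (simp add: const_poly_def mult_single)
qed

text \<open>Constants and variables generate the polynomial ring as an algebra, so a property that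
  is stable under sums and products needs checking only on them.\<close>

lemma cpoly_induct [case_names const var add mult]:
  assumes "\<And>c. Q (const_poly c)" "\<And>v. Q (var v)"
    "\<And>p q. Q p \<Longrightarrow> Q q \<Longrightarrow> Q (p + q)" "\<And>p q. Q p \<Longrightarrow> Q q \<Longrightarrow> Q (p * q)"
  shows "Q (p :: 'v cpoly)"
proof (induction p rule: cpoly_induct_single)
  case (single m c)
  have one: "Q 1" using assms(1)[of 1] by (simp add: const_poly_simps)
  have "Q (var v ^ k)" for v k
    by (induction k) (simp_all add: one assms)
  then have "Q (\<Prod>v\<in>A. var v ^ Poly_Mapping.lookup m v)" for A
    by (induction A rule: infinite_finite_induct) (simp_all add: one assms)
  then show ?case
    unfolding single_eq_mono_value by (simp add: assms mono_value_def)
qed (rule assms)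

lemma subst_subst: "subst \<sigma> (subst \<tau> p) = subst (\<lambda>v. subst \<sigma> (\<tau> v)) p"
  by (induction p rule: cpoly_induct) (simp_all add: subst_hom)

lemma monomial_poly_add: "monomial_poly (m + n) = monomial_poly m * monomial_poly n"
  by (simp add: monomial_poly_def mult_single)

lemma subst_monomial_poly: "subst \<sigma> (monomial_poly m) = mono_value \<sigma> m"
  by (simp add: monomial_poly_def subst_single const_poly_simps)

lemma lookup_const_mult: "Poly_Mapping.lookup (const_poly c * p) m = c * Poly_Mapping.lookup p m"
proof (induction p rule: cpoly_induct_single)
  case (single n d)
  show ?case by (simp add: const_poly_def mult_single lookup_single when_def)
qed (simp add: distrib_left lookup_add)

text \<open>Translation by \<open>n\<close> is injective on exponents, so only one term of
  \<open>p\<close> contributes to the coefficient.\<close>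

lemma lookup_single_mult:
  "Poly_Mapping.lookup (Poly_Mapping.single n c * p) (n + m) = c * Poly_Mapping.lookup (p :: 'v cpoly) m"
proof (induction p rule: cpoly_induct_single)
  case (single k d)
  show ?case by (simp add: mult_single lookup_single when_def)
qed (simp add: distrib_left lookup_add)

text \<open>Dedekind: the monomials are distinct characters of the multiplicative monoid of points, hence
  linearly independent functions.\<close>

lemma monomial_functions_independent:
  fixes c :: "'v monomial \<Rightarrow> complex"
  assumes "finite A" "\<And>P. (\<Sum>m\<in>A. c m * (\<Prod>v\<in>Poly_Mapping.keys m. P v ^ Poly_Mapping.lookup m v)) = 0"
  shows "\<forall>m\<in>A. c m = 0"
  using assms
proof (induction A arbitrary: c rule: finite_induct)
  case (insert n A)
  define ch :: "'v monomial \<Rightarrow> ('v \<Rightarrow> complex) \<Rightarrow> complex"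
    where "ch m P = (\<Prod>v\<in>Poly_Mapping.keys m. P v ^ Poly_Mapping.lookup m v)" for m P
  have mult: "ch m (\<lambda>v. P v * Q v) = ch m P * ch m Q" for m P Q
    by (simp add: ch_def power_mult_distrib prod.distrib)
  have z: "(\<Sum>m\<in>insert n A. c m * ch m P) = 0" for P
    using insert.prems by (simp add: ch_def)
  have "c m = 0" if m: "m \<in> A" for m
  proof -
    from m insert.hyps have "m \<noteq> n" by auto
    then obtain v where v: "Poly_Mapping.lookup m v \<noteq> Poly_Mapping.lookup n v"
      by (meson poly_mapping_eqI)
    \<comment> \<open>The character of \<open>k\<close> takes at \<open>Q\<close> the value 2 to the
      exponent of \<open>v\<close> in \<open>k\<close>, which separates \<open>m\<close> from
      \<open>n\<close>.\<close>
    define Q :: "'v \<Rightarrow> complex" where "Q w = (if w = v then 2 else 1)" for w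
    have chQ: "ch k Q = 2 ^ Poly_Mapping.lookup k v" for k
    proof -
      have "ch k Q = (\<Prod>w\<in>Poly_Mapping.keys k. if w = v then 2 ^ Poly_Mapping.lookup k v else 1)"
        unfolding ch_def by (rule prod.cong) (auto simp: Q_def)
      also have "\<dots> = 2 ^ Poly_Mapping.lookup k v"
        by (simp add: prod.delta in_keys_iff)
      finally show ?thesis .
    qed
    \<comment> \<open>Scaling the argument by \<open>Q\<close> and subtracting \<open>ch n Q\<close>
      times the original relation removes the term of \<open>n\<close>.\<close>
    have "(\<Sum>m\<in>A. (c m * (ch m Q - ch n Q)) * ch m P) = 0" for P
    proof -
      have "(\<Sum>m\<in>A. (c m * (ch m Q - ch n Q)) * ch m P)
          = (\<Sum>m\<in>insert n A. c m * ch m (\<lambda>v. Q v * P v)) - ch n Q * (\<Sum>m\<in>insert n A. c m * ch m P)"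
        using insert.hyps by (simp add: mult algebra_simps sum_subtractf sum_distrib_left)
      then show ?thesis by (simp only: z) simp
    qed
    then have "\<forall>m\<in>A. c m * (ch m Q - ch n Q) = 0"
      by (intro insert.IH) (simp add: ch_def)
    moreover have "ch m Q - ch n Q \<noteq> 0"
    proof -
      have "(2::complex) ^ Poly_Mapping.lookup m v = of_nat (2 ^ Poly_Mapping.lookup m v)"
        "(2::complex) ^ Poly_Mapping.lookup n v = of_nat (2 ^ Poly_Mapping.lookup n v)" by simp_all
      moreover have "(2::nat) ^ Poly_Mapping.lookup m v \<noteq> 2 ^ Poly_Mapping.lookup n v" using v by simp
      ultimately show ?thesis unfolding chQ by (metis eq_iff_diff_eq_0 of_nat_eq_iff)
    qed
    ultimately show ?thesis using m by auto
  qed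
  moreover from this have "c n = 0"
  proof -
    \<comment> \<open>At the point with all coordinates 1 every character is 1, which leaves
      \<open>c n\<close> alone in the relation.\<close>
    have "(\<Sum>m\<in>A. c m * ch m (\<lambda>_. 1)) = 0" using \<open>\<And>m. m \<in> A \<Longrightarrow> c m = 0\<close> by simp
    then show ?thesis using z[of "\<lambda>_. 1"] insert.hyps by (simp add: ch_def)
  qed
  ultimately show ?case by auto
qed simp

text \<open>A point is a substitution of constant polynomials, so evaluation is an instance of
  \<open>subst\<close>. The target ring is arbitrary because the constants embed injectively in each
  one.\<close>

lemma vanishing_poly_eq_0:
  fixes p :: "'v cpoly"
  assumes "\<And>P :: 'v \<Rightarrow> complex. subst (\<lambda>v. const_poly (P v) :: 'w cpoly) p = 0"
  shows "p = 0"
proof -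
  have "(\<Sum>m\<in>Poly_Mapping.keys p. Poly_Mapping.lookup p m * (\<Prod>v\<in>Poly_Mapping.keys m. P v ^ Poly_Mapping.lookup m v)) = 0" for P
  proof -
    have s: "const_poly (sum f A) = (\<Sum>a\<in>A. const_poly (f a))" for f and A :: "'v monomial set"
      by (induction A rule: infinite_finite_induct) (simp_all add: const_poly_simps)
    have pr: "const_poly (prod f A) = (\<Prod>a\<in>A. const_poly (f a))" for f and A :: "'v set"
      by (induction A rule: infinite_finite_induct) (simp_all add: const_poly_simps)
    have "const_poly (\<Sum>m\<in>Poly_Mapping.keys p. Poly_Mapping.lookup p m * (\<Prod>v\<in>Poly_Mapping.keys m. P v ^ Poly_Mapping.lookup m v)) = (0 :: 'w cpoly)"
      using assms[of P] by (simp add: subst_def s pr const_poly_simps const_poly_power)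
    then show ?thesis by (simp add: const_poly_eq_0_iff)
  qed
  then have "\<forall>m\<in>Poly_Mapping.keys p. Poly_Mapping.lookup p m = 0"
    by (intro monomial_functions_independent) auto
  then show ?thesis by (simp add: in_keys_iff poly_mapping_eq_iff fun_eq_iff) 
qed

section \<open>Leading terms, saturation and rewriting\<close>

definition below :: "'v::linorder cpoly \<Rightarrow> 'v monomial \<Rightarrow> bool" where
  "below p m \<longleftrightarrow> (\<forall>k\<in>Poly_Mapping.keys p. k < m)"

text \<open>A relation instead of a maximum of the support: products and additions of lower terms
  are handled without treating the zero polynomial separately.\<close>

definition lead :: "'v::linorder cpoly \<Rightarrow> 'v monomial \<Rightarrow> complex \<Rightarrow> bool" where
  "lead p m c \<longleftrightarrow> c \<noteq> 0 \<and> below (p - Poly_Mapping.single m c) m"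

lemma below_add: "below p m \<Longrightarrow> below q m \<Longrightarrow> below (p + q) m"
  using keys_add[of p q] by (auto simp: below_def)

lemma below_diff: "below p m \<Longrightarrow> below q m \<Longrightarrow> below (p - q) m"
  using keys_diff[of p q] by (auto simp: below_def)

lemma below_single_mult: "below p m \<Longrightarrow> below (Poly_Mapping.single n c * p) (n + m)"
  using keys_mult[of "Poly_Mapping.single n c" p]
  by (fastforce simp: below_def split: if_splits)

lemma below_mult: "below p m \<Longrightarrow> below q n \<Longrightarrow> below (p * q) (m + n)"
  using keys_mult[of p q] by (fastforce simp: below_def intro: add_strict_mono)

lemma lead_lookup: "lead p m c \<Longrightarrow> Poly_Mapping.lookup p m = c"
proof -
  assume "lead p m c"
  then have "m \<notin> Poly_Mapping.keys (p - Poly_Mapping.single m c)" by (auto simp: lead_def below_def)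
  then show ?thesis by (simp add: in_keys_iff lookup_minus)
qed

lemma lead_le: "lead p m c \<Longrightarrow> k \<in> Poly_Mapping.keys p \<Longrightarrow> k \<le> m"
proof -
  assume l: "lead p m c" and k: "k \<in> Poly_Mapping.keys p"
  show ?thesis
  proof (cases "k = m")
    case False
    then have "k \<in> Poly_Mapping.keys (p - Poly_Mapping.single m c)"
      using k by (simp add: in_keys_iff lookup_minus lookup_single)
    then show ?thesis using l by (auto simp: lead_def below_def)
  qed simp
qed

lemma lead_in_keys: "lead p m c \<Longrightarrow> m \<in> Poly_Mapping.keys p"
  using lead_lookup[of p m c] by (auto simp: in_keys_iff lead_def)

lemma leadI:
  assumes "Poly_Mapping.lookup p m = c" "c \<noteq> 0" "\<And>k. k \<in> Poly_Mapping.keys p \<Longrightarrow> k \<le> m"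
  shows "lead p m c"
  unfolding lead_def below_def
proof (intro conjI ballI)
  fix k assume "k \<in> Poly_Mapping.keys (p - Poly_Mapping.single m c)"
  then have "k \<noteq> m" "k \<in> Poly_Mapping.keys p" using assms(1)
    by (auto simp: in_keys_iff lookup_minus lookup_single when_def split: if_splits)
  then show "k < m" using assms(3) by force
qed (rule assms)

lemma lead_unique: "lead p m c \<Longrightarrow> lead p n d \<Longrightarrow> m = n \<and> c = d"
proof -
  assume a: "lead p m c" "lead p n d"
  then have "m \<in> Poly_Mapping.keys p" "n \<in> Poly_Mapping.keys p"
    by (auto dest: lead_in_keys)
  then have "m = n" using a by (meson lead_le order_antisym)
  then show ?thesis using a by (auto dest: lead_lookup)
qed

lemma lead_exists: "p \<noteq> 0 \<Longrightarrow> \<exists>m c. lead p m c"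
proof -
  assume "p \<noteq> 0"
  then have "Poly_Mapping.keys p \<noteq> {}" by simp
  then have "Max (Poly_Mapping.keys p) \<in> Poly_Mapping.keys p" by simp
  then have "lead p (Max (Poly_Mapping.keys p)) (Poly_Mapping.lookup p (Max (Poly_Mapping.keys p)))"
    by (intro leadI) (auto simp: in_keys_iff)
  then show ?thesis by blast
qed

lemma lead_nonzero: "lead p m c \<Longrightarrow> p \<noteq> 0"
  using lead_lookup[of p m c] by (auto simp: lead_def)

lemma lead_below: "lead p k c \<Longrightarrow> k < m \<Longrightarrow> below p m"
  by (auto simp: below_def dest!: lead_le)

text \<open>The order on exponents is invariant under translation and the coefficients have no zero
  divisors, so every term of the expanded product except the product of the leading terms is
  lower.\<close>

lemma lead_mult:
  assumes "lead p m c" "lead q n d"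
  shows "lead (p * q) (m + n) (c * d)"
proof -
  define p' where "p' = p - Poly_Mapping.single m c"
  define q' where "q' = q - Poly_Mapping.single n d"
  have b: "below p' m" "below q' n" "c \<noteq> 0" "d \<noteq> 0"
    using assms by (auto simp: lead_def p'_def q'_def)
  have "p * q - Poly_Mapping.single (m + n) (c * d)
      = Poly_Mapping.single m c * q' + Poly_Mapping.single n d * p' + p' * q'"
    by (simp add: p'_def q'_def mult_single[symmetric] algebra_simps)
  moreover have "below (Poly_Mapping.single n d * p') (m + n)"
    using below_single_mult[OF b(1), of n d] by (simp add: add.commute)
  ultimately show ?thesis
    unfolding lead_def using b by (auto intro!: below_add below_single_mult below_mult)
qed

lemma lead_add_below: "lead p m c \<Longrightarrow> below q m \<Longrightarrow> lead (p + q) m c"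
  unfolding lead_def using below_add[of "p - Poly_Mapping.single m c" m q] by (simp add: algebra_simps)

lemma lead_diff_below: "lead p m c \<Longrightarrow> below q m \<Longrightarrow> lead (p - q) m c"
  unfolding lead_def using below_diff[of "p - Poly_Mapping.single m c" m q] by (simp add: algebra_simps)

lemma lead_single: "c \<noteq> 0 \<Longrightarrow> lead (Poly_Mapping.single m c) m c"
  by (simp add: lead_def below_def)

lemma lead_const: "c \<noteq> 0 \<Longrightarrow> lead (const_poly c) 0 c"
  unfolding const_poly_def by (rule lead_single)

lemma lead_var: "lead (var v) (Poly_Mapping.single v 1) 1"
  unfolding var_def by (rule lead_single) simp

text \<open>By uniqueness, the leading term of a quotient can be read off from that of the
  numerator; \<open>f4\<close> and the four new generators obtain theirs in this way.\<close>

lemma lead_cancel: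
  assumes "lead (p * q) (m + n) (c * d)" "lead p m c"
  shows "lead q n d"
proof -
  have "q \<noteq> 0" using lead_nonzero[OF assms(1)] by auto
  then obtain k e where l: "lead q k e" using lead_exists by blast
  have "m + n = m + k \<and> c * d = c * e" by (rule lead_unique[OF assms(1) lead_mult[OF assms(2) l]])
  then show ?thesis using l assms(2) by (auto simp: lead_def)
qed

lemma lead_leading_monomial: "lead p m c \<Longrightarrow> leading_monomial p = m"
proof -
  assume l: "lead p m c"
  then have "m \<in> Poly_Mapping.keys p" by (rule lead_in_keys)
  then show ?thesis unfolding leading_monomial_def using l by (intro Max_eqI) (auto dest: lead_le)
qed

lemma lead_leading_coeff: "lead p m c \<Longrightarrow> leading_coeff p = c"
  by (simp add: leading_coeff_def lead_leading_monomial lead_lookup)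

section \<open>Additive maps of exponents and linear independence\<close>

definition linear_monomial :: "('g \<Rightarrow> 'v monomial) \<Rightarrow> 'g monomial \<Rightarrow> 'v monomial" where
  "linear_monomial \<mu> n = (\<Sum>g\<in>Poly_Mapping.keys n. ((+) (\<mu> g) ^^ Poly_Mapping.lookup n g) 0)"

lemma lookup_funpow_add: "Poly_Mapping.lookup (((+) m ^^ k) 0) v = k * Poly_Mapping.lookup (m :: 'v monomial) v"
  by (induction k) (simp_all add: lookup_add)

lemma lookup_linear_monomial:
  "Poly_Mapping.lookup (linear_monomial \<mu> n) v =
     (\<Sum>g\<in>Poly_Mapping.keys n. Poly_Mapping.lookup n g * Poly_Mapping.lookup (\<mu> g) v)"
  by (simp add: linear_monomial_def lookup_sum lookup_funpow_add)

lemma lookup_linear_monomial_superset: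
  assumes "finite V" "Poly_Mapping.keys n \<subseteq> V"
  shows "Poly_Mapping.lookup (linear_monomial \<mu> n) v =
     (\<Sum>g\<in>V. Poly_Mapping.lookup n g * Poly_Mapping.lookup (\<mu> g) v)"
  unfolding lookup_linear_monomial using assms by (intro sum.mono_neutral_left) (auto simp: in_keys_iff)

lemma lead_mono_value:
  fixes \<mu> :: "'g \<Rightarrow> 'v::linorder monomial"
  assumes "\<And>g. g \<in> Poly_Mapping.keys n \<Longrightarrow> lead (\<sigma> g) (\<mu> g) (c g)"
  shows "lead (mono_value \<sigma> n) (linear_monomial \<mu> n) (\<Prod>g\<in>Poly_Mapping.keys n. c g ^ Poly_Mapping.lookup n g)"
proof -
  have one: "lead (1 :: 'v cpoly) 0 1" using lead_const[of 1] by (simp add: const_poly_simps)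
  have pow: "lead (\<sigma> g ^ k) (((+) (\<mu> g) ^^ k) 0) (c g ^ k)" if "g \<in> Poly_Mapping.keys n" for g k
    by (induction k) (simp_all add: one lead_mult assms that)
  have "lead (\<Prod>g\<in>A. \<sigma> g ^ Poly_Mapping.lookup n g) (\<Sum>g\<in>A. ((+) (\<mu> g) ^^ Poly_Mapping.lookup n g) 0)
    (\<Prod>g\<in>A. c g ^ Poly_Mapping.lookup n g)" if "finite A" "A \<subseteq> Poly_Mapping.keys n" for A
    using that by induction (simp_all add: one lead_mult pow)
  then show ?thesis by (simp add: mono_value_def linear_monomial_def)
qed

text \<open>As the leading monomials are distinct, the largest of them occurs in the image of one
  monomial only, so nothing can cancel it.\<close>

lemma independent_of_leads:
  fixes \<sigma> :: "'g \<Rightarrow> 'v::linorder cpoly"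
  assumes lead: "\<And>n. n \<in> Poly_Mapping.keys q \<Longrightarrow> lead (mono_value \<sigma> n) (L n) (c n)"
    and inj: "inj_on L (Poly_Mapping.keys q)" and zero: "subst \<sigma> q = 0"
  shows "q = 0"
proof (rule ccontr)
  assume "q \<noteq> 0"
  then have ne: "L ` Poly_Mapping.keys q \<noteq> {}" by simp
  define M where "M = Max (L ` Poly_Mapping.keys q)"
  have "M \<in> L ` Poly_Mapping.keys q" unfolding M_def using ne by (intro Max_in) auto
  then obtain n where n: "n \<in> Poly_Mapping.keys q" "L n = M" by auto
  have other: "Poly_Mapping.lookup (mono_value \<sigma> k) M = 0" if k: "k \<in> Poly_Mapping.keys q" "k \<noteq> n" for k
  proof -
    have "L k \<le> M" unfolding M_def using k by (intro Max_ge) auto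
    moreover have "L k \<noteq> M" using k n inj by (auto simp: inj_on_def)
    ultimately have "L k < M" by simp
    then have "below (mono_value \<sigma> k) M" using lead_below[OF lead[OF k(1)]] by blast
    then have "M \<notin> Poly_Mapping.keys (mono_value \<sigma> k)" by (auto simp: below_def)
    then show ?thesis by (simp add: in_keys_iff)
  qed
  have "0 = Poly_Mapping.lookup (subst \<sigma> q) M" by (simp add: zero)
  also have "\<dots> = (\<Sum>k\<in>Poly_Mapping.keys q. Poly_Mapping.lookup q k * Poly_Mapping.lookup (mono_value \<sigma> k) M)"
    by (simp add: subst_alt lookup_sum lookup_const_mult)
  also have "\<dots> = (\<Sum>k\<in>{n}. Poly_Mapping.lookup q k * Poly_Mapping.lookup (mono_value \<sigma> k) M)"
    using n other by (intro sum.mono_neutral_right) auto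
  also have "\<dots> = Poly_Mapping.lookup q n * c n"
    using lead_lookup[OF lead[OF n(1)]] n by simp
  also have "\<dots> \<noteq> 0" using lead[OF n(1)] n(1) by (simp add: lead_def in_keys_iff)
  finally show False by simp
qed

lemma keys_var_mult: "n \<in> Poly_Mapping.keys q \<Longrightarrow> n + Poly_Mapping.single g 1 \<in> Poly_Mapping.keys (var g * q)"
  using lookup_single_mult[of "Poly_Mapping.single g 1" 1 q n]
  by (simp add: in_keys_iff var_def add.commute)

text \<open>If \<open>\<rho>\<close> kills \<open>\<gamma> g\<close> and separates the monomials of \<open>M\<close> without \<open>g\<close>, then the span of the
  monomials of \<open>M\<close> in \<open>\<gamma>\<close> is saturated with respect to \<open>\<gamma> g\<close>.\<close>

locale saturated =
  fixes \<gamma> :: "'g \<Rightarrow> 'v::linorder cpoly" and \<rho> :: "'v \<Rightarrow> 'v cpoly" and g :: 'g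
    and M :: "'g monomial set" and L :: "'g monomial \<Rightarrow> 'v monomial" and c :: "'g monomial \<Rightarrow> complex"
  assumes kills: "subst \<rho> (\<gamma> g) = 0" and nonzero: "\<gamma> g \<noteq> 0"
    and leads: "\<And>n. n \<in> M \<Longrightarrow> Poly_Mapping.lookup n g = 0 \<Longrightarrow>
      lead (mono_value (\<lambda>h. subst \<rho> (\<gamma> h)) n) (L n) (c n)"
    and inj: "inj_on L {n \<in> M. Poly_Mapping.lookup n g = 0}"
    and divisor: "\<And>n. n + Poly_Mapping.single g 1 \<in> M \<Longrightarrow> n \<in> M"
begin

text \<open>The terms of \<open>q\<close> free of \<open>g\<close> form \<open>q0\<close>. Since
  \<open>\<rho>\<close> kills \<open>\<gamma> g\<close>, it sends the value of \<open>q0\<close> to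
  0, and independence after restriction gives \<open>q0 = 0\<close>. What remains is a multiple of
  \<open>var g\<close>, and \<open>\<gamma> g\<close> cancels.\<close>

lemma divide:
  assumes q: "Poly_Mapping.keys q \<subseteq> M" and eq: "subst \<gamma> q = \<gamma> g * p"
  shows "\<exists>q'. q = var g * q' \<and> Poly_Mapping.keys q' \<subseteq> M \<and> p = subst \<gamma> q'"
proof -
  let ?A = "{n \<in> Poly_Mapping.keys q. Poly_Mapping.lookup n g = 0}"
  let ?B = "{n \<in> Poly_Mapping.keys q. Poly_Mapping.lookup n g \<noteq> 0}"
  let ?e = "Poly_Mapping.single g (1::nat)"
  define q0 where "q0 = (\<Sum>n\<in>?A. Poly_Mapping.single n (Poly_Mapping.lookup q n))"
  define q' where "q' = (\<Sum>n\<in>?B. Poly_Mapping.single (n - ?e) (Poly_Mapping.lookup q n))"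
  \<comment> \<open>The truncated subtraction of exponents is exact because \<open>g\<close> occurs
    in \<open>n\<close>.\<close>
  have restore: "n - ?e + ?e = n" if "n \<in> ?B" for n
    using that by (intro poly_mapping_eqI) (auto simp: lookup_add lookup_minus lookup_single when_def)
  have "var g * q' = (\<Sum>n\<in>?B. Poly_Mapping.single n (Poly_Mapping.lookup q n))"
    unfolding q'_def sum_distrib_left
    by (intro sum.cong refl) (simp only: var_def mult_single add.commute[of ?e] restore mult_1)
  moreover have "q = (\<Sum>n\<in>?A \<union> ?B. Poly_Mapping.single n (Poly_Mapping.lookup q n))"
  proof -
    have "?A \<union> ?B = Poly_Mapping.keys q" by auto
    then show ?thesis by (simp add: poly_mapping_sum_single)
  qed
  moreover have "(\<Sum>n\<in>?A \<union> ?B. Poly_Mapping.single n (Poly_Mapping.lookup q n))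
     = q0 + (\<Sum>n\<in>?B. Poly_Mapping.single n (Poly_Mapping.lookup q n))"
    unfolding q0_def by (intro sum.union_disjoint) auto
  ultimately have split: "q = q0 + var g * q'" by simp
  have k0: "Poly_Mapping.keys q0 \<subseteq> ?A"
    unfolding q0_def by (rule order_trans[OF keys_sum]) auto
  have "subst (\<lambda>h. subst \<rho> (\<gamma> h)) q0 = subst \<rho> (subst \<gamma> q)"
    by (simp add: split subst_hom kills subst_subst)
  also have "\<dots> = 0" by (simp add: eq subst_hom kills)
  finally have "subst (\<lambda>h. subst \<rho> (\<gamma> h)) q0 = 0" .
  moreover have "inj_on L (Poly_Mapping.keys q0)"
    using k0 q by (intro inj_on_subset[OF inj]) auto
  ultimately have "q0 = 0"
    using k0 q by (intro independent_of_leads[of q0 "\<lambda>h. subst \<rho> (\<gamma> h)" L c]) (auto intro: leads)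
  with split have q_eq: "q = var g * q'" by simp
  have "\<gamma> g * p = \<gamma> g * subst \<gamma> q'" using eq unfolding q_eq subst_mult subst_var by (rule sym)
  then have "p = subst \<gamma> q'" using nonzero by simp
  moreover have "Poly_Mapping.keys q' \<subseteq> M"
  proof
    fix n assume "n \<in> Poly_Mapping.keys q'"
    then have "n + ?e \<in> Poly_Mapping.keys q" unfolding q_eq by (rule keys_var_mult)
    then show "n \<in> M" using q divisor by blast
  qed
  ultimately show ?thesis using q_eq by blast
qed

lemma divide_power:
  assumes "Poly_Mapping.keys q \<subseteq> M" and "subst \<gamma> q = \<gamma> g ^ k * p"
  shows "\<exists>q'. Poly_Mapping.keys q' \<subseteq> M \<and> p = subst \<gamma> q'"
  using assms
proof (induction k arbitrary: q)
  case (Suc k)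
  then show ?case using divide[of q "\<gamma> g ^ k * p"] by (auto simp: mult.assoc)
qed (auto intro: exI[of _ q])

text \<open>Division with \<open>p = 0\<close> strips a factor \<open>var g\<close> from a relation;
  a bound on the exponents of \<open>g\<close> makes this descent end at the zero
  polynomial.\<close>

lemma independent:
  assumes "Poly_Mapping.keys q \<subseteq> M" and "subst \<gamma> q = 0"
  shows "q = 0"
proof -
  have "q = 0" if "\<forall>n\<in>Poly_Mapping.keys q. Poly_Mapping.lookup n g < N"
    "Poly_Mapping.keys q \<subseteq> M" "subst \<gamma> q = 0" for N q
    using that
  proof (induction N arbitrary: q)
    case (Suc N)
    then obtain q' where q': "q = var g * q'" "Poly_Mapping.keys q' \<subseteq> M" "0 = subst \<gamma> q'"
      using divide[of q 0] by auto
    have "q' = 0"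
    proof (rule Suc.IH)
      show "\<forall>n\<in>Poly_Mapping.keys q'. Poly_Mapping.lookup n g < N"
        using Suc.prems(1) keys_var_mult[of _ q' g] by (force simp: q'(1) lookup_add)
    qed (use q' in auto)
    then show ?case by (simp add: q')
  next
    case 0
    then have "Poly_Mapping.keys q = {}" by auto
    then show ?case by simp
  qed
  moreover have "\<exists>N. \<forall>n\<in>Poly_Mapping.keys q. Poly_Mapping.lookup n g < N"
    using finite_nat_set_iff_bounded[of "(\<lambda>n. Poly_Mapping.lookup n g) ` Poly_Mapping.keys q"] by auto
  ultimately show ?thesis using assms by blast
qed

end

section \<open>Additive gradings and terminating rewriting\<close>

definition weight :: "('g \<Rightarrow> nat) \<Rightarrow> 'g monomial \<Rightarrow> nat" where
  "weight W n = (\<Sum>g\<in>Poly_Mapping.keys n. Poly_Mapping.lookup n g * W g)"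

lemma weight_add: "weight W (m + n) = weight W m + weight W n"
proof -
  let ?V = "Poly_Mapping.keys m \<union> Poly_Mapping.keys n"
  have sup: "weight W k = (\<Sum>g\<in>?V. Poly_Mapping.lookup k g * W g)" if "Poly_Mapping.keys k \<subseteq> ?V" for k
    unfolding weight_def using that by (intro sum.mono_neutral_left) (auto simp: in_keys_iff)
  show ?thesis
    using keys_add[of m n] by (simp add: sup lookup_add sum.distrib distrib_right)
qed

lemma weight_single: "weight W (Poly_Mapping.single g k) = k * W g"
  by (simp add: weight_def)

text \<open>\<open>J\<close> is an ideal, \<open>H\<close> holds the monomials to be rewritten, and
  \<open>C\<close> confines the variables that occur. As \<open>W\<close> is additive, it also drops
  for multiples of a rule, so rewriting ends. \<open>J\<close> is kept general to serve both for the
  relation ideal and for the kernel of a substitution.\<close>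

lemma reduction:
  fixes J :: "'g cpoly set"
  assumes J0: "0 \<in> J" and Jadd: "\<And>p q. p \<in> J \<Longrightarrow> q \<in> J \<Longrightarrow> p + q \<in> J"
    and Jmult: "\<And>p q. p \<in> J \<Longrightarrow> q * p \<in> J"
    and rule: "\<And>h. h \<in> H \<Longrightarrow> \<exists>r. monomial_poly h - r \<in> J \<and>
      (\<forall>n\<in>Poly_Mapping.keys r. weight W n < weight W h \<and> Poly_Mapping.keys n \<subseteq> C)"
    and supp: "\<forall>n\<in>Poly_Mapping.keys q. Poly_Mapping.keys n \<subseteq> C"
  shows "\<exists>q'. q - q' \<in> J \<and>
    (\<forall>n\<in>Poly_Mapping.keys q'. Poly_Mapping.keys n \<subseteq> C \<and> (\<forall>h\<in>H. \<forall>k. n \<noteq> h + k))"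
proof -
  define good where "good q \<longleftrightarrow> (\<exists>q'. q - q' \<in> J \<and>
    (\<forall>n\<in>Poly_Mapping.keys q'. Poly_Mapping.keys n \<subseteq> C \<and> (\<forall>h\<in>H. \<forall>k. n \<noteq> h + k)))" for q
  have good0: "good 0" unfolding good_def using J0 by (intro exI[of _ 0]) simp
  have good_add: "good (p + q)" if pq: "good p" "good q" for p q
  proof -
    obtain p' q' where
      p': "p - p' \<in> J" "\<forall>n\<in>Poly_Mapping.keys p'. Poly_Mapping.keys n \<subseteq> C \<and> (\<forall>h\<in>H. \<forall>k. n \<noteq> h + k)" and
      q': "q - q' \<in> J" "\<forall>n\<in>Poly_Mapping.keys q'. Poly_Mapping.keys n \<subseteq> C \<and> (\<forall>h\<in>H. \<forall>k. n \<noteq> h + k)"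
      using pq unfolding good_def by blast
    have "(p - p') + (q - q') \<in> J" using p' q' Jadd by blast
    then have "(p + q) - (p' + q') \<in> J" by (simp add: algebra_simps)
    moreover have "Poly_Mapping.keys (p' + q') \<subseteq> Poly_Mapping.keys p' \<union> Poly_Mapping.keys q'"
      by (rule keys_add)
    ultimately show ?thesis unfolding good_def using p'(2) q'(2) by blast
  qed
  have good_scale: "good (const_poly c * p)" if p: "good p" for c p
  proof -
    obtain p' where
      p': "p - p' \<in> J" "\<forall>n\<in>Poly_Mapping.keys p'. Poly_Mapping.keys n \<subseteq> C \<and> (\<forall>h\<in>H. \<forall>k. n \<noteq> h + k)"
      using p unfolding good_def by blast
    have "const_poly c * (p - p') \<in> J" using p' Jmult by blast
    then have "const_poly c * p - const_poly c * p' \<in> J" by (simp add: algebra_simps)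
    moreover have "Poly_Mapping.keys (const_poly c * p') \<subseteq> Poly_Mapping.keys p'"
      by (auto simp: in_keys_iff lookup_const_mult)
    ultimately show ?thesis unfolding good_def using p'(2) by blast
  qed
  have good_shift: "good q" if "p - q \<in> J" "good p" for p q
  proof -
    obtain p' where
      p': "p - p' \<in> J" "\<forall>n\<in>Poly_Mapping.keys p'. Poly_Mapping.keys n \<subseteq> C \<and> (\<forall>h\<in>H. \<forall>k. n \<noteq> h + k)"
      using \<open>good p\<close> unfolding good_def by blast
    have "(p - p') + (- 1) * (p - q) \<in> J" using p'(1) that(1) Jadd Jmult by blast
    then have "q - p' \<in> J" by (simp add: algebra_simps)
    then show ?thesis unfolding good_def using p'(2) by blast
  qed
  have good_keys: "good q" if mons: "\<And>n. n \<in> Poly_Mapping.keys q \<Longrightarrow> good (monomial_poly n)" for q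
  proof -
    have s: "Poly_Mapping.single n c = const_poly c * monomial_poly n" for n :: "'g monomial" and c
      by (simp add: const_poly_def monomial_poly_def mult_single)
    have "good (\<Sum>n\<in>A. Poly_Mapping.single n (Poly_Mapping.lookup q n))"
      if fin: "finite A" "A \<subseteq> Poly_Mapping.keys q" for A
      using fin
    proof induction
      case (insert n A)
      then have "good (Poly_Mapping.single n (Poly_Mapping.lookup q n))"
        unfolding s by (intro good_scale mons) auto
      then show ?case using insert by (simp add: good_add)
    qed (simp add: good0)
    from this[of "Poly_Mapping.keys q"] show ?thesis by (simp add: poly_mapping_sum_single)
  qed
  have "good (monomial_poly n)" if "Poly_Mapping.keys n \<subseteq> C" for n
    using that
  proof (induction "weight W n" arbitrary: n rule: less_induct)
    case less
    show ?case
    proof (cases "\<exists>h\<in>H. \<exists>k. n = h + k")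
      case True
      then obtain h k where hk: "h \<in> H" "n = h + k" by blast
      obtain r where r: "monomial_poly h - r \<in> J"
        "\<forall>n\<in>Poly_Mapping.keys r. weight W n < weight W h \<and> Poly_Mapping.keys n \<subseteq> C"
        using rule[OF hk(1)] by blast
      have kC: "Poly_Mapping.keys k \<subseteq> C"
        using less.prems by (auto simp: hk in_keys_iff lookup_add subset_iff)
      \<comment> \<open>Replacing \<open>h\<close> by \<open>r\<close> in \<open>h + k\<close> gives
        \<open>r\<close> shifted by \<open>k\<close>; all its monomials have smaller weight, so the
        induction hypothesis covers them.\<close>
      have "good (monomial_poly k * r)"
      proof (rule good_keys)
        fix m assume "m \<in> Poly_Mapping.keys (monomial_poly k * r)"
        then obtain a where a: "a \<in> Poly_Mapping.keys r" "m = k + a"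
          using keys_mult[of "monomial_poly k" r] by (auto simp: monomial_poly_def)
        show "good (monomial_poly m)"
        proof (rule less.hyps)
          show "weight W m < weight W n" using a r(2) by (auto simp: hk weight_add)
          show "Poly_Mapping.keys m \<subseteq> C" using a r(2) kC keys_add[of k a] by blast
        qed
      qed
      moreover have "monomial_poly k * r - monomial_poly n \<in> J"
      proof -
        have "(- monomial_poly k) * (monomial_poly h - r) \<in> J" using r(1) Jmult by blast
        then show ?thesis by (simp add: hk monomial_poly_add algebra_simps)
      qed
      ultimately show ?thesis using good_shift by blast
    next
      case False
      then have "\<forall>h\<in>H. \<forall>k. n \<noteq> h + k" by blast
      moreover have "Poly_Mapping.keys (monomial_poly n) = {n}" by (simp add: monomial_poly_def)
      moreover have "monomial_poly n - monomial_poly n \<in> J" using J0 by simp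
      ultimately show ?thesis unfolding good_def
        using less.prems by (metis singletonD)
    qed
  qed
  then have "good q" using supp good_keys[of q] by blast
  then show ?thesis by (simp add: good_def)
qed

section \<open>Coordinates and the slice\<close>

text \<open>The twelve variables are numbered \<open>0, \<dots>, 11\<close> from the highest to the lowest, so that the
  generators become polynomial functions of a vector \<open>nat \<Rightarrow> 'a\<close> over any commutative ring.\<close>

definition idx_at :: "nat \<Rightarrow> idx" where
  "idx_at m = [Idx 1 1 1, Idx 1 1 2, Idx 1 1 3, Idx 1 2 1, Idx 1 2 2, Idx 1 2 3,
    Idx 2 1 1, Idx 2 1 2, Idx 2 1 3, Idx 2 2 1, Idx 2 2 2, Idx 2 2 3] ! m"

fun number :: "idx \<Rightarrow> nat" where
  "number (Idx i j k) = 6 * (pos2 i - 1) + 3 * (pos2 j - 1) + (pos3 k - 1)"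

lemma less_12_cases:
  assumes "(m::nat) < 12"
  shows "m = 0 \<or> m = 1 \<or> m = 2 \<or> m = 3 \<or> m = 4 \<or> m = 5 \<or> m = 6 \<or> m = 7 \<or> m = 8 \<or> m = 9 \<or> m = 10 \<or> m = 11"
  using assms by (auto simp: numeral_eq_Suc less_Suc_eq)

lemma number_at: "m < 12 \<Longrightarrow> number (idx_at m) = m"
  by (drule less_12_cases, elim disjE; simp add: idx_at_def pos2_def pos3_def)

lemma idx_cases:
  fixes v :: idx
  obtains i j k where "v = Idx i j k" "i = 1 \<or> i = 2" "j = 1 \<or> j = 2" "k = 1 \<or> k = 2 \<or> k = 3"
proof (cases v)
  case (Idx i j k)
  then show ?thesis using that exhaust_2[of i] exhaust_2[of j] exhaust_3[of k] by blast
qed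

lemma number_less: "number v < 12"
  by (cases v rule: idx_cases) (auto simp: pos2_def pos3_def)

lemma at_number: "idx_at (number v) = v"
  by (cases v rule: idx_cases) (auto simp: idx_at_def pos2_def pos3_def)

lemma less_idx_number: "v < w \<longleftrightarrow> number v < number w"
  by (cases v rule: idx_cases; cases w rule: idx_cases) (auto simp: less_idx_def pos2_def pos3_def)

abbreviation X :: "nat \<Rightarrow> poly223" where
  "X m \<equiv> var (idx_at m)"

lemma xvar_eq:
  "xvar 1 1 1 = X 0" "xvar 1 1 2 = X 1" "xvar 1 1 3 = X 2" "xvar 1 2 1 = X 3" "xvar 1 2 2 = X 4"
  "xvar 1 2 3 = X 5" "xvar 2 1 1 = X 6" "xvar 2 1 2 = X 7" "xvar 2 1 3 = X 8" "xvar 2 2 1 = X 9"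
  "xvar 2 2 2 = X 10" "xvar 2 2 3 = X 11"
  by (simp_all add: xvar_def idx_at_def)

section \<open>The explicit elements as polynomial functions\<close>

definition D12 :: "(nat \<Rightarrow> 'a::comm_ring_1) \<Rightarrow> 'a" where
  "D12 a = a 0 * a 9 - a 3 * a 6"

definition D13 :: "(nat \<Rightarrow> 'a::comm_ring_1) \<Rightarrow> 'a" where
  "D13 a = a 0 * a 7 - a 1 * a 6"

definition D23 :: "(nat \<Rightarrow> 'a::comm_ring_1) \<Rightarrow> 'a" where
  "D23 a = a 0 * a 4 - a 1 * a 3"

definition F3 :: "(nat \<Rightarrow> 'a::comm_ring_1) \<Rightarrow> 'a" where
  "F3 a = a 0 ^ 2 * a 10 - a 0 * a 1 * a 9 - a 0 * a 3 * a 7 - a 0 * a 4 * a 6 + 2 * a 1 * a 3 * a 6"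

definition U :: "(nat \<Rightarrow> 'a::comm_ring_1) \<Rightarrow> 'a" where
  "U a = a 0 * (a 4 * a 8 - a 5 * a 7) - a 1 * (a 3 * a 8 - a 5 * a 6) + a 2 * (a 3 * a 7 - a 4 * a 6)"

text \<open>Cayley's hyperdeterminant of the 2 x 2 x 2 array of entries with third index 1 or
  2.\<close>

definition F4 :: "(nat \<Rightarrow> 'a::comm_ring_1) \<Rightarrow> 'a" where
  "F4 a = a 0 ^ 2 * a 10 ^ 2 - 2 * a 0 * a 1 * a 9 * a 10 - 2 * a 0 * a 3 * a 7 * a 10
    - 2 * a 0 * a 4 * a 6 * a 10 + 4 * a 0 * a 4 * a 7 * a 9 + a 1 ^ 2 * a 9 ^ 2
    + 4 * a 1 * a 3 * a 6 * a 10 - 2 * a 1 * a 3 * a 7 * a 9 - 2 * a 1 * a 4 * a 6 * a 9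
    + a 3 ^ 2 * a 7 ^ 2 - 2 * a 3 * a 4 * a 6 * a 7 + a 4 ^ 2 * a 6 ^ 2"

text \<open>Expansion of the determinant along its first column, whose first two entries are 0. The
  second bracket equals \<open>- U a\<close>; in \<open>Vs\<close> it equals
  \<open>U a\<close>.\<close>

definition V :: "(nat \<Rightarrow> 'a::comm_ring_1) \<Rightarrow> 'a" where
  "V a = a 0 * (a 0 * (a 7 * a 11 - a 8 * a 10) - a 1 * (a 6 * a 11 - a 8 * a 9) + a 2 * (a 6 * a 10 - a 7 * a 9))
    - a 6 * (a 0 * (a 7 * a 5 - a 8 * a 4) - a 1 * (a 6 * a 5 - a 8 * a 3) + a 2 * (a 6 * a 4 - a 7 * a 3))"

definition Vs :: "(nat \<Rightarrow> 'a::comm_ring_1) \<Rightarrow> 'a" where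
  "Vs a = a 0 * (a 0 * (a 4 * a 11 - a 5 * a 10) - a 1 * (a 3 * a 11 - a 5 * a 9) + a 2 * (a 3 * a 10 - a 4 * a 9))
    - a 3 * (a 0 * (a 4 * a 8 - a 5 * a 7) - a 1 * (a 3 * a 8 - a 5 * a 6) + a 2 * (a 3 * a 7 - a 4 * a 6))"

lemmas formulas = D12_def D13_def D23_def F3_def U_def F4_def V_def Vs_def

lemma det_4:
  "det (A :: 'a::comm_ring_1^4^4) =
     A$1$1 * (A$2$2 * (A$3$3 * A$4$4 - A$3$4 * A$4$3) - A$2$3 * (A$3$2 * A$4$4 - A$3$4 * A$4$2) + A$2$4 * (A$3$2 * A$4$3 - A$3$3 * A$4$2))
   - A$2$1 * (A$1$2 * (A$3$3 * A$4$4 - A$3$4 * A$4$3) - A$1$3 * (A$3$2 * A$4$4 - A$3$4 * A$4$2) + A$1$4 * (A$3$2 * A$4$3 - A$3$3 * A$4$2))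
   + A$3$1 * (A$1$2 * (A$2$3 * A$4$4 - A$2$4 * A$4$3) - A$1$3 * (A$2$2 * A$4$4 - A$2$4 * A$4$2) + A$1$4 * (A$2$2 * A$4$3 - A$2$3 * A$4$2))
   - A$4$1 * (A$1$2 * (A$2$3 * A$3$4 - A$2$4 * A$3$3) - A$1$3 * (A$2$2 * A$3$4 - A$2$4 * A$3$2) + A$1$4 * (A$2$2 * A$3$3 - A$2$3 * A$3$2))"
proof -
  have f: "finite {2::4, 3, 4}" "1 \<notin> {2::4, 3, 4}" "finite {3::4, 4}" "2 \<notin> {3::4, 4}" "finite {4::4}" "3 \<notin> {4::4}"
    by auto
  show ?thesis
    unfolding det_def UNIV_4
    unfolding sum_over_permutations_insert[OF f(1,2)]
    unfolding sum_over_permutations_insert[OF f(3,4)]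
    unfolding sum_over_permutations_insert[OF f(5,6)]
    unfolding permutes_sing
    by (simp add: sign_swap_id permutation_swap_id sign_compose sign_id swap_id_eq permutation_compose algebra_simps)
qed

lemma vector_4:
  "(vector [x, y, z, w] :: 'a::zero^4) $ 1 = x" "(vector [x, y, z, w] :: 'a^4) $ 2 = y"
  "(vector [x, y, z, w] :: 'a^4) $ 3 = z" "(vector [x, y, z, w] :: 'a^4) $ 4 = w"
  unfolding vector_def by simp_all

lemma generators_eq:
  "d12 = D12 X" "d13 = D13 X" "d23 = D23 X" "f3 = F3 X" "u_det = U X" "f4 = F4 X" "v_det = V X" "v_star_det = Vs X"
proof -
  show "d12 = D12 X" "d13 = D13 X" "d23 = D23 X" "f3 = F3 X" "f4 = F4 X"
    by (simp_all only: d12_def d13_def d23_def f3_def f4_def formulas xvar_eq)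
  show "u_det = U X"
    unfolding u_det_def xvar_eq det_3 vector_3 U_def by (simp add: algebra_simps)
  show "v_det = V X"
    unfolding v_det_def xvar_eq det_4 vector_4 V_def by (simp add: algebra_simps)
  show "v_star_det = Vs X"
    unfolding v_star_det_def xvar_eq det_4 vector_4 Vs_def by (simp add: algebra_simps)
qed

lemma subst_generators:
  fixes s :: "idx \<Rightarrow> 'w cpoly"
  shows "subst s (X m) = s (idx_at m)"
    "subst s (D12 X) = D12 (\<lambda>m. s (idx_at m))" "subst s (D13 X) = D13 (\<lambda>m. s (idx_at m))"
    "subst s (D23 X) = D23 (\<lambda>m. s (idx_at m))" "subst s (F3 X) = F3 (\<lambda>m. s (idx_at m))"
    "subst s (U X) = U (\<lambda>m. s (idx_at m))" "subst s (F4 X) = F4 (\<lambda>m. s (idx_at m))"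
    "subst s (V X) = V (\<lambda>m. s (idx_at m))" "subst s (Vs X) = Vs (\<lambda>m. s (idx_at m))"
  by (simp_all add: formulas subst_hom)

text \<open>In the numbering of the variables, lowering the first, second or third index by one
  means going back 6, 3 or 1 places; this explains the offsets here and in the two analogues for the
  other factors.\<close>

definition shift1 :: "'a::comm_ring_1 \<Rightarrow> (nat \<Rightarrow> 'a) \<Rightarrow> nat \<Rightarrow> 'a" where
  "shift1 s a m = (if m < 6 then a m else a m + s * a (m - 6))"

definition shift2 :: "'a::comm_ring_1 \<Rightarrow> (nat \<Rightarrow> 'a) \<Rightarrow> nat \<Rightarrow> 'a" where
  "shift2 r a m = (if m mod 6 < 3 then a m else a m + r * a (m - 3))"

definition shift3 :: "'a::comm_ring_1 \<Rightarrow> 'a \<Rightarrow> 'a \<Rightarrow> (nat \<Rightarrow> 'a) \<Rightarrow> nat \<Rightarrow> 'a" where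
  "shift3 \<alpha> \<beta> \<delta> a m = (if m mod 3 = 0 then a m else if m mod 3 = 1 then a m + \<alpha> * a (m - 1)
     else a m + \<beta> * a (m - 2) + \<delta> * a (m - 1))"

text \<open>Valid over every commutative ring, these identities give both the invariance of the
  polynomials and the constancy of their values along orbits of points. \<open>F4\<close> is treated
  later as a quotient of invariants.\<close>

lemma shift1_invariant:
  "shift1 s a 0 = a 0" "D12 (shift1 s a) = D12 a" "D13 (shift1 s a) = D13 a" "D23 (shift1 s a) = D23 a"
  "F3 (shift1 s a) = F3 a" "U (shift1 s a) = U a" "V (shift1 s a) = V a" "Vs (shift1 s a) = Vs a"
  unfolding formulas by (simp_all add: shift1_def algebra_simps power2_eq_square)

lemma shift2_invariant:
  "shift2 s a 0 = a 0" "D12 (shift2 s a) = D12 a" "D13 (shift2 s a) = D13 a" "D23 (shift2 s a) = D23 a"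
  "F3 (shift2 s a) = F3 a" "U (shift2 s a) = U a" "V (shift2 s a) = V a" "Vs (shift2 s a) = Vs a"
  unfolding formulas by (simp_all add: shift2_def algebra_simps power2_eq_square)

lemma shift3_invariant:
  "shift3 \<alpha> \<beta> \<delta> a 0 = a 0" "D12 (shift3 \<alpha> \<beta> \<delta> a) = D12 a" "D13 (shift3 \<alpha> \<beta> \<delta> a) = D13 a"
  "D23 (shift3 \<alpha> \<beta> \<delta> a) = D23 a" "F3 (shift3 \<alpha> \<beta> \<delta> a) = F3 a" "U (shift3 \<alpha> \<beta> \<delta> a) = U a"
  "V (shift3 \<alpha> \<beta> \<delta> a) = V a" "Vs (shift3 \<alpha> \<beta> \<delta> a) = Vs a"
  unfolding formulas by (simp_all add: shift3_def algebra_simps power2_eq_square)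

text \<open>The action of an element of \<open>N\<close> on the variables: \<open>s\<close> and \<open>r\<close> are the entries above the diagonals of the
  first two factors, and \<open>\<alpha>\<close>, \<open>\<beta>\<close>, \<open>\<delta>\<close> are the entries 12, 13, 23 of the third.\<close>

definition unipotent_shift :: "complex \<Rightarrow> complex \<Rightarrow> complex \<Rightarrow> complex \<Rightarrow> complex \<Rightarrow> (nat \<Rightarrow> 'w cpoly) \<Rightarrow> nat \<Rightarrow> 'w cpoly" where
  "unipotent_shift s r \<alpha> \<beta> \<delta> a =
     shift1 (const_poly s) (shift2 (const_poly r) (shift3 (const_poly \<alpha>) (const_poly \<beta>) (const_poly \<delta>) a))"

lemma unipotent_shift_invariant:
  "unipotent_shift s r \<alpha> \<beta> \<delta> a 0 = a 0" "D12 (unipotent_shift s r \<alpha> \<beta> \<delta> a) = D12 a"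
  "D13 (unipotent_shift s r \<alpha> \<beta> \<delta> a) = D13 a" "D23 (unipotent_shift s r \<alpha> \<beta> \<delta> a) = D23 a"
  "F3 (unipotent_shift s r \<alpha> \<beta> \<delta> a) = F3 a" "U (unipotent_shift s r \<alpha> \<beta> \<delta> a) = U a"
  "V (unipotent_shift s r \<alpha> \<beta> \<delta> a) = V a" "Vs (unipotent_shift s r \<alpha> \<beta> \<delta> a) = Vs a"
  by (simp_all only: unipotent_shift_def shift1_invariant shift2_invariant shift3_invariant)

lemma subst_cong_at:
  assumes "\<And>m. m < 12 \<Longrightarrow> s (idx_at m) = t (idx_at m)"
  shows "subst s p = subst t p"
proof -
  have "s = t" using assms number_less at_number by (metis ext)
  then show ?thesis by simp
qed

lemma act_eq:
  assumes "unipotent_upper2 g" "unipotent_upper2 h" "unipotent_upper3 k"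
  shows "act (g, h, k) p =
    subst (\<lambda>v. unipotent_shift (g $ 1 $ 2) (h $ 1 $ 2) (k $ 1 $ 2) (k $ 1 $ 3) (k $ 2 $ 3) X (number v)) p"
proof -
  have "(\<Sum>a\<in>UNIV. \<Sum>b\<in>UNIV. \<Sum>c\<in>UNIV. cscale (g $ a $ idx1 v * h $ b $ idx2 v * k $ c $ idx3 v) (xvar a b c))
    = unipotent_shift (g $ 1 $ 2) (h $ 1 $ 2) (k $ 1 $ 2) (k $ 1 $ 3) (k $ 2 $ 3) X (number v)" for v
    using assms unfolding unipotent_upper2_def unipotent_upper3_def
    apply (cases v rule: idx_cases)
    apply (simp only: sum_2 sum_3 cscale_def xvar_eq)
    apply (elim disjE; simp add: unipotent_shift_def shift1_def shift2_def shift3_def pos2_def pos3_def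
        const_poly_simps algebra_simps flip: numeral_2_eq_2)
    done
  then show ?thesis by simp
qed

text \<open>Any five parameters occur as the entries above the diagonals of an element of
  \<open>N\<close>. Invariance thus means being fixed by a family of algebra homomorphisms.\<close>

lemma A223_iff:
  "p \<in> A223 \<longleftrightarrow> (\<forall>s r \<alpha> \<beta> \<delta>. subst (\<lambda>v. unipotent_shift s r \<alpha> \<beta> \<delta> X (number v)) p = p)"
proof
  assume p: "p \<in> A223"
  show "\<forall>s r \<alpha> \<beta> \<delta>. subst (\<lambda>v. unipotent_shift s r \<alpha> \<beta> \<delta> X (number v)) p = p"
  proof (intro allI)
    fix s r \<alpha> \<beta> \<delta>
    define g :: "complex^2^2" where "g = (\<chi> i j. if i = j then 1 else if i = 1 then s else 0)"
    define h :: "complex^2^2" where "h = (\<chi> i j. if i = j then 1 else if i = 1 then r else 0)"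
    define k :: "complex^3^3" where "k = (\<chi> i j. if i = j then 1 else if i = 1 \<and> j = 2 then \<alpha>
      else if i = 1 then \<beta> else if i = 2 \<and> j = 3 then \<delta> else 0)"
    have "unipotent_upper2 g" "unipotent_upper2 h" "unipotent_upper3 k"
      by (simp_all add: unipotent_upper2_def unipotent_upper3_def g_def h_def k_def)
    moreover from this have "act (g, h, k) p = p" using p by (simp add: A223_def N223_def del: act.simps)
    ultimately show "subst (\<lambda>v. unipotent_shift s r \<alpha> \<beta> \<delta> X (number v)) p = p"
      using act_eq[of g h k p] by (simp add: g_def h_def k_def del: act.simps)
  qed
next
  assume "\<forall>s r \<alpha> \<beta> \<delta>. subst (\<lambda>v. unipotent_shift s r \<alpha> \<beta> \<delta> X (number v)) p = p"
  then show "p \<in> A223"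
    by (auto simp: A223_def N223_def act_eq simp del: act.simps)
qed

lemma A223_closed:
  "const_poly c \<in> A223" "p \<in> A223 \<Longrightarrow> q \<in> A223 \<Longrightarrow> p + q \<in> A223"
  "p \<in> A223 \<Longrightarrow> q \<in> A223 \<Longrightarrow> p - q \<in> A223" "p \<in> A223 \<Longrightarrow> q \<in> A223 \<Longrightarrow> p * q \<in> A223"
  "p \<in> A223 \<Longrightarrow> p ^ n \<in> A223"
  by (simp_all add: A223_iff subst_hom)

text \<open>If a homomorphism of the family sends \<open>q\<close> to \<open>q'\<close>, then
  \<open>p * (q' - q) = 0\<close> in an integral domain. This gives the invariance of
  quotients.\<close>

lemma A223_cancel:
  assumes "p \<in> A223" "p \<noteq> 0" "p * q \<in> A223"
  shows "q \<in> A223"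
  using assms by (simp add: A223_iff subst_hom)

lemma formulas_cong:
  assumes "\<And>m. m < 12 \<Longrightarrow> a m = b m"
  shows "D12 a = D12 b" "D13 a = D13 b" "D23 a = D23 b" "F3 a = F3 b" "U a = U b" "F4 a = F4 b" "V a = V b" "Vs a = Vs b"
  unfolding formulas by (simp_all only: assms numeral_less_iff semiring_norm zero_less_numeral one_less_numeral_iff)

lemma A223_generators:
  "X 0 \<in> A223" "D12 X \<in> A223" "D13 X \<in> A223" "D23 X \<in> A223" "F3 X \<in> A223" "U X \<in> A223"
  "V X \<in> A223" "Vs X \<in> A223"
proof -
  \<comment> \<open>The formulas read only coordinates below 12, where \<open>number\<close> inverts
    \<open>idx_at\<close>.\<close>
  have at: "D12 (\<lambda>m. f (number (idx_at m))) = D12 f" "D13 (\<lambda>m. f (number (idx_at m))) = D13 f"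
    "D23 (\<lambda>m. f (number (idx_at m))) = D23 f" "F3 (\<lambda>m. f (number (idx_at m))) = F3 f"
    "U (\<lambda>m. f (number (idx_at m))) = U f" "V (\<lambda>m. f (number (idx_at m))) = V f"
    "Vs (\<lambda>m. f (number (idx_at m))) = Vs f" for f :: "nat \<Rightarrow> poly223"
    by (intro formulas_cong; simp add: number_at)+
  show "X 0 \<in> A223" "D12 X \<in> A223" "D13 X \<in> A223" "D23 X \<in> A223" "F3 X \<in> A223" "U X \<in> A223"
    "V X \<in> A223" "Vs X \<in> A223"
    unfolding A223_iff subst_generators at unipotent_shift_invariant
    by (simp_all add: number_at unipotent_shift_invariant)
qed

section \<open>The remaining generators and the relations\<close>

text \<open>Together with the defining equations of the four quotients, these are the axioms from
  which all relations are derived.\<close>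

lemma generic_identities:
  "D13 a * Vs a - D23 a * V a = U a * F3 a"
  "a 0 ^ 2 * F4 a = F3 a ^ 2 + 4 * D12 a * D13 a * D23 a"
  by (simp_all add: formulas algebra_simps power2_eq_square)

text \<open>On the hyperplane \<open>a 0 = 0\<close> the numerators of the new generators vanish,
  hence their divisibility by \<open>x111\<close>. The first identity is doubled to avoid one half
  over a general ring; the last two show that \<open>d13\<close> and \<open>d23\<close> are nonzero
  modulo \<open>x111\<close>.\<close>

lemma identities_at_zero:
  assumes "a 0 = 0"
  shows "2 * (D23 a * V a) = - (U a * F3 a)" "F3 a * V a = 2 * D12 a * D13 a * U a"
    "F3 a * Vs a = - (2 * D12 a * D23 a * U a)" "V a * Vs a = D12 a * U a ^ 2"
    "D13 a = - (a 1 * a 6)" "D23 a = - (a 1 * a 3)"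
  by (simp_all add: formulas assms algebra_simps power2_eq_square)

text \<open>The difference of \<open>p\<close> and its restriction to \<open>v = 0\<close> is a
  multiple of \<open>var v\<close>; for products this is the telescoping identity
  \<open>p * q - p0 * q0 = (p - p0) * q + p0 * (q - q0)\<close>.\<close>

lemma var_dvdE:
  assumes "subst (\<lambda>w. if w = v then 0 else var w) p = 0"
  obtains q where "p = var v * q"
proof -
  have "var v dvd p - subst (\<lambda>w. if w = v then 0 else var w) p" for p
  proof (induction p rule: cpoly_induct)
    case (add p q)
    then have "var v dvd (p - subst (\<lambda>w. if w = v then 0 else var w) p) + (q - subst (\<lambda>w. if w = v then 0 else var w) q)"
      by (rule dvd_add)
    then show ?case by (simp add: subst_hom algebra_simps)
  next
    case (mult p q)
    let ?s = "subst (\<lambda>w. if w = v then 0 else var w)"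
    have "p * q - ?s (p * q) = (p - ?s p) * q + ?s p * (q - ?s q)" by (simp add: subst_hom algebra_simps)
    then show ?case using mult by (simp only: dvd_add dvd_mult dvd_mult2)
  qed simp_all
  from this[of p] show ?thesis using that by (auto simp: assms dvd_def)
qed

text \<open>The equations are abstracted to an integral domain, so that they apply to the generators
  and also to their restrictions to coordinate subspaces. \<open>H\<close> stands for one
  half.\<close>

locale syzygies =
  fixes x d12 d13 d23 f3 u f4 v vs f5 \<psi> \<psi>s H :: "'a::idom"
  assumes x: "x \<noteq> 0" and H: "2 * H = 1"
    and e0: "d13 * vs - d23 * v = u * f3" and ef4: "x ^ 2 * f4 = f3 ^ 2 + 4 * d12 * d13 * d23"
    and ef5: "x * f5 = d23 * v + H * u * f3" and e\<psi>: "x * \<psi> = f3 * v - 2 * d12 * d13 * u"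
    and e\<psi>s: "x * \<psi>s = f3 * vs + 2 * d12 * d23 * u"
begin

lemma cancel: "x * p = x * q \<Longrightarrow> p = q"
  using x by simp

text \<open>By \<open>e0\<close> the products \<open>d13 * vs\<close> and \<open>d23 * v\<close>
  differ by \<open>u * f3\<close>, and \<open>x * f5\<close> is their mean. This form serves the
  relations where the starred element is paired with \<open>d13\<close>.\<close>

lemma ef5': "x * f5 = d13 * vs - H * u * f3"
  using ef5 e0 H by algebra

lemma R1: "f3 ^ 2 = x ^ 2 * f4 - 4 * d12 * d13 * d23"
  using ef4 by algebra
lemma R2: "d23 * v = x * f5 - H * f3 * u"
  using ef5 by algebra
lemma R3: "d13 * vs = x * f5 + H * f3 * u"
  using ef5' by algebra
lemma R4: "f3 * v = x * \<psi> + 2 * d12 * d13 * u"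
  using e\<psi> by algebra
lemma R5: "f3 * vs = x * \<psi>s - 2 * d12 * d23 * u"
  using e\<psi>s by algebra
lemma R6: "f3 * f5 = d23 * \<psi> + H * x * u * f4"
  by (rule cancel) (use R1 R2 R4 H in algebra)
lemma R7: "d13 * \<psi>s = d23 * \<psi> + x * u * f4"
  by (rule cancel) (use R1 R4 R5 e0 in algebra)
lemma R11: "f3 * \<psi> = x * f4 * v - 4 * d12 * d13 * f5"
  by (rule cancel) (use R1 R2 R4 H in algebra)
lemma R12: "f3 * \<psi>s = x * f4 * vs - 4 * d12 * d23 * f5"
  by (rule cancel) (use R1 R3 R5 H in algebra)

text \<open>Multiply the two expressions for \<open>x * f5\<close>. The result supplies the second
  factor \<open>x\<close> of the numerator of \<open>\<phi>\<close>, up to the factor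
  \<open>d13 * d23\<close>.\<close>

lemma d13_d23_\<phi>: "d13 * d23 * (v * vs - d12 * u ^ 2) = x ^ 2 * (f5 ^ 2 - H ^ 2 * u ^ 2 * f4)"
proof -
  have "x ^ 2 * f5 ^ 2 = (d23 * v + H * u * f3) * (d13 * vs - H * u * f3)"
    using ef5 ef5' by algebra
  moreover have "H * (u * f3) * (d13 * vs - d23 * v) = 2 * H ^ 2 * u ^ 2 * f3 ^ 2"
    using e0 H by algebra
  moreover have "x ^ 2 * (H ^ 2 * u ^ 2 * f4) = H ^ 2 * u ^ 2 * (f3 ^ 2 + 4 * d12 * d13 * d23)"
    using ef4 by algebra
  moreover have "4 * H ^ 2 = 1" using H by algebra
  ultimately show ?thesis by algebra
qed

end

text \<open>\<open>\<phi>\<close> comes in a second locale because the divisibility of its numerator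
  by \<open>x ^ 2\<close> rests on consequences of the first.\<close>

locale all_syzygies = syzygies +
  fixes \<phi>
  assumes e\<phi>: "x ^ 2 * \<phi> = v * vs - d12 * u ^ 2"
begin

lemma R8: "v * vs = x ^ 2 * \<phi> + d12 * u ^ 2"
  using e\<phi> by algebra
lemma R9: "v * f5 = x * d13 * \<phi> - H * u * \<psi>"
proof (rule cancel)
  have "x * (v * f5) = d13 * (v * vs) - H * u * (f3 * v)" using ef5' by algebra
  then show "x * (v * f5) = x * (x * d13 * \<phi> - H * u * \<psi>)" unfolding R8 R4 using H by algebra
qed
lemma R10: "vs * f5 = x * d23 * \<phi> + H * u * \<psi>s"
proof (rule cancel)
  have "x * (vs * f5) = d23 * (v * vs) + H * u * (f3 * vs)" using ef5 by algebra
  then show "x * (vs * f5) = x * (x * d23 * \<phi> + H * u * \<psi>s)" unfolding R8 R5 using H by algebra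
qed
lemma R13: "f5 ^ 2 = d13 * d23 * \<phi> + H ^ 2 * u ^ 2 * f4"
  by (rule cancel, rule cancel) (use d13_d23_\<phi> e\<phi> in algebra)
lemma R14: "vs * \<psi> = x * f3 * \<phi> - 2 * d12 * u * f5"
  by (rule cancel) (use R8 e\<psi> R3 H in algebra)
lemma R15: "v * \<psi>s = x * f3 * \<phi> + 2 * d12 * u * f5"
  by (rule cancel) (use R8 e\<psi>s R2 H in algebra)
text \<open>With the expression of \<open>x * f5\<close> through \<open>d13 * vs\<close>, the terms
  in \<open>d12 * d13 * u * f5\<close> coming from \<open>R14\<close> and \<open>R11\<close> cancel
  because \<open>2 * H = 1\<close>.\<close>

lemma R16: "f5 * \<psi> = d13 * f3 * \<phi> - H * u * f4 * v"
  by (rule cancel) (use R14 R11 ef5' H in algebra)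
lemma R17: "f5 * \<psi>s = d23 * f3 * \<phi> + H * u * f4 * vs"
  by (rule cancel) (use R15 R12 ef5 H in algebra)
lemma R18: "\<psi> ^ 2 = f4 * v ^ 2 - 4 * d12 * d13 ^ 2 * \<phi>"
  by (rule cancel) (use R11 R9 e\<psi> H in algebra)
lemma R19: "\<psi>s ^ 2 = f4 * vs ^ 2 - 4 * d12 * d23 ^ 2 * \<phi>"
  by (rule cancel) (use R12 R10 e\<psi>s H in algebra)
lemma R20: "\<psi> * \<psi>s = x ^ 2 * f4 * \<phi> - d12 * u ^ 2 * f4 - 4 * d12 * d13 * d23 * \<phi>"
  by (rule cancel) (use R8 R11 R10 R7 e\<psi>s H in algebra)

end

section \<open>Existence of the four quotients\<close>

lemma X_nonzero [simp]: "X m \<noteq> 0"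
  using lead_nonzero[OF lead_var] by blast

lemma generators_exist:
  "\<exists>f5 \<phi> \<psi> \<psi>s. all_syzygies (X 0) (D12 X) (D13 X) (D23 X) (F3 X) (U X) (F4 X) (V X) (Vs X)
    f5 \<psi> \<psi>s (const_poly (1/2)) \<phi>"
proof -
  let ?s = "\<lambda>w. if w = idx_at 0 then 0 else var w"
  let ?a = "\<lambda>m. ?s (idx_at m)"
  define H :: poly223 where "H = const_poly (1/2)"
  have H: "2 * H = 1"
    unfolding H_def const_poly_numeral[symmetric] const_poly_simps(5)[symmetric] by (simp add: const_poly_simps)
  have sH: "subst ?s H = H" by (simp add: H_def)
  have a0: "?a 0 = 0" by simp
  note zero = identities_at_zero[of ?a, OF a0]
  have "subst ?s (D23 X * V X + H * U X * F3 X) = D23 ?a * V ?a + H * U ?a * F3 ?a"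
    by (simp only: subst_hom sH subst_generators)
  also have "\<dots> = 0" using zero(1) H by algebra
  finally obtain f5 where f5: "D23 X * V X + H * U X * F3 X = X 0 * f5"
    by (rule var_dvdE)
  have "subst ?s (F3 X * V X - 2 * D12 X * D13 X * U X) = 0"
    using zero(2) by (simp only: subst_hom subst_generators subst_numeral) simp
  then obtain \<psi> where \<psi>: "F3 X * V X - 2 * D12 X * D13 X * U X = X 0 * \<psi>"
    by (rule var_dvdE)
  have "subst ?s (F3 X * Vs X + 2 * D12 X * D23 X * U X) = 0"
    using zero(3) by (simp only: subst_hom subst_generators subst_numeral) simp
  then obtain \<psi>s where \<psi>s: "F3 X * Vs X + 2 * D12 X * D23 X * U X = X 0 * \<psi>s"
    by (rule var_dvdE)
  have "subst ?s (V X * Vs X - D12 X * U X ^ 2) = 0"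
    using zero(4) by (simp only: subst_hom subst_generators subst_numeral) simp
  then obtain \<phi>' where \<phi>': "V X * Vs X - D12 X * U X ^ 2 = X 0 * \<phi>'"
    by (rule var_dvdE)
  interpret syzygies "X 0" "D12 X" "D13 X" "D23 X" "F3 X" "U X" "F4 X" "V X" "Vs X" f5 \<psi> \<psi>s H
    by unfold_locales (use generic_identities[of X] f5 \<psi> \<psi>s H in simp_all)
  \<comment> \<open>One factor \<open>x111\<close> is already removed. Modulo \<open>x111\<close>
    the product of \<open>d13\<close>, \<open>d23\<close> and \<open>\<phi>'\<close> vanishes while
    \<open>d13\<close> and \<open>d23\<close> do not, so \<open>\<phi>'\<close> is divisible once
    more.\<close>
  have "D13 X * D23 X * \<phi>' = X 0 * (f5 ^ 2 - H ^ 2 * U X ^ 2 * F4 X)"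
    by (rule cancel) (use d13_d23_\<phi> \<phi>' in algebra)
  then have "subst ?s (D13 X * D23 X * \<phi>') = subst ?s (X 0 * (f5 ^ 2 - H ^ 2 * U X ^ 2 * F4 X))" by simp
  also have "\<dots> = 0" by (simp add: subst_hom)
  finally have "D13 ?a * D23 ?a * subst ?s \<phi>' = 0" by (simp only: subst_hom subst_generators)
  moreover have "?a 1 = X 1" "?a 3 = X 3" "?a 6 = X 6" by (simp_all add: idx_at_def)
  ultimately have "subst ?s \<phi>' = 0" unfolding zero(5,6) by simp
  then obtain \<phi> where \<phi>: "\<phi>' = X 0 * \<phi>" by (rule var_dvdE)
  have "X 0 ^ 2 * \<phi> = V X * Vs X - D12 X * U X ^ 2" using \<phi> \<phi>' by algebra
  then have "all_syzygies (X 0) (D12 X) (D13 X) (D23 X) (F3 X) (U X) (F4 X) (V X) (Vs X) f5 \<psi> \<psi>s H \<phi>"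
    by unfold_locales
  then show ?thesis unfolding H_def by blast
qed

section \<open>Leading monomials and weights\<close>

text \<open>Monomials are given by lists of factors with repetition, so that orders, weights and
  products reduce to computations with lists.\<close>

definition listmon :: "'v list \<Rightarrow> 'v monomial" where
  "listmon vs = sum_list (map (\<lambda>v. Poly_Mapping.single v 1) vs)"

lemma listmon_simps: "listmon [] = 0" "listmon (v # vs) = Poly_Mapping.single v 1 + listmon vs"
  by (simp_all add: listmon_def)

lemma listmon_append: "listmon (vs @ ws) = listmon vs + listmon ws"
  by (simp add: listmon_def)

lemma lookup_listmon: "Poly_Mapping.lookup (listmon vs) v = count_list vs v"
  by (induction vs) (simp_all add: listmon_simps lookup_add lookup_single when_def)

lemma mono_value_listmon: "mono_value \<sigma> (listmon vs) = prod_list (map \<sigma> vs)"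
  by (induction vs) (simp_all add: listmon_simps mono_value_add mono_value_single)

lemma monomial_poly_listmon: "monomial_poly (listmon vs) = prod_list (map var vs)"
  using single_eq_mono_value[of "listmon vs" 1]
  by (simp add: monomial_poly_def const_poly_simps mono_value_listmon)

lemma weight_listmon: "weight W (listmon vs) = sum_list (map W vs)"
  by (induction vs) (simp_all add: listmon_simps weight_add weight_single, simp add: weight_def)

text \<open>Meant for exponent vectors: \<open>listmon_less\<close> turns a successful comparison
  into an inequality in the monomial order.\<close>

fun lex_less :: "nat list \<Rightarrow> nat list \<Rightarrow> bool" where
  "lex_less (a # as) (b # bs) \<longleftrightarrow> a < b \<or> a = b \<and> lex_less as bs"
| "lex_less _ _ \<longleftrightarrow> False"

lemma lex_lessE:
  assumes "lex_less as bs"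
  shows "\<exists>k. k < length as \<and> k < length bs \<and> as ! k < bs ! k \<and> (\<forall>j<k. as ! j = bs ! j)"
  using assms
proof (induction as bs rule: lex_less.induct)
  case (1 a as b bs)
  show ?case
  proof (cases "a < b")
    case True
    then show ?thesis by (intro exI[of _ 0]) simp
  next
    case False
    then obtain k where "k < length as" "k < length bs" "as ! k < bs ! k" "\<forall>j<k. as ! j = bs ! j" "a = b"
      using 1 by auto
    then show ?thesis by (intro exI[of _ "Suc k"]) (auto simp: nth_Cons split: nat.split)
  qed
qed auto

definition counts :: "nat list \<Rightarrow> nat list" where
  "counts ms = map (count_list ms) [0, 1, 2, 3, 4, 5, 6, 7, 8, 9, 10, 11]"

lemma lookup_listmon_at:
  assumes "set ms \<subseteq> {..<12}" "k < 12"
  shows "Poly_Mapping.lookup (listmon (map idx_at ms)) (idx_at k) = count_list ms k"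
proof -
  have "count_list (map idx_at ms) (idx_at k) = count_list ms k"
    using assms(1)
  proof (induction ms)
    case (Cons m ms)
    then have "idx_at m = idx_at k \<longleftrightarrow> m = k" using assms(2) number_at by (metis insert_subset lessThan_iff list.simps(15))
    then show ?case using Cons by simp
  qed simp
  then show ?thesis by (simp add: lookup_listmon)
qed

lemma listmon_less:
  assumes "set ms \<subseteq> {..<12}" "set ns \<subseteq> {..<12}" "lex_less (counts ms) (counts ns)"
  shows "listmon (map idx_at ms) < listmon (map idx_at ns)"
proof -
  have nth: "counts l ! k = count_list l k" if "k < 12" for l k
  proof -
    show ?thesis using less_12_cases[OF that] by (elim disjE; simp add: counts_def)
  qed
  have len: "length (counts l) = 12" for l by (simp add: counts_def)
  obtain k where k: "k < 12" "counts ms ! k < counts ns ! k" "\<forall>j<k. counts ms ! j = counts ns ! j"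
    using lex_lessE[OF assms(3)] by (auto simp: len)
  show ?thesis
    unfolding less_poly_mapping.rep_eq less_fun_def
  proof (intro exI[of _ "idx_at k"] conjI allI impI)
    show "Poly_Mapping.lookup (listmon (map idx_at ms)) (idx_at k) < Poly_Mapping.lookup (listmon (map idx_at ns)) (idx_at k)"
      using k assms by (simp add: lookup_listmon_at nth)
    fix v assume "v < idx_at k"
    then have "number v < k" using k(1) by (simp add: less_idx_number number_at)
    then have "count_list ms (number v) = count_list ns (number v)"
      using k(3) nth[OF number_less[of v]] by metis
    then have "Poly_Mapping.lookup (listmon (map idx_at ms)) (idx_at (number v)) = Poly_Mapping.lookup (listmon (map idx_at ns)) (idx_at (number v))"
      using assms number_less[of v] by (simp add: lookup_listmon_at)
    then show "Poly_Mapping.lookup (listmon (map idx_at ms)) v = Poly_Mapping.lookup (listmon (map idx_at ns)) v"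
      by (simp add: at_number)
  qed
qed

lemma lead_X_list: "lead (prod_list (map X ms)) (listmon (map idx_at ms)) 1"
proof -
  have "prod_list (map X ms) = Poly_Mapping.single (listmon (map idx_at ms)) 1"
    using monomial_poly_listmon[of "map idx_at ms"] by (simp add: monomial_poly_def comp_def)
  then show ?thesis by (simp add: lead_single)
qed

lemma below_X_list:
  assumes "set ms \<subseteq> {..<12}" "set ns \<subseteq> {..<12}" "lex_less (counts ms) (counts ns)"
  shows "below (prod_list (map X ms)) (listmon (map idx_at ns))"
  using lead_X_list listmon_less[OF assms] by (rule lead_below)

lemma below_0: "below 0 m"
  by (simp add: below_def)

lemma below_const_mult: "below p m \<Longrightarrow> below (const_poly c * p) m"
  by (auto simp: below_def in_keys_iff lookup_const_mult)

lemma lead_formulas: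
  "lead (D12 X) (listmon (map idx_at [0,9])) 1"
  "lead (D13 X) (listmon (map idx_at [0,7])) 1"
  "lead (D23 X) (listmon (map idx_at [0,4])) 1"
  "lead (F3 X) (listmon (map idx_at [0,0,10])) 1"
  "lead (U X) (listmon (map idx_at [0,4,8])) 1"
  "lead (V X) (listmon (map idx_at [0,0,7,11])) 1"
  "lead (Vs X) (listmon (map idx_at [0,0,4,11])) 1"
proof -
  \<comment> \<open>The bracket of lower terms starts from 0, so that each further product is added
    or subtracted by a rule for \<open>below\<close>; the same pattern is used for all
    formulas.\<close>
  have "D12 X = prod_list (map X [0,9]) + (0 - prod_list (map X [3,6]))"
    by (simp add: D12_def const_poly_numeral algebra_simps power2_eq_square)
  moreover have "lead \<dots> (listmon (map idx_at [0,9])) 1"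
    by (intro lead_add_below lead_X_list below_add below_diff below_0 below_const_mult below_X_list) (simp_all add: counts_def)
  ultimately show "lead (D12 X) (listmon (map idx_at [0,9])) 1" by simp
  have "D13 X = prod_list (map X [0,7]) + (0 - prod_list (map X [1,6]))"
    by (simp add: D13_def const_poly_numeral algebra_simps power2_eq_square)
  moreover have "lead \<dots> (listmon (map idx_at [0,7])) 1"
    by (intro lead_add_below lead_X_list below_add below_diff below_0 below_const_mult below_X_list) (simp_all add: counts_def)
  ultimately show "lead (D13 X) (listmon (map idx_at [0,7])) 1" by simp
  have "D23 X = prod_list (map X [0,4]) + (0 - prod_list (map X [1,3]))"
    by (simp add: D23_def const_poly_numeral algebra_simps power2_eq_square)
  moreover have "lead \<dots> (listmon (map idx_at [0,4])) 1"
    by (intro lead_add_below lead_X_list below_add below_diff below_0 below_const_mult below_X_list) (simp_all add: counts_def)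
  ultimately show "lead (D23 X) (listmon (map idx_at [0,4])) 1" by simp
  have "F3 X = prod_list (map X [0,0,10]) + (0 - prod_list (map X [0,1,9]) - prod_list (map X [0,3,7]) - prod_list (map X [0,4,6]) + const_poly 2 * prod_list (map X [1,3,6]))"
    by (simp add: F3_def const_poly_numeral algebra_simps power2_eq_square)
  moreover have "lead \<dots> (listmon (map idx_at [0,0,10])) 1"
    by (intro lead_add_below lead_X_list below_add below_diff below_0 below_const_mult below_X_list) (simp_all add: counts_def)
  ultimately show "lead (F3 X) (listmon (map idx_at [0,0,10])) 1" by simp
  have "U X = prod_list (map X [0,4,8]) + (0 - prod_list (map X [0,5,7]) - prod_list (map X [1,3,8]) + prod_list (map X [1,5,6]) + prod_list (map X [2,3,7]) - prod_list (map X [2,4,6]))"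
    by (simp add: U_def const_poly_numeral algebra_simps power2_eq_square)
  moreover have "lead \<dots> (listmon (map idx_at [0,4,8])) 1"
    by (intro lead_add_below lead_X_list below_add below_diff below_0 below_const_mult below_X_list) (simp_all add: counts_def)
  ultimately show "lead (U X) (listmon (map idx_at [0,4,8])) 1" by simp
  have "V X = prod_list (map X [0,0,7,11]) + (0 - prod_list (map X [0,0,8,10]) - prod_list (map X [0,1,6,11]) + prod_list (map X [0,1,8,9]) + prod_list (map X [0,2,6,10]) - prod_list (map X [0,2,7,9]) + prod_list (map X [0,4,6,8]) - prod_list (map X [0,5,6,7]) - prod_list (map X [1,3,6,8]) + prod_list (map X [1,5,6,6]) + prod_list (map X [2,3,6,7]) - prod_list (map X [2,4,6,6]))"
    by (simp add: V_def const_poly_numeral algebra_simps power2_eq_square)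
  moreover have "lead \<dots> (listmon (map idx_at [0,0,7,11])) 1"
    by (intro lead_add_below lead_X_list below_add below_diff below_0 below_const_mult below_X_list) (simp_all add: counts_def)
  ultimately show "lead (V X) (listmon (map idx_at [0,0,7,11])) 1" by simp
  have "Vs X = prod_list (map X [0,0,4,11]) + (0 - prod_list (map X [0,0,5,10]) - prod_list (map X [0,1,3,11]) + prod_list (map X [0,1,5,9]) + prod_list (map X [0,2,3,10]) - prod_list (map X [0,2,4,9]) - prod_list (map X [0,3,4,8]) + prod_list (map X [0,3,5,7]) + prod_list (map X [1,3,3,8]) - prod_list (map X [1,3,5,6]) - prod_list (map X [2,3,3,7]) + prod_list (map X [2,3,4,6]))"
    by (simp add: Vs_def const_poly_numeral algebra_simps power2_eq_square)
  moreover have "lead \<dots> (listmon (map idx_at [0,0,4,11])) 1"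
    by (intro lead_add_below lead_X_list below_add below_diff below_0 below_const_mult below_X_list) (simp_all add: counts_def)
  ultimately show "lead (Vs X) (listmon (map idx_at [0,0,4,11])) 1" by simp
qed

section \<open>Homogeneity in the three kinds of indices\<close>

definition homogeneous :: "('v \<Rightarrow> nat) \<Rightarrow> nat \<Rightarrow> 'v cpoly \<Rightarrow> bool" where
  "homogeneous W d p \<longleftrightarrow> (\<forall>m\<in>Poly_Mapping.keys p. weight W m = d)"

lemma homogeneous_var: "W v = d \<Longrightarrow> homogeneous W d (var v)"
  by (simp add: homogeneous_def var_def weight_single)

lemma homogeneous_const: "homogeneous W 0 (const_poly c)"
  by (simp add: homogeneous_def const_poly_def weight_def)

lemma homogeneous_add: "homogeneous W d p \<Longrightarrow> homogeneous W d q \<Longrightarrow> homogeneous W d (p + q)"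
  using keys_add[of p q] by (auto simp: homogeneous_def)

lemma homogeneous_diff: "homogeneous W d p \<Longrightarrow> homogeneous W d q \<Longrightarrow> homogeneous W d (p - q)"
  using keys_diff[of p q] by (auto simp: homogeneous_def)

lemma homogeneous_mult: "homogeneous W d p \<Longrightarrow> homogeneous W e q \<Longrightarrow> d + e = k \<Longrightarrow> homogeneous W k (p * q)"
  using keys_mult[of p q] by (fastforce simp: homogeneous_def weight_add)

lemma homogeneous_var_cancel: "homogeneous W (W v + d) (var v * q) \<Longrightarrow> homogeneous W d q"
  using keys_var_mult[of _ q v] by (fastforce simp: homogeneous_def weight_add weight_single)

text \<open>The values of \<open>A\<close>, \<open>B\<close>, \<open>C\<close> are free weights for
  the values of the three indices, index value 1 being at argument 0. Their coefficients in the
  degree form the weight of the polynomial.\<close>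

lemma homogeneous_formulas:
  fixes A B C :: "nat \<Rightarrow> nat"
  assumes W: "\<And>m. m < 12 \<Longrightarrow> W (idx_at m) = A (m div 6) + B (m div 3 mod 2) + C (m mod 3)"
  shows "homogeneous W (A 0 + A 1 + B 0 + B 1 + 2 * C 0) (D12 X)"
    "homogeneous W (A 0 + A 1 + 2 * B 0 + C 0 + C 1) (D13 X)"
    "homogeneous W (2 * A 0 + B 0 + B 1 + C 0 + C 1) (D23 X)"
    "homogeneous W (2 * A 0 + A 1 + 2 * B 0 + B 1 + 2 * C 0 + C 1) (F3 X)"
    "homogeneous W (2 * A 0 + A 1 + 2 * B 0 + B 1 + C 0 + C 1 + C 2) (U X)"
    "homogeneous W (2 * A 0 + 2 * A 1 + 3 * B 0 + B 1 + 2 * C 0 + C 1 + C 2) (V X)"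
    "homogeneous W (3 * A 0 + A 1 + 2 * B 0 + 2 * B 1 + 2 * C 0 + C 1 + C 2) (Vs X)"
  unfolding formulas power2_eq_square const_poly_numeral[symmetric]
  by (auto intro!: homogeneous_diff homogeneous_add homogeneous_mult homogeneous_const homogeneous_var simp: W)

section \<open>Leading terms of the generators and the encoded relations\<close>

lemma listmon_perm: "mset ms = mset ns \<Longrightarrow> listmon (map f ms) = listmon (map f ns)"
  by (rule poly_mapping_eqI) (metis count_mset lookup_listmon mset_map)

lemma lead_mult_list:
  assumes "lead p (listmon (map idx_at ms)) 1" "lead q (listmon (map idx_at ns)) 1"
  shows "lead (p * q) (listmon (map idx_at (ms @ ns))) 1"
  using lead_mult[OF assms] by (simp add: listmon_append)

lemma lead_var_mult_cancel:
  assumes "lead (X k * q) (listmon (map idx_at ms)) 1" "mset ms = mset (k # ns)"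
  shows "lead q (listmon (map idx_at ns)) 1"
proof (rule lead_cancel)
  have "listmon (map idx_at ms) = Poly_Mapping.single (idx_at k) 1 + listmon (map idx_at ns)"
    using listmon_perm[OF assms(2), of idx_at] by (simp add: listmon_simps)
  then show "lead (X k * q) (Poly_Mapping.single (idx_at k) 1 + listmon (map idx_at ns)) (1 * 1)"
    using assms(1) by simp
qed (rule lead_var)

lemma below_list:
  assumes "lead p (listmon (map idx_at ms)) 1" "set ms \<subseteq> {..<12}" "set ns \<subseteq> {..<12}" "lex_less (counts ms) (counts ns)"
  shows "below p (listmon (map idx_at ns))"
  using assms(1) listmon_less[OF assms(2-4)] by (rule lead_below)

fun lead_list :: "gen \<Rightarrow> nat list" where
  "lead_list GX = [0]"
| "lead_list GD12 = [0, 9]"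
| "lead_list GD13 = [0, 7]"
| "lead_list GD23 = [0, 4]"
| "lead_list GF3 = [0, 0, 10]"
| "lead_list GU = [0, 4, 8]"
| "lead_list GF4 = [0, 0, 10, 10]"
| "lead_list GV = [0, 0, 7, 11]"
| "lead_list GVs = [0, 0, 4, 11]"
| "lead_list GF5 = [0, 0, 4, 7, 11]"
| "lead_list GPhi = [0, 0, 4, 7, 11, 11]"
| "lead_list GPsi = [0, 0, 0, 7, 10, 11]"
| "lead_list GPsis = [0, 0, 0, 4, 10, 11]"

text \<open>A relation \<open>m - m' - t\<close> is encoded by the factors of \<open>m\<close>, the factors of \<open>m'\<close>, and the
  terms of \<open>t\<close>.\<close>

definition relation_data :: "(gen list \<times> gen list \<times> (complex \<times> gen list) list) list" where
  "relation_data =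
   [([GF3, GF3], [GX, GX, GF4], [(- 4, [GD12, GD13, GD23])]),
    ([GD23, GV], [GX, GF5], [(- (1/2), [GF3, GU])]),
    ([GD13, GVs], [GX, GF5], [(1/2, [GF3, GU])]),
    ([GF3, GV], [GX, GPsi], [(2, [GD12, GD13, GU])]),
    ([GF3, GVs], [GX, GPsis], [(- 2, [GD12, GD23, GU])]),
    ([GF3, GF5], [GD23, GPsi], [(1/2, [GX, GU, GF4])]),
    ([GD13, GPsis], [GD23, GPsi], [(1, [GX, GU, GF4])]),
    ([GV, GVs], [GX, GX, GPhi], [(1, [GD12, GU, GU])]),
    ([GV, GF5], [GX, GD13, GPhi], [(- (1/2), [GU, GPsi])]),
    ([GVs, GF5], [GX, GD23, GPhi], [(1/2, [GU, GPsis])]),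
    ([GF3, GPsi], [GX, GF4, GV], [(- 4, [GD12, GD13, GF5])]),
    ([GF3, GPsis], [GX, GF4, GVs], [(- 4, [GD12, GD23, GF5])]),
    ([GF5, GF5], [GD13, GD23, GPhi], [(1/4, [GU, GU, GF4])]),
    ([GVs, GPsi], [GX, GF3, GPhi], [(- 2, [GD12, GU, GF5])]),
    ([GV, GPsis], [GX, GF3, GPhi], [(2, [GD12, GU, GF5])]),
    ([GF5, GPsi], [GD13, GF3, GPhi], [(- (1/2), [GU, GF4, GV])]),
    ([GF5, GPsis], [GD23, GF3, GPhi], [(1/2, [GU, GF4, GVs])]),
    ([GPsi, GPsi], [GF4, GV, GV], [(- 4, [GD12, GD13, GD13, GPhi])]),
    ([GPsis, GPsis], [GF4, GVs, GVs], [(- 4, [GD12, GD23, GD23, GPhi])]),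
    ([GPsi, GPsis], [GX, GX, GF4, GPhi], [(- 1, [GD12, GU, GU, GF4]), (- 4, [GD12, GD13, GD23, GPhi])])]"

definition tail :: "(complex \<times> gen list) list \<Rightarrow> gen cpoly" where
  "tail ts = sum_list (map (\<lambda>(c, gs). const_poly c * prod_list (map var gs)) ts)"

lemma relation_heads_eq:
  "relation_heads = map (\<lambda>(h, m, ts). (prod_list (map var h), prod_list (map var m))) relation_data"
  by (simp add: relation_heads_def relation_data_def power2_eq_square mult.assoc)

lemma keys_tail: "Poly_Mapping.keys (tail ts) \<subseteq> (\<lambda>(c, gs). listmon gs) ` set ts"
proof (induction ts)
  case (Cons a ts)
  obtain c gs where a: "a = (c, gs)" by force
  have "tail (a # ts) = const_poly c * monomial_poly (listmon gs) + tail ts"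
    by (simp add: tail_def a monomial_poly_listmon)
  moreover have "Poly_Mapping.keys (const_poly c * monomial_poly (listmon gs)) \<subseteq> {listmon gs}"
    by (auto simp: const_poly_def monomial_poly_def mult_single)
  ultimately show ?case
    using Cons keys_add[of "const_poly c * monomial_poly (listmon gs)" "tail ts"] by (auto simp: a)
qed (simp add: tail_def)

locale generators_223 =
  all_syzygies "X 0" "D12 X" "D13 X" "D23 X" "F3 X" "U X" "F4 X" "V X" "Vs X" f5 \<psi> \<psi>s "const_poly (1/2)" \<phi>
  for f5 \<psi> \<psi>s \<phi>
begin

abbreviation \<gamma> :: "gen \<Rightarrow> poly223" where
  "\<gamma> \<equiv> generator f5 \<phi> \<psi> \<psi>s"

lemma \<gamma>_simps:
  "\<gamma> GX = X 0" "\<gamma> GD12 = D12 X" "\<gamma> GD13 = D13 X" "\<gamma> GD23 = D23 X" "\<gamma> GF3 = F3 X" "\<gamma> GU = U X"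
  "\<gamma> GF4 = F4 X" "\<gamma> GV = V X" "\<gamma> GVs = Vs X" "\<gamma> GF5 = f5" "\<gamma> GPhi = \<phi>" "\<gamma> GPsi = \<psi>" "\<gamma> GPsis = \<psi>s"
  by (simp_all add: generators_eq xvar_eq)

text \<open>For \<open>f4\<close> and the four new generators the numerator has a product of known
  leading terms on top of lower terms, and the factors \<open>x111\<close> are cancelled from its
  leading term.\<close>

lemma lead_\<gamma>: "lead (\<gamma> g) (listmon (map idx_at (lead_list g))) 1"
proof -
  note base = lead_formulas
  have x: "lead (X 0) (listmon (map idx_at [0])) 1"
    using lead_var[of "idx_at 0"] by (simp add: listmon_simps)
  have "below (const_poly (1/2) * (U X * F3 X)) (listmon (map idx_at ([0, 4] @ [0, 0, 7, 11])))"
    by (rule below_const_mult, rule below_list[OF lead_mult_list[OF base(5,4)]]) (simp_all add: counts_def)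
  then have "lead (X 0 * f5) (listmon (map idx_at ([0, 4] @ [0, 0, 7, 11]))) 1"
    unfolding ef5 mult.assoc by (rule lead_add_below[OF lead_mult_list[OF base(3,6)]])
  then have f5: "lead f5 (listmon (map idx_at [0, 0, 4, 7, 11])) 1"
    by (rule lead_var_mult_cancel) simp
  have "below (const_poly 2 * (D12 X * D13 X * U X)) (listmon (map idx_at ([0, 0, 10] @ [0, 0, 7, 11])))"
    by (rule below_const_mult, rule below_list[OF lead_mult_list[OF lead_mult_list[OF base(1,2)] base(5)]])
      (simp_all add: counts_def)
  then have "lead (F3 X * V X - const_poly 2 * (D12 X * D13 X * U X)) (listmon (map idx_at ([0, 0, 10] @ [0, 0, 7, 11]))) 1"
    by (rule lead_diff_below[OF lead_mult_list[OF base(4,6)]])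
  then have "lead (X 0 * \<psi>) (listmon (map idx_at ([0, 0, 10] @ [0, 0, 7, 11]))) 1"
    by (simp only: e\<psi> mult.assoc const_poly_numeral)
  then have \<psi>: "lead \<psi> (listmon (map idx_at [0, 0, 0, 7, 10, 11])) 1"
    by (rule lead_var_mult_cancel) simp
  have "below (const_poly 2 * (D12 X * D23 X * U X)) (listmon (map idx_at ([0, 0, 10] @ [0, 0, 4, 11])))"
    by (rule below_const_mult, rule below_list[OF lead_mult_list[OF lead_mult_list[OF base(1,3)] base(5)]])
      (simp_all add: counts_def)
  then have "lead (F3 X * Vs X + const_poly 2 * (D12 X * D23 X * U X)) (listmon (map idx_at ([0, 0, 10] @ [0, 0, 4, 11]))) 1"
    by (rule lead_add_below[OF lead_mult_list[OF base(4,7)]])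
  then have "lead (X 0 * \<psi>s) (listmon (map idx_at ([0, 0, 10] @ [0, 0, 4, 11]))) 1"
    by (simp only: e\<psi>s mult.assoc const_poly_numeral)
  then have \<psi>s: "lead \<psi>s (listmon (map idx_at [0, 0, 0, 4, 10, 11])) 1"
    by (rule lead_var_mult_cancel) simp
  have "below (D12 X * (U X * U X)) (listmon (map idx_at ([0, 0, 7, 11] @ [0, 0, 4, 11])))"
    by (rule below_list[OF lead_mult_list[OF base(1) lead_mult_list[OF base(5,5)]]]) (simp_all add: counts_def)
  then have "lead (V X * Vs X - D12 X * (U X * U X)) (listmon (map idx_at ([0, 0, 7, 11] @ [0, 0, 4, 11]))) 1"
    by (rule lead_diff_below[OF lead_mult_list[OF base(6,7)]])
  then have "lead (X 0 * (X 0 * \<phi>)) (listmon (map idx_at ([0, 0, 7, 11] @ [0, 0, 4, 11]))) 1"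
    using e\<phi> by (simp only: power2_eq_square mult.assoc)
  then have "lead (X 0 * \<phi>) (listmon (map idx_at [0, 0, 0, 4, 7, 11, 11])) 1"
    by (rule lead_var_mult_cancel) simp
  then have \<phi>: "lead \<phi> (listmon (map idx_at [0, 0, 4, 7, 11, 11])) 1"
    by (rule lead_var_mult_cancel) simp
  have "below (const_poly 4 * (D12 X * D13 X * D23 X)) (listmon (map idx_at ([0, 0, 10] @ [0, 0, 10])))"
    by (rule below_const_mult, rule below_list[OF lead_mult_list[OF lead_mult_list[OF base(1,2)] base(3)]])
      (simp_all add: counts_def)
  then have "lead (F3 X * F3 X + const_poly 4 * (D12 X * D13 X * D23 X)) (listmon (map idx_at ([0, 0, 10] @ [0, 0, 10]))) 1"
    by (rule lead_add_below[OF lead_mult_list[OF base(4,4)]])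
  then have "lead (X 0 * (X 0 * F4 X)) (listmon (map idx_at ([0, 0, 10] @ [0, 0, 10]))) 1"
    using ef4 by (simp only: power2_eq_square mult.assoc const_poly_numeral)
  then have "lead (X 0 * F4 X) (listmon (map idx_at [0, 0, 0, 10, 10])) 1"
    by (rule lead_var_mult_cancel) simp
  then have f4: "lead (F4 X) (listmon (map idx_at [0, 0, 10, 10])) 1"
    by (rule lead_var_mult_cancel) simp
  show ?thesis
    by (cases g) (simp_all only: \<gamma>_simps lead_list.simps x base f5 \<phi> \<psi> \<psi>s f4)
qed

lemma lead_monomial:
  "lead (subst \<gamma> (monomial_poly (listmon gs))) (listmon (map idx_at (concat (map lead_list gs)))) 1"
proof -
  have "lead (prod_list (map \<gamma> gs)) (listmon (map idx_at (concat (map lead_list gs)))) 1"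
  proof (induction gs)
    case Nil
    show ?case using lead_const[of 1] by (simp add: const_poly_simps listmon_simps)
  next
    case (Cons g gs)
    then show ?case using lead_mult_list[OF lead_\<gamma>] by simp
  qed
  then show ?thesis by (simp add: subst_monomial_poly mono_value_listmon)
qed

lemma relation_identities:
  "(h, m, ts) \<in> set relation_data \<Longrightarrow>
    subst \<gamma> (prod_list (map var h)) - subst \<gamma> (prod_list (map var m)) = subst \<gamma> (tail ts)"
proof -
  \<comment> \<open>The constants are expressed by \<open>const_poly (1/2)\<close>, the
    \<open>H\<close> of the locale, with one quarter as its square.\<close>
  have c: "const_poly (- (1/2)) = - const_poly (1/2 :: complex)" "const_poly (1/4) = const_poly (1/2 :: complex) ^ 2"
    "const_poly (- 4) = (- 4 :: poly223)" "const_poly (- 2) = (- 2 :: poly223)" "const_poly 2 = (2 :: poly223)"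
    "const_poly (- 1) = (- 1 :: poly223)" "const_poly 1 = (1 :: poly223)"
    by (simp_all add: const_poly_simps const_poly_numeral const_poly_power[symmetric] power_divide)
  have "list_all (\<lambda>(h, m, ts). subst \<gamma> (prod_list (map var h)) - subst \<gamma> (prod_list (map var m)) = subst \<gamma> (tail ts)) relation_data"
    unfolding relation_data_def list.pred_inject prod.case tail_def list.map prod_list.Cons prod_list.Nil
      sum_list.Cons sum_list.Nil subst_hom subst_var subst_1 subst_0 subst_const \<gamma>_simps c mult_1_right add_0_right
    apply (intro conjI TrueI)
    subgoal using R1 by algebra
    subgoal using R2 by algebra
    subgoal using R3 by algebra
    subgoal using R4 by algebra
    subgoal using R5 by algebra
    subgoal using R6 by algebra
    subgoal using R7 by algebra
    subgoal using R8 by algebra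
    subgoal using R9 by algebra
    subgoal using R10 by algebra
    subgoal using R11 by algebra
    subgoal using R12 by algebra
    subgoal using R13 by algebra
    subgoal using R14 by algebra
    subgoal using R15 by algebra
    subgoal using R16 by algebra
    subgoal using R17 by algebra
    subgoal using R18 by algebra
    subgoal using R19 by algebra
    subgoal using R20 by algebra
    subgoal by simp
    done
  then show "(h, m, ts) \<in> set relation_data \<Longrightarrow>
    subst \<gamma> (prod_list (map var h)) - subst \<gamma> (prod_list (map var m)) = subst \<gamma> (tail ts)"
    by (auto simp: list_all_iff)
qed

lemma relation_leads:
  "list_all (\<lambda>(h, m, ts). mset (concat (map lead_list h)) = mset (concat (map lead_list m)) \<and>
    list_all (\<lambda>(c, gs). lex_less (counts (concat (map lead_list gs))) (counts (concat (map lead_list h)))) ts) relation_data"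
  by (simp add: relation_data_def counts_def)

lemma lead_list_less: "set (concat (map lead_list gs)) \<subseteq> {..<12}"
proof -
  have "set (lead_list g) \<subseteq> {..<12}" for g by (cases g) simp_all
  then show ?thesis by (induction gs) auto
qed

lemma relations_equiv_mod_tail:
  assumes "(h, m, ts) \<in> set relation_data"
  shows "equiv_mod_tail \<gamma> (prod_list (map var h)) (prod_list (map var m)) (tail ts)"
  unfolding equiv_mod_tail_def
proof (intro conjI ballI)
  have l: "mset (concat (map lead_list h)) = mset (concat (map lead_list m))"
    "\<And>c gs. (c, gs) \<in> set ts \<Longrightarrow> lex_less (counts (concat (map lead_list gs))) (counts (concat (map lead_list h)))"
    using relation_leads assms by (auto simp: list_all_iff)
  have lm: "leading_monomial (subst \<gamma> (monomial_poly (listmon gs))) = listmon (map idx_at (concat (map lead_list gs)))" for gs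
    using lead_monomial by (rule lead_leading_monomial)
  show "leading_monomial (subst \<gamma> (prod_list (map var h))) = leading_monomial (subst \<gamma> (prod_list (map var m)))"
    unfolding monomial_poly_listmon[symmetric] lm by (rule listmon_perm[OF l(1)])
  show "subst \<gamma> (prod_list (map var h)) - subst \<gamma> (prod_list (map var m)) = subst \<gamma> (tail ts)"
    using assms by (rule relation_identities)
  fix n assume "n \<in> Poly_Mapping.keys (tail ts)"
  then obtain c gs where gs: "(c, gs) \<in> set ts" "n = listmon gs" using keys_tail[of ts] by auto
  show "leading_monomial (subst \<gamma> (monomial_poly n)) < leading_monomial (subst \<gamma> (prod_list (map var h)))"
    unfolding gs(2) monomial_poly_listmon[symmetric] lm
    using lead_list_less lead_list_less l(2)[OF gs(1)] by (rule listmon_less)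
qed

text \<open>Eight elements are invariant by direct computation; the others become invariant after
  multiplication by \<open>x111\<close> or its square, which \<open>A223_cancel\<close>
  removes.\<close>

lemma \<gamma>_in_A223: "\<gamma> g \<in> A223"
proof -
  note A = A223_generators A223_closed
  have num: "(2 :: poly223) \<in> A223" "(4 :: poly223) \<in> A223"
    using A223_closed(1)[of 2] A223_closed(1)[of 4] by (simp_all add: const_poly_numeral)
  have n2: "X 0 ^ 2 \<noteq> 0" by simp
  have "X 0 * f5 \<in> A223" "X 0 * \<psi> \<in> A223" "X 0 * \<psi>s \<in> A223" "X 0 ^ 2 * \<phi> \<in> A223" "X 0 ^ 2 * F4 X \<in> A223"
    unfolding ef5 e\<psi> e\<psi>s e\<phi> ef4 by (intro A num)+
  then have "f5 \<in> A223" "\<psi> \<in> A223" "\<psi>s \<in> A223" "\<phi> \<in> A223" "F4 X \<in> A223"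
    by (auto dest: A223_cancel[OF A(1) X_nonzero] A223_cancel[OF A223_closed(5)[OF A(1)] n2])
  then show ?thesis by (cases g) (simp_all only: \<gamma>_simps A)
qed

text \<open>The numerators are homogeneous by \<open>homogeneous_formulas\<close>, and dividing by a
  variable subtracts its weight.\<close>

lemma homogeneous_generators:
  fixes A B C :: "nat \<Rightarrow> nat"
  assumes W: "\<And>m. m < 12 \<Longrightarrow> W (idx_at m) = A (m div 6) + B (m div 3 mod 2) + C (m mod 3)"
  shows "homogeneous W (3 * A 0 + 2 * A 1 + 3 * B 0 + 2 * B 1 + 2 * C 0 + 2 * C 1 + C 2) f5"
    "homogeneous W (3 * A 0 + 3 * A 1 + 3 * B 0 + 3 * B 1 + 2 * C 0 + 2 * C 1 + 2 * C 2) \<phi>"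
    "homogeneous W (3 * A 0 + 3 * A 1 + 4 * B 0 + 2 * B 1 + 3 * C 0 + 2 * C 1 + C 2) \<psi>"
    "homogeneous W (4 * A 0 + 2 * A 1 + 3 * B 0 + 3 * B 1 + 3 * C 0 + 2 * C 1 + C 2) \<psi>s"
proof -
  note F = homogeneous_formulas[of W A B C, OF W]
  have x: "W (idx_at 0) = A 0 + B 0 + C 0" by (simp add: W)
  have num: "homogeneous W 0 (2 :: poly223)"
    using homogeneous_const[of W 2] by (simp add: const_poly_numeral)
  have "homogeneous W (W (idx_at 0) + (3 * A 0 + 2 * A 1 + 3 * B 0 + 2 * B 1 + 2 * C 0 + 2 * C 1 + C 2)) (X 0 * f5)"
    unfolding ef5
    by (rule homogeneous_add homogeneous_mult homogeneous_const F refl | simp add: x)+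
  then show "homogeneous W (3 * A 0 + 2 * A 1 + 3 * B 0 + 2 * B 1 + 2 * C 0 + 2 * C 1 + C 2) f5"
    by (rule homogeneous_var_cancel)
  have "homogeneous W (W (idx_at 0) + (3 * A 0 + 3 * A 1 + 4 * B 0 + 2 * B 1 + 3 * C 0 + 2 * C 1 + C 2)) (X 0 * \<psi>)"
    unfolding e\<psi>
    by (rule homogeneous_diff homogeneous_mult num F refl | simp add: x)+
  then show "homogeneous W (3 * A 0 + 3 * A 1 + 4 * B 0 + 2 * B 1 + 3 * C 0 + 2 * C 1 + C 2) \<psi>"
    by (rule homogeneous_var_cancel)
  have "homogeneous W (W (idx_at 0) + (4 * A 0 + 2 * A 1 + 3 * B 0 + 3 * B 1 + 3 * C 0 + 2 * C 1 + C 2)) (X 0 * \<psi>s)"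
    unfolding e\<psi>s
    by (rule homogeneous_add homogeneous_mult num F refl | simp add: x)+
  then show "homogeneous W (4 * A 0 + 2 * A 1 + 3 * B 0 + 3 * B 1 + 3 * C 0 + 2 * C 1 + C 2) \<psi>s"
    by (rule homogeneous_var_cancel)
  have "homogeneous W (W (idx_at 0) + (W (idx_at 0) + (3 * A 0 + 3 * A 1 + 3 * B 0 + 3 * B 1 + 2 * C 0 + 2 * C 1 + 2 * C 2))) (X 0 * (X 0 * \<phi>))"
    unfolding mult.assoc[symmetric] power2_eq_square[symmetric] e\<phi>
    unfolding power2_eq_square
    by (rule homogeneous_diff homogeneous_mult F refl | simp add: x)+
  then show "homogeneous W (3 * A 0 + 3 * A 1 + 3 * B 0 + 3 * B 1 + 2 * C 0 + 2 * C 1 + 2 * C 2) \<phi>"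
    by (rule homogeneous_var_cancel[OF homogeneous_var_cancel])
qed

end

section \<open>Weights of monomials from gradings\<close>

lemma weight_idx:
  "weight W m = (\<Sum>i\<in>UNIV. \<Sum>j\<in>UNIV. \<Sum>k\<in>UNIV. Poly_Mapping.lookup m (Idx i j k) * W (Idx i j k))"
proof -
  have bij: "bij_betw (\<lambda>(i, j, k). Idx i j k) UNIV (UNIV :: idx set)"
    by (rule bij_betw_byWitness[where f' = "\<lambda>v. (idx1 v, idx2 v, idx3 v)"]) auto
  then have fin: "finite (UNIV :: idx set)" using bij_betw_finite[OF bij] by simp
  have "weight W m = (\<Sum>v\<in>UNIV. Poly_Mapping.lookup m v * W v)"
    unfolding weight_def using fin by (intro sum.mono_neutral_left) (auto simp: in_keys_iff)
  also have "\<dots> = (\<Sum>(i, j, k)\<in>UNIV. Poly_Mapping.lookup m (Idx i j k) * W (Idx i j k))"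
    by (subst sum.reindex_bij_betw[OF bij, symmetric]) (simp add: case_prod_beta)
  also have "\<dots> = (\<Sum>i\<in>UNIV. \<Sum>j\<in>UNIV. \<Sum>k\<in>UNIV. Poly_Mapping.lookup m (Idx i j k) * W (Idx i j k))"
    by (simp add: sum.cartesian_product)
  finally show ?thesis .
qed

text \<open>Taking as index weights the indicator \<open>e a\<close> of one index value, and the
  zero function \<open>z\<close> for the other two kinds of indices, extracts one entry of the
  weight at a time.\<close>

lemma weight_vectorI:
  assumes hom: "\<And>W A B C. (\<And>m. m < 12 \<Longrightarrow> W (idx_at m) = A (m div 6) + B (m div 3 mod 2) + C (m mod 3)) \<Longrightarrow>
    homogeneous W (l1 * A 0 + l2 * A 1 + m1 * B 0 + m2 * B 1 + n1 * C 0 + n2 * C 1 + n3 * C 2) p"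
    and k: "k \<in> Poly_Mapping.keys p"
  shows "monomial_weight k = ((l1, l2), (m1, m2), (n1, n2, n3))"
proof -
  define W :: "(nat \<Rightarrow> nat) \<Rightarrow> (nat \<Rightarrow> nat) \<Rightarrow> (nat \<Rightarrow> nat) \<Rightarrow> idx \<Rightarrow> nat" where
    "W A B C v = A (pos2 (idx1 v) - 1) + B (pos2 (idx2 v) - 1) + C (pos3 (idx3 v) - 1)" for A B C v
  have W: "W A B C (idx_at m) = A (m div 6) + B (m div 3 mod 2) + C (m mod 3)" if "m < 12" for A B C m
    using less_12_cases[OF that] by (elim disjE; simp add: W_def idx_at_def pos2_def pos3_def flip: numeral_2_eq_2)
  have wt: "weight (W A B C) k = l1 * A 0 + l2 * A 1 + m1 * B 0 + m2 * B 1 + n1 * C 0 + n2 * C 1 + n3 * C 2" for A B C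
    using hom[of "W A B C" A B C, OF W] k by (simp add: homogeneous_def)
  define e :: "nat \<Rightarrow> nat \<Rightarrow> nat" where "e a b = (if a = b then 1 else 0)" for a b
  define z :: "nat \<Rightarrow> nat" where "z b = 0" for b
  note w = wt[unfolded weight_idx sum_2 sum_3 W_def]
  show ?thesis
    unfolding monomial_weight_def Let_def sum_2 sum_3
    using w[of "e 0" z z] w[of "e 1" z z] w[of z "e 0" z] w[of z "e 1" z] w[of z z "e 0"] w[of z z "e 1"] w[of z z "e 2"]
    by (simp add: e_def z_def pos2_def pos3_def)
qed

section \<open>Invariants on the slice\<close>

text \<open>The value stays a constant polynomial instead of a complex number, so that evaluation
  composes with substitutions.\<close>

definition evaluate :: "(nat \<Rightarrow> complex) \<Rightarrow> poly223 \<Rightarrow> poly223" where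
  "evaluate P p = subst (\<lambda>v. const_poly (P (number v))) p"

lemma evaluate_formulas:
  "evaluate P (X m) = const_poly (P (number (idx_at m)))"
  "evaluate P (D12 X) = const_poly (D12 P)" "evaluate P (D13 X) = const_poly (D13 P)"
  "evaluate P (D23 X) = const_poly (D23 P)" "evaluate P (F3 X) = const_poly (F3 P)"
  "evaluate P (U X) = const_poly (U P)" "evaluate P (V X) = const_poly (V P)" "evaluate P (Vs X) = const_poly (Vs P)"
  unfolding evaluate_def subst_generators
  by (simp_all add: formulas number_at const_poly_simps const_poly_power const_poly_numeral)

lemma evaluate_vanishing:
  assumes "\<And>P. evaluate P p = 0"
  shows "p = 0"
proof (rule vanishing_poly_eq_0)
  fix P :: "idx \<Rightarrow> complex"
  show "subst (\<lambda>v. const_poly (P v)) p = (0 :: poly223)"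
    using assms[of "\<lambda>m. P (idx_at m)"] by (simp add: evaluate_def at_number)
qed

text \<open>Evaluating the shifted variables at \<open>P\<close> is the same as evaluating at the
  shifted point.\<close>

lemma evaluate_invariant:
  assumes "p \<in> A223"
  shows "evaluate (shift1 s (shift2 r (shift3 \<alpha> \<beta> \<delta> P))) p = evaluate P p"
proof -
  have "subst (\<lambda>v. const_poly (P (number v))) (unipotent_shift s r \<alpha> \<beta> \<delta> X m)
    = (const_poly (shift1 s (shift2 r (shift3 \<alpha> \<beta> \<delta> P)) m) :: poly223)" if "m < 12" for m
    using less_12_cases[OF that]
    by (elim disjE; simp add: unipotent_shift_def shift1_def shift2_def shift3_def subst_hom number_at const_poly_simps)
  then have "evaluate P (subst (\<lambda>v. unipotent_shift s r \<alpha> \<beta> \<delta> X (number v)) p)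
    = evaluate (shift1 s (shift2 r (shift3 \<alpha> \<beta> \<delta> P))) p"
    by (simp add: evaluate_def subst_subst number_less)
  then show ?thesis using assms by (simp add: A223_iff)
qed

text \<open>The point of the slice \<open>x\<^sub>1\<^sub>1\<^sub>2 = x\<^sub>1\<^sub>1\<^sub>3 = x\<^sub>1\<^sub>2\<^sub>1 = x\<^sub>1\<^sub>2\<^sub>3 = x\<^sub>2\<^sub>1\<^sub>1 = 0\<close> in the \<open>N\<close>-orbit of \<open>P\<close>; its
  coordinates are determined by the values of the invariants at \<open>P\<close>.\<close>

definition slice :: "(nat \<Rightarrow> complex) \<Rightarrow> nat \<Rightarrow> complex" where
  "slice P m = [P 0, 0, 0, 0, D23 P / P 0, 0, 0, D13 P / P 0, U P / D23 P, D12 P / P 0,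
    F3 P / P 0 ^ 2, Vs P / (P 0 * D23 P)] ! m"

lemma evaluate_cong: "(\<And>m. m < 12 \<Longrightarrow> P m = Q m) \<Longrightarrow> evaluate P p = evaluate Q p"
  unfolding evaluate_def by (rule subst_cong_at) (simp add: number_at)

lemma evaluate_slice:
  assumes p: "p \<in> A223" and nz: "P 0 \<noteq> 0" "D23 P \<noteq> 0"
  shows "evaluate (slice P) p = evaluate P p"
proof -
  \<comment> \<open>The entries in \<open>S\<close> clear the coordinates \<open>P 1\<close>,
    \<open>P 3\<close> and \<open>P 6\<close>; \<open>\<beta>\<close> clears coordinate 2 for any
    \<open>\<delta>\<close>, and \<open>\<delta>\<close> then solves the linear equation for
    coordinate 5, whose coefficient is \<open>D23 P\<close>.\<close>
  define \<delta> where "\<delta> = (P 2 * P 3 - P 0 * P 5) / D23 P"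
  define \<beta> where "\<beta> = - (P 2 + \<delta> * P 1) / P 0"
  define S where "S = shift1 (- P 6 / P 0) (shift2 (- P 3 / P 0) (shift3 (- P 1 / P 0) \<beta> \<delta> P))"
  note inv = shift1_invariant shift2_invariant shift3_invariant
  have S: "S 0 = P 0" "D12 S = D12 P" "D13 S = D13 P" "D23 S = D23 P" "F3 S = F3 P" "U S = U P" "Vs S = Vs P"
    by (simp_all only: S_def inv)
  have Z: "S 1 = 0" "S 2 = 0" "S 3 = 0" "S 6 = 0"
    using nz(1) by (simp_all add: S_def shift1_def shift2_def shift3_def \<beta>_def)
  have "P 0 * S 5 = P 0 * P 5 - P 2 * P 3 + \<delta> * D23 P"
    using nz(1) by (simp add: S_def shift1_def shift2_def shift3_def \<beta>_def D23_def field_simps)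
  also have "\<dots> = 0" using nz(2) by (simp add: \<delta>_def)
  finally have Z5: "S 5 = 0" using nz(1) by simp
  \<comment> \<open>With these coordinates zero, each of the invariants used collapses to a single
    product, which can be solved for one remaining coordinate.\<close>
  have 4: "S 4 = D23 P / P 0" and 7: "S 7 = D13 P / P 0" and 9: "S 9 = D12 P / P 0"
    using S(2-4) nz(1) by (simp_all only: D12_def[of S] D13_def[of S] D23_def[of S] Z S(1)) (simp_all add: field_simps)
  have 10: "S 10 = F3 P / P 0 ^ 2"
    using S(5) nz(1) by (simp only: F3_def[of S] Z S(1)) (simp add: field_simps)
  have 8: "S 8 = U P / D23 P"
    using S(6) nz by (simp only: U_def[of S] Z Z5 S(1) 4) (simp add: field_simps)
  have 11: "S 11 = Vs P / (P 0 * D23 P)"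
    using S(7) nz by (simp only: Vs_def[of S] Z Z5 S(1) 4) (simp add: field_simps)
  have "S m = slice P m" if "m < 12" for m
    using less_12_cases[OF that] by (elim disjE; simp add: slice_def S(1) Z Z5 4 7 8 9 10 11 del: One_nat_def)
  then have "evaluate (slice P) p = evaluate S p" by (intro evaluate_cong) simp
  then show ?thesis unfolding S_def evaluate_invariant[OF p] .
qed

section \<open>Polynomials in the eight elementary invariants\<close>

definition supported :: "'g set \<Rightarrow> 'g cpoly \<Rightarrow> bool" where
  "supported C q \<longleftrightarrow> (\<forall>n\<in>Poly_Mapping.keys q. Poly_Mapping.keys n \<subseteq> C)"

lemma supported_const: "supported C (const_poly c)"
  by (simp add: supported_def const_poly_def)

lemma supported_var: "g \<in> C \<Longrightarrow> supported C (var g)"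
  by (simp add: supported_def var_def)

lemma supported_add: "supported C p \<Longrightarrow> supported C q \<Longrightarrow> supported C (p + q)"
  using keys_add[of p q] by (auto simp: supported_def)

lemma supported_mult: "supported C p \<Longrightarrow> supported C q \<Longrightarrow> supported C (p * q)"
  unfolding supported_def
proof (intro ballI)
  assume s: "\<forall>n\<in>Poly_Mapping.keys p. Poly_Mapping.keys n \<subseteq> C" "\<forall>n\<in>Poly_Mapping.keys q. Poly_Mapping.keys n \<subseteq> C"
  fix n assume "n \<in> Poly_Mapping.keys (p * q)"
  then obtain a b where ab: "n = a + b" "a \<in> Poly_Mapping.keys p" "b \<in> Poly_Mapping.keys q"
    using keys_mult[of p q] by auto
  then show "Poly_Mapping.keys n \<subseteq> C" using s keys_add[of a b] by fast
qed

lemma supported_power: "supported C p \<Longrightarrow> supported C (p ^ k)"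
  using supported_const[of C 1] by (induction k) (simp_all add: supported_mult const_poly_simps)

text \<open>The seven generators that give the slice coordinates, and \<open>GV\<close>, which
  enters when \<open>GF3 * GU\<close> is rewritten.\<close>

definition elementary_gens :: "gen set" where
  "elementary_gens = {GX, GD12, GD13, GD23, GF3, GU, GV, GVs}"

lemma UNIV_gen: "UNIV = {GX, GD12, GD13, GD23, GF3, GU, GF4, GV, GVs, GF5, GPhi, GPsi, GPsis}"
proof -
  have "g \<in> {GX, GD12, GD13, GD23, GF3, GU, GF4, GV, GVs, GF5, GPhi, GPsi, GPsis}" for g
    by (cases g) simp_all
  then show ?thesis by blast
qed

context generators_223
begin

text \<open>The slice coordinates are fractions in the invariants with denominators dividing
  \<open>x111 ^ 2 * d23\<close>, so a power of this product clears the denominators of any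
  polynomial in them.\<close>

lemma slice_denominator:
  "\<exists>N q. supported elementary_gens q \<and> (\<forall>P. P 0 \<noteq> 0 \<longrightarrow> D23 P \<noteq> 0 \<longrightarrow>
    evaluate P (subst \<gamma> q) = const_poly ((P 0 ^ 2 * D23 P) ^ N) * evaluate (slice P) p)"
proof (induction p rule: cpoly_induct)
  case (const c)
  show ?case
    by (intro exI[of _ 0] exI[of _ "const_poly c"]) (simp add: supported_const evaluate_def const_poly_simps)
next
  case (var v)
  \<comment> \<open>Entry \<open>m\<close> is \<open>x111 ^ 2 * d23\<close> times the slice
    coordinate \<open>m\<close>, written in the generators.\<close>
  define l where "l = [var GX ^ 3 * var GD23, 0, 0, 0, var GX * var GD23 ^ 2, 0, 0,
    var GX * var GD13 * var GD23, var GX ^ 2 * var GU, var GX * var GD12 * var GD23,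
    var GF3 * var GD23, var GX * var GVs]"
  have sl: "evaluate (slice P) (var v) = const_poly (slice P (number v))" for P
    by (simp add: evaluate_def)
  have "supported elementary_gens (0 :: gen cpoly)"
    by (simp add: supported_def)
  then have "\<forall>q\<in>set l. supported elementary_gens q"
    unfolding l_def by (auto intro!: supported_mult supported_power supported_var simp: elementary_gens_def)
  moreover have "l ! number v \<in> set l"
    using number_less[of v] by (intro nth_mem) (simp add: l_def)
  ultimately have "supported elementary_gens (l ! number v)" by blast
  moreover have "evaluate P (subst \<gamma> (l ! number v)) = const_poly ((P 0 ^ 2 * D23 P) ^ 1) * evaluate (slice P) (var v)"
    if nz: "P 0 \<noteq> 0" "D23 P \<noteq> 0" for P
  proof -
    have ev: "evaluate P (p * q) = evaluate P p * evaluate P q" "evaluate P (p ^ k) = evaluate P p ^ k" "evaluate P 0 = 0" for p q k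
      by (simp_all add: evaluate_def subst_hom)
    note rules = subst_hom subst_var subst_0 generators_eq xvar_eq ev evaluate_formulas number_at const_poly_power[symmetric] const_poly_simps(5)[symmetric]
    show ?thesis
      unfolding sl using less_12_cases[OF number_less[of v]] nz
      by (elim disjE; simp add: l_def slice_def rules field_simps power2_eq_square power3_eq_cube const_poly_simps(1))
  qed
  ultimately show ?case by blast
next
  case (add p1 p2)
  then obtain N1 q1 N2 q2 where q: "supported elementary_gens q1" "supported elementary_gens q2"
    "\<And>P. P 0 \<noteq> 0 \<Longrightarrow> D23 P \<noteq> 0 \<Longrightarrow> evaluate P (subst \<gamma> q1) = const_poly ((P 0 ^ 2 * D23 P) ^ N1) * evaluate (slice P) p1"
    "\<And>P. P 0 \<noteq> 0 \<Longrightarrow> D23 P \<noteq> 0 \<Longrightarrow> evaluate P (subst \<gamma> q2) = const_poly ((P 0 ^ 2 * D23 P) ^ N2) * evaluate (slice P) p2"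
    by blast
  let ?d = "var GX ^ 2 * var GD23"
  have d: "evaluate P (subst \<gamma> (?d ^ k)) = const_poly ((P 0 ^ 2 * D23 P) ^ k)" for P k
  proof -
    have "evaluate P (subst \<gamma> (?d ^ k)) = (evaluate P (X 0) ^ 2 * evaluate P (D23 X)) ^ k"
      by (simp add: subst_hom generators_eq xvar_eq evaluate_def)
    then show ?thesis by (simp add: evaluate_formulas number_at const_poly_simps const_poly_power)
  qed
  have sd: "supported elementary_gens (?d ^ k)" for k
    by (intro supported_power supported_mult supported_var) (simp_all add: elementary_gens_def)
  \<comment> \<open>The summands are brought to a common denominator.\<close>
  have "evaluate P (subst \<gamma> (q1 * ?d ^ N2 + q2 * ?d ^ N1)) = const_poly ((P 0 ^ 2 * D23 P) ^ (N1 + N2)) * evaluate (slice P) (p1 + p2)"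
    if nz: "P 0 \<noteq> 0" "D23 P \<noteq> 0" for P
  proof -
    have ev: "evaluate R (p + q) = evaluate R p + evaluate R q" "evaluate R (p * q) = evaluate R p * evaluate R q" for R p q
      by (simp_all add: evaluate_def subst_hom)
    show ?thesis
      unfolding subst_add subst_mult[of _ q1] subst_mult[of _ q2] ev d q(3)[OF nz] q(4)[OF nz] power_add const_poly_simps
      by (simp add: algebra_simps)
  qed
  moreover have "supported elementary_gens (q1 * ?d ^ N2 + q2 * ?d ^ N1)"
    by (intro supported_add supported_mult q sd)
  ultimately show ?case by blast
next
  case (mult p1 p2)
  then obtain N1 q1 N2 q2 where q: "supported elementary_gens q1" "supported elementary_gens q2"
    "\<And>P. P 0 \<noteq> 0 \<Longrightarrow> D23 P \<noteq> 0 \<Longrightarrow> evaluate P (subst \<gamma> q1) = const_poly ((P 0 ^ 2 * D23 P) ^ N1) * evaluate (slice P) p1"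
    "\<And>P. P 0 \<noteq> 0 \<Longrightarrow> D23 P \<noteq> 0 \<Longrightarrow> evaluate P (subst \<gamma> q2) = const_poly ((P 0 ^ 2 * D23 P) ^ N2) * evaluate (slice P) p2"
    by blast
  have "evaluate P (subst \<gamma> (q1 * q2)) = const_poly ((P 0 ^ 2 * D23 P) ^ (N1 + N2)) * evaluate (slice P) (p1 * p2)"
    if nz: "P 0 \<noteq> 0" "D23 P \<noteq> 0" for P
  proof -
    have ev: "evaluate R (p * q) = evaluate R p * evaluate R q" for R p q
      by (simp add: evaluate_def subst_hom)
    show ?thesis
      unfolding subst_mult ev q(3)[OF nz] q(4)[OF nz] power_add const_poly_simps by (simp add: algebra_simps)
  qed
  moreover have "supported elementary_gens (q1 * q2)"
    by (intro supported_mult q)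
  ultimately show ?case by blast
qed

lemma D_nonzero: "D23 X \<noteq> 0" "D13 X \<noteq> 0"
  using lead_formulas(2,3) lead_nonzero by blast+

lemma invariant_denominator:
  assumes "p \<in> A223"
  shows "\<exists>N q. supported elementary_gens q \<and> subst \<gamma> q = D23 X ^ N * (X 0 ^ (2 * N) * p)"
proof -
  obtain N q where q: "supported elementary_gens q" "\<And>P. P 0 \<noteq> 0 \<Longrightarrow> D23 P \<noteq> 0 \<Longrightarrow>
    evaluate P (subst \<gamma> q) = const_poly ((P 0 ^ 2 * D23 P) ^ N) * evaluate (slice P) p"
    using slice_denominator by blast
  have ev: "evaluate R (p * q) = evaluate R p * evaluate R q" "evaluate R (p - q) = evaluate R p - evaluate R q"
    "evaluate R (p ^ k) = evaluate R p ^ k" for R p q k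
    by (simp_all add: evaluate_def subst_hom)
  \<comment> \<open>The extra factor makes the identity hold also at points where the slice is
    undefined; it cancels in the polynomial ring.\<close>
  have "X 0 * D23 X * (subst \<gamma> q - D23 X ^ N * (X 0 ^ (2 * N) * p)) = 0"
  proof (rule evaluate_vanishing)
    fix P :: "nat \<Rightarrow> complex"
    show "evaluate P (X 0 * D23 X * (subst \<gamma> q - D23 X ^ N * (X 0 ^ (2 * N) * p))) = 0"
    proof (cases "P 0 \<noteq> 0 \<and> D23 P \<noteq> 0")
      case True
      then have "evaluate P (subst \<gamma> q) = const_poly ((P 0 ^ 2 * D23 P) ^ N) * evaluate P p"
        using q(2) evaluate_slice[OF assms] by simp
      then have "evaluate P (subst \<gamma> q - D23 X ^ N * (X 0 ^ (2 * N) * p)) = 0"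
        by (simp add: ev evaluate_formulas number_at const_poly_power const_poly_simps power_mult power_mult_distrib)
      then show ?thesis by (simp add: ev)
    next
      case False
      then show ?thesis by (auto simp: ev evaluate_formulas number_at const_poly_simps)
    qed
  qed
  then have "subst \<gamma> q = D23 X ^ N * (X 0 ^ (2 * N) * p)" using D_nonzero by simp
  then show ?thesis using q(1) by blast
qed

end

section \<open>Restrictions to coordinate subspaces\<close>

text \<open>The hypotheses say, in the order of the relations, that no left-hand side divides the
  monomial; \<open>c\<close>, \<open>d\<close>, \<open>e\<close>, \<open>h\<close>,
  \<open>i\<close>, \<open>j\<close>, \<open>l\<close>, \<open>m\<close> are the exponents of
  \<open>d13\<close>, \<open>d23\<close>, \<open>f3\<close>, \<open>v\<close>, \<open>v*\<close>,
  \<open>f5\<close>, \<open>\<psi>\<close>, \<open>\<psi>*\<close>. The nine cases cover the seven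
  families.\<close>

lemma irreducible_cases:
  fixes c d e h i j l m :: nat
  assumes irr: "e < 2" "d = 0 \<or> h = 0" "c = 0 \<or> i = 0" "e = 0 \<or> h = 0" "e = 0 \<or> i = 0" "e = 0 \<or> j = 0"
      "c = 0 \<or> m = 0" "h = 0 \<or> i = 0" "h = 0 \<or> j = 0" "i = 0 \<or> j = 0" "e = 0 \<or> l = 0" "e = 0 \<or> m = 0"
      "j < 2" "i = 0 \<or> l = 0" "h = 0 \<or> m = 0" "j = 0 \<or> l = 0" "j = 0 \<or> m = 0" "l < 2" "m < 2" "l = 0 \<or> m = 0"
  obtains "e = 1" "h = 0" "i = 0" "j = 0" "l = 0" "m = 0" | "j = 1" "e = 0" "h = 0" "i = 0" "l = 0" "m = 0"
    | "h > 0" "d = 0" "e = 0" "i = 0" "j = 0" "m = 0" "l = 0" | "h > 0" "d = 0" "e = 0" "i = 0" "j = 0" "m = 0" "l = 1"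
    | "i > 0" "c = 0" "e = 0" "h = 0" "j = 0" "l = 0" "m = 0" | "i > 0" "c = 0" "e = 0" "h = 0" "j = 0" "l = 0" "m = 1"
    | "e = 0" "h = 0" "i = 0" "j = 0" "m = 0" "l = 0" | "e = 0" "h = 0" "i = 0" "j = 0" "m = 0" "l = 1"
    | "e = 0" "h = 0" "i = 0" "j = 0" "l = 0" "m = 1" "c = 0"
proof -
  have *: "e = 0 \<or> e = 1" "j = 0 \<or> j = 1" "l = 0 \<or> l = 1" "m = 0 \<or> m = 1" using irr(1,13,18,19) by presburger+
  have l: "l = 1" if "l \<noteq> 0" using that *(3) by simp
  have m: "m = 1" if "m \<noteq> 0" using that *(4) by simp
  show thesis
  proof (cases "e = 0")
    case False
    then show thesis using irr(4,5,6,11,12) *(1) by (intro that(1)) simp_all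
  next
    case e: True
    show thesis
    proof (cases "j = 0")
      case False
      then show thesis using e irr(9,10,16,17) *(2) by (intro that(2)) simp_all
    next
      case j: True
      show thesis
      proof (cases "h = 0")
        case False
        then have "h > 0" "d = 0" "i = 0" "m = 0" using irr(2,8,15) by simp_all
        with e j l show thesis by (cases "l = 0") (rule that(3,4); simp)+
      next
        case h: True
        show thesis
        proof (cases "i = 0")
          case False
          then have "i > 0" "c = 0" "l = 0" using irr(3,14) by simp_all
          with e j h m show thesis by (cases "m = 0") (rule that(5,6); simp)+
        next
          case i: True
          show thesis
          proof (cases "l = 0")
            case False
            then have "m = 0" "l = 1" using irr(20) l by simp_all
            with e j h i show thesis by (intro that(8))
          next
            case True
            with e j h i m irr(7) show thesis by (cases "m = 0") (rule that(7,9); simp)+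
          qed
        qed
      qed
    qed
  qed
qed

text \<open>\<open>t\<close>, \<open>A\<close>, \<open>B\<close>, \<open>C\<close> are linear combinations of the exponents of the leading monomial on the slice
  \<open>x_slice_list\<close> below.\<close>

lemma irreducible_exponents:
  fixes b c d e h i j l m :: nat
  assumes irr: "e < 2" "d = 0 \<or> h = 0" "c = 0 \<or> i = 0" "e = 0 \<or> h = 0" "e = 0 \<or> i = 0" "e = 0 \<or> j = 0"
      "c = 0 \<or> m = 0" "h = 0 \<or> i = 0" "h = 0 \<or> j = 0" "i = 0 \<or> j = 0" "e = 0 \<or> l = 0" "e = 0 \<or> m = 0"
      "j < 2" "i = 0 \<or> l = 0" "h = 0 \<or> m = 0" "j = 0 \<or> l = 0" "j = 0 \<or> m = 0" "l < 2" "m < 2" "l = 0 \<or> m = 0"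
    and t: "j + l + m = t" and A: "c + d + e = A" and B: "b + d + e + i + m = B" and C: "b + c + e + h + l = C"
  shows "t < 2 \<and> h = C - (A + B) - t \<and> i = B - (A + C) - t \<and> m = (if t = 1 \<and> A + C < B then 1 else 0) \<and>
    l = (if t = 1 \<and> B \<le> A + C \<and> (odd (A + B + C) \<or> A + B < C) then 1 else 0) \<and>
    e = (if t = 0 \<and> h = 0 \<and> i = 0 \<and> odd (A + B + C) then 1 else 0)"
  using irr
  by (cases rule: irreducible_cases) (simp_all add: t[symmetric] A[symmetric] B[symmetric] C[symmetric], blast+)

text \<open>The bound on \<open>j + l + m\<close> lets the last equation separate it from
  \<open>k\<close>. The first three equations then give the sums \<open>A\<close>, \<open>B\<close>,
  \<open>C\<close> of \<open>irreducible_exponents\<close>, which determine \<open>h\<close>,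
  \<open>i\<close>, \<open>l\<close>, \<open>m\<close>, \<open>e\<close> and with them all
  exponents.\<close>

lemma exponents_unique:
  fixes b c d e f g h i j k l m :: nat
  assumes irr: "e < 2" "d = 0 \<or> h = 0" "c = 0 \<or> i = 0" "e = 0 \<or> h = 0" "e = 0 \<or> i = 0" "e = 0 \<or> j = 0"
      "c = 0 \<or> m = 0" "h = 0 \<or> i = 0" "h = 0 \<or> j = 0" "i = 0 \<or> j = 0" "e = 0 \<or> l = 0" "e = 0 \<or> m = 0"
      "j < 2" "i = 0 \<or> l = 0" "h = 0 \<or> m = 0" "j = 0 \<or> l = 0" "j = 0 \<or> m = 0" "l < 2" "m < 2" "l = 0 \<or> m = 0"
    and irr': "e' < 2" "d' = 0 \<or> h' = 0" "c' = 0 \<or> i' = 0" "e' = 0 \<or> h' = 0" "e' = 0 \<or> i' = 0" "e' = 0 \<or> j' = 0"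
      "c' = 0 \<or> m' = 0" "h' = 0 \<or> i' = 0" "h' = 0 \<or> j' = 0" "i' = 0 \<or> j' = 0" "e' = 0 \<or> l' = 0" "e' = 0 \<or> m' = 0"
      "j' < 2" "i' = 0 \<or> l' = 0" "h' = 0 \<or> m' = 0" "j' = 0 \<or> l' = 0" "j' = 0 \<or> m' = 0" "l' < 2" "m' < 2" "l' = 0 \<or> m' = 0"
    and eq: "c + d + e + f + g + h + i + 2 * j + 2 * k + 2 * l + 2 * m = c' + d' + e' + f' + g' + h' + i' + 2 * j' + 2 * k' + 2 * l' + 2 * m'"
      "b + d + e + f + g + h + 2 * i + j + k + l + 2 * m = b' + d' + e' + f' + g' + h' + 2 * i' + j' + k' + l' + 2 * m'"
      "b + c + e + g + h + j + k + 2 * l + m = b' + c' + e' + g' + h' + j' + k' + 2 * l' + m'"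
      "g = g'" "f + h + i = f' + h' + i'" "j + 2 * k + l + m = j' + 2 * k' + l' + m'"
  shows "b = b' \<and> c = c' \<and> d = d' \<and> e = e' \<and> f = f' \<and> h = h' \<and> i = i' \<and> j = j' \<and> k = k' \<and> l = l' \<and> m = m'"
proof -
  from irreducible_exponents[OF irr refl refl refl refl, of b] have t: "j + l + m < 2" by blast
  from irreducible_exponents[OF irr' refl refl refl refl, of b'] have t': "j' + l' + m' < 2" by blast
  \<comment> \<open>The sum \<open>j + l + m\<close> is the last binary digit of
    \<open>j + 2 * k + l + m\<close>.\<close>
  have "x = x' \<and> y = y'" if "x < 2" "x' < 2" "x + 2 * y = x' + 2 * y'" for x x' y y' :: nat
    using that by presburger
  from this[OF t t', of k k'] eq(6) have tk: "j + l + m = j' + l' + m'" "k = k'" by linarith+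
  note tk1 = tk(1) and k = tk(2)
  have A: "c + d + e = c' + d' + e'" using eq(1) eq(5) tk1 unfolding k eq(4) by linarith
  have B: "b + d + e + i + m = b' + d' + e' + i' + m'" using eq(2) eq(5) tk1 unfolding k eq(4) by linarith
  have C: "b + c + e + h + l = b' + c' + e' + h' + l'" using eq(3) tk1 unfolding k eq(4) by linarith
  obtain t A B C where P: "j' + l' + m' = t" "c' + d' + e' = A" "b' + d' + e' + i' + m' = B" "b' + c' + e' + h' + l' = C"
    by blast
  note 1 = irreducible_exponents[OF irr tk1[THEN trans, OF P(1)] A[THEN trans, OF P(2)] B[THEN trans, OF P(3)] C[THEN trans, OF P(4)]]
    and 2 = irreducible_exponents[OF irr' P]
  have h: "h = h'" and i: "i = i'" and l: "l = l'" and m: "m = m'" using 1 2 by (elim conjE, simp only:)+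
  moreover have e: "e = e'" using 1 2 by (elim conjE, simp only:)
  moreover have "f = f'" "j = j'" using eq(5) tk(1) unfolding h i l m by simp_all
  moreover have "b = b'" "c = c'" "d = d'" using A B C unfolding e h i l m by linarith+
  ultimately show ?thesis using tk(2) by simp
qed

section \<open>Standard monomials and their exponents on the first slice\<close>

lemma listmon_divides_iff:
  "(\<exists>k. n = listmon gs + k) \<longleftrightarrow> (\<forall>g\<in>set gs. count_list gs g \<le> Poly_Mapping.lookup n g)"
proof
  assume "\<forall>g\<in>set gs. count_list gs g \<le> Poly_Mapping.lookup n g"
  then have "count_list gs g \<le> Poly_Mapping.lookup n g" for g
    by (cases "g \<in> set gs") simp_all
  then have "n = listmon gs + (n - listmon gs)"
    by (intro poly_mapping_eqI) (simp add: lookup_add lookup_minus lookup_listmon)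
  then show "\<exists>k. n = listmon gs + k" ..
qed (auto simp: lookup_add lookup_listmon)

lemma lookup_linear_gen:
  assumes "\<And>g. set (\<kappa> g) \<subseteq> {..<12}" "k < 12"
  shows "Poly_Mapping.lookup (linear_monomial (\<lambda>g. listmon (map idx_at (\<kappa> g))) n) (idx_at k)
    = (\<Sum>g\<in>UNIV. Poly_Mapping.lookup n (g :: gen) * count_list (\<kappa> g) k)"
proof -
  have "finite (UNIV :: gen set)" by (simp add: UNIV_gen)
  then show ?thesis
    using assms by (subst lookup_linear_monomial_superset[of UNIV]) (simp_all add: lookup_listmon_at)
qed

definition irreducible_monomials :: "gen monomial set" where
  "irreducible_monomials = {n. \<forall>h\<in>(\<lambda>(h, m, ts). listmon h) ` set relation_data. \<forall>k. n \<noteq> h + k}"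

lemma irreducible_iff:
  "n \<in> irreducible_monomials \<longleftrightarrow> list_all (\<lambda>(h, m, ts). \<not> (\<forall>g\<in>set h. count_list h g \<le> Poly_Mapping.lookup n g)) relation_data"
  unfolding irreducible_monomials_def listmon_divides_iff[symmetric] by (auto simp: list_all_iff)

lemma irreducible_lookups:
  fixes n :: "gen monomial"
  defines "e \<equiv> Poly_Mapping.lookup n GF3" and "c \<equiv> Poly_Mapping.lookup n GD13" and "d \<equiv> Poly_Mapping.lookup n GD23"
    and "h \<equiv> Poly_Mapping.lookup n GV" and "i \<equiv> Poly_Mapping.lookup n GVs" and "j \<equiv> Poly_Mapping.lookup n GF5"
    and "l \<equiv> Poly_Mapping.lookup n GPsi" and "m \<equiv> Poly_Mapping.lookup n GPsis"
  shows "n \<in> irreducible_monomials \<longleftrightarrow> e < 2 \<and> (d = 0 \<or> h = 0) \<and> (c = 0 \<or> i = 0) \<and> (e = 0 \<or> h = 0) \<and> (e = 0 \<or> i = 0) \<and>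
    (e = 0 \<or> j = 0) \<and> (c = 0 \<or> m = 0) \<and> (h = 0 \<or> i = 0) \<and> (h = 0 \<or> j = 0) \<and> (i = 0 \<or> j = 0) \<and> (e = 0 \<or> l = 0) \<and>
    (e = 0 \<or> m = 0) \<and> j < 2 \<and> (i = 0 \<or> l = 0) \<and> (h = 0 \<or> m = 0) \<and> (j = 0 \<or> l = 0) \<and> (j = 0 \<or> m = 0) \<and>
    l < 2 \<and> m < 2 \<and> (l = 0 \<or> m = 0)"
  unfolding irreducible_iff relation_data_def assms
  by (simp add: not_le Suc_le_eq numeral_2_eq_2)

lemma irreducibleD:
  assumes "n \<in> irreducible_monomials"
  shows "Poly_Mapping.lookup n GF3 < 2" "Poly_Mapping.lookup n GD23 = 0 \<or> Poly_Mapping.lookup n GV = 0"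
    "Poly_Mapping.lookup n GD13 = 0 \<or> Poly_Mapping.lookup n GVs = 0" "Poly_Mapping.lookup n GF3 = 0 \<or> Poly_Mapping.lookup n GV = 0"
    "Poly_Mapping.lookup n GF3 = 0 \<or> Poly_Mapping.lookup n GVs = 0" "Poly_Mapping.lookup n GF3 = 0 \<or> Poly_Mapping.lookup n GF5 = 0"
    "Poly_Mapping.lookup n GD13 = 0 \<or> Poly_Mapping.lookup n GPsis = 0" "Poly_Mapping.lookup n GV = 0 \<or> Poly_Mapping.lookup n GVs = 0"
    "Poly_Mapping.lookup n GV = 0 \<or> Poly_Mapping.lookup n GF5 = 0" "Poly_Mapping.lookup n GVs = 0 \<or> Poly_Mapping.lookup n GF5 = 0"
    "Poly_Mapping.lookup n GF3 = 0 \<or> Poly_Mapping.lookup n GPsi = 0" "Poly_Mapping.lookup n GF3 = 0 \<or> Poly_Mapping.lookup n GPsis = 0"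
    "Poly_Mapping.lookup n GF5 < 2" "Poly_Mapping.lookup n GVs = 0 \<or> Poly_Mapping.lookup n GPsi = 0"
    "Poly_Mapping.lookup n GV = 0 \<or> Poly_Mapping.lookup n GPsis = 0" "Poly_Mapping.lookup n GF5 = 0 \<or> Poly_Mapping.lookup n GPsi = 0"
    "Poly_Mapping.lookup n GF5 = 0 \<or> Poly_Mapping.lookup n GPsis = 0" "Poly_Mapping.lookup n GPsi < 2"
    "Poly_Mapping.lookup n GPsis < 2" "Poly_Mapping.lookup n GPsi = 0 \<or> Poly_Mapping.lookup n GPsis = 0"
  using assms by (simp_all only: irreducible_lookups)

lemma irreducible_divisor: "n + k \<in> irreducible_monomials \<Longrightarrow> n \<in> irreducible_monomials"
  unfolding irreducible_monomials_def by (auto simp: add.assoc)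

lemma sum_gen:
  "(\<Sum>g\<in>UNIV. f g) = f GX + f GD12 + f GD13 + f GD23 + f GF3 + f GU + f GF4 + f GV + f GVs + f GF5 + f GPhi + f GPsi + f GPsis"
  for f :: "gen \<Rightarrow> nat"
  by (simp add: UNIV_gen)

lemma gen_monomial_eqI:
  assumes "Poly_Mapping.lookup n GX = Poly_Mapping.lookup k GX" "Poly_Mapping.lookup n GD12 = Poly_Mapping.lookup k GD12"
    "Poly_Mapping.lookup n GD13 = Poly_Mapping.lookup k GD13" "Poly_Mapping.lookup n GD23 = Poly_Mapping.lookup k GD23"
    "Poly_Mapping.lookup n GF3 = Poly_Mapping.lookup k GF3" "Poly_Mapping.lookup n GU = Poly_Mapping.lookup k GU"
    "Poly_Mapping.lookup n GF4 = Poly_Mapping.lookup k GF4" "Poly_Mapping.lookup n GV = Poly_Mapping.lookup k GV"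
    "Poly_Mapping.lookup n GVs = Poly_Mapping.lookup k GVs" "Poly_Mapping.lookup n GF5 = Poly_Mapping.lookup k GF5"
    "Poly_Mapping.lookup n GPhi = Poly_Mapping.lookup k GPhi" "Poly_Mapping.lookup n GPsi = Poly_Mapping.lookup k GPsi"
    "Poly_Mapping.lookup n GPsis = Poly_Mapping.lookup k GPsis"
  shows "n = (k :: gen monomial)"
proof (rule poly_mapping_eqI)
  fix g show "Poly_Mapping.lookup n g = Poly_Mapping.lookup k g" by (cases g) (simp_all only: assms)
qed

text \<open>Exponents of the leading monomials of the generators modulo \<open>x\<^sub>1\<^sub>1\<^sub>1\<close>, on the subspace where only
  \<open>x\<^sub>1\<^sub>1\<^sub>2\<close>, \<open>x\<^sub>1\<^sub>2\<^sub>1\<close>, \<open>x\<^sub>2\<^sub>1\<^sub>1\<close>, \<open>x\<^sub>2\<^sub>1\<^sub>3\<close>, \<open>x\<^sub>2\<^sub>2\<^sub>2\<close>, \<open>x\<^sub>2\<^sub>2\<^sub>3\<close> survive. All of them restrict to monomials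
  there, except \<open>\<phi>\<close>.\<close>

fun x_slice_list :: "gen \<Rightarrow> nat list" where
  "x_slice_list GX = []"
| "x_slice_list GD12 = [3, 6]"
| "x_slice_list GD13 = [1, 6]"
| "x_slice_list GD23 = [1, 3]"
| "x_slice_list GF3 = [1, 3, 6]"
| "x_slice_list GU = [1, 3, 8]"
| "x_slice_list GF4 = [1, 3, 6, 10]"
| "x_slice_list GV = [1, 3, 6, 8]"
| "x_slice_list GVs = [1, 3, 3, 8]"
| "x_slice_list GF5 = [1, 1, 3, 6, 11]"
| "x_slice_list GPhi = [1, 1, 3, 6, 11, 11]"
| "x_slice_list GPsi = [1, 1, 3, 6, 6, 11]"
| "x_slice_list GPsis = [1, 1, 3, 3, 6, 11]"

text \<open>The exponents of \<open>x112\<close>, \<open>x121\<close>, \<open>x211\<close>,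
  \<open>x222\<close>, \<open>x213\<close>, \<open>x223\<close> supply the equations of
  \<open>exponents_unique\<close>; that of \<open>x222\<close> is the exponent of
  \<open>f4\<close>.\<close>

lemma x_slice_inj:
  "inj_on (linear_monomial (\<lambda>g. listmon (map idx_at (x_slice_list g)))) {n \<in> irreducible_monomials. Poly_Mapping.lookup n GX = 0}"
proof (rule inj_onI)
  fix n n' :: "gen monomial"
  assume n: "n \<in> {n \<in> irreducible_monomials. Poly_Mapping.lookup n GX = 0}"
    and n': "n' \<in> {n \<in> irreducible_monomials. Poly_Mapping.lookup n GX = 0}"
    and eq: "linear_monomial (\<lambda>g. listmon (map idx_at (x_slice_list g))) n = linear_monomial (\<lambda>g. listmon (map idx_at (x_slice_list g))) n'"
  have less: "set (x_slice_list g) \<subseteq> {..<12}" for g by (cases g) simp_all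
  have sums: "(\<Sum>g\<in>UNIV. Poly_Mapping.lookup n g * count_list (x_slice_list g) k) = (\<Sum>g\<in>UNIV. Poly_Mapping.lookup n' g * count_list (x_slice_list g) k)"
    if "k < 12" for k
    using lookup_linear_gen[of x_slice_list k n] lookup_linear_gen[of x_slice_list k n'] less that eq by simp
  let ?e = "\<lambda>g. Poly_Mapping.lookup n g" and ?e' = "\<lambda>g. Poly_Mapping.lookup n' g"
  have "?e GD12 = ?e' GD12 \<and> ?e GD13 = ?e' GD13 \<and> ?e GD23 = ?e' GD23 \<and> ?e GF3 = ?e' GF3 \<and> ?e GU = ?e' GU \<and>
    ?e GV = ?e' GV \<and> ?e GVs = ?e' GVs \<and> ?e GF5 = ?e' GF5 \<and> ?e GPhi = ?e' GPhi \<and> ?e GPsi = ?e' GPsi \<and> ?e GPsis = ?e' GPsis"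
  proof (rule exponents_unique[where g = "?e GF4" and g' = "?e' GF4"])
    show S: "?e GF4 = ?e' GF4" using sums[of 10] by (simp add: sum_gen)
    show "?e GD13 + ?e GD23 + ?e GF3 + ?e GU + ?e GF4 + ?e GV + ?e GVs + 2 * ?e GF5 + 2 * ?e GPhi + 2 * ?e GPsi + 2 * ?e GPsis
      = ?e' GD13 + ?e' GD23 + ?e' GF3 + ?e' GU + ?e' GF4 + ?e' GV + ?e' GVs + 2 * ?e' GF5 + 2 * ?e' GPhi + 2 * ?e' GPsi + 2 * ?e' GPsis"
      using sums[of 1] by (simp add: sum_gen algebra_simps)
    show "?e GD12 + ?e GD23 + ?e GF3 + ?e GU + ?e GF4 + ?e GV + 2 * ?e GVs + ?e GF5 + ?e GPhi + ?e GPsi + 2 * ?e GPsis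
      = ?e' GD12 + ?e' GD23 + ?e' GF3 + ?e' GU + ?e' GF4 + ?e' GV + 2 * ?e' GVs + ?e' GF5 + ?e' GPhi + ?e' GPsi + 2 * ?e' GPsis"
      using sums[of 3] by (simp add: sum_gen algebra_simps)
    show "?e GD12 + ?e GD13 + ?e GF3 + ?e GF4 + ?e GV + ?e GF5 + ?e GPhi + 2 * ?e GPsi + ?e GPsis
      = ?e' GD12 + ?e' GD13 + ?e' GF3 + ?e' GF4 + ?e' GV + ?e' GF5 + ?e' GPhi + 2 * ?e' GPsi + ?e' GPsis"
      using sums[of 6] by (simp add: sum_gen algebra_simps)
    show "?e GU + ?e GV + ?e GVs = ?e' GU + ?e' GV + ?e' GVs"
      using sums[of 8] by (simp add: sum_gen algebra_simps)
    show "?e GF5 + 2 * ?e GPhi + ?e GPsi + ?e GPsis = ?e' GF5 + 2 * ?e' GPhi + ?e' GPsi + ?e' GPsis"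
      using sums[of 11] by (simp add: sum_gen algebra_simps)
  qed (rule irreducibleD, use n n' in simp)+
  moreover have "?e GF4 = ?e' GF4" using sums[of 10] by (simp add: sum_gen)
  moreover have "?e GX = ?e' GX" using n n' by simp
  ultimately show "n = n'" by (intro gen_monomial_eqI) blast+
qed

text \<open>The quotients must be formed before \<open>x111\<close> can be set to 0. So
  \<open>a 0\<close> is kept, the defining equations are solved, and the multiple of
  \<open>a 0\<close> is displayed apart from the rest.\<close>

lemma x_slice_values:
  fixes a :: "nat \<Rightarrow> 'a::idom"
  assumes "all_syzygies (a 0) (D12 a) (D13 a) (D23 a) (F3 a) (U a) (F4 a) (V a) (Vs a) f5 \<psi> \<psi>s H \<phi>"
    and z: "a 2 = 0" "a 4 = 0" "a 5 = 0" "a 7 = 0" "a 9 = 0"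
  shows "f5 = a 0 * (H * a 1 * a 3 * a 8 * a 10) + a 1 * a 1 * a 3 * a 6 * a 11"
    "\<phi> = a 0 * (a 1 * a 3 * a 8 * a 10 * a 11) + (a 1 * a 1 * a 3 * a 6 * a 11 * a 11 - a 1 * a 3 * a 3 * a 8 * a 8 * a 10)"
    "\<psi> = a 0 * (a 10 * V a - 2 * a 1 * a 3 * a 6 * a 8 * a 10) - 2 * (a 1 * a 1 * a 3 * a 6 * a 6 * a 11)"
    "\<psi>s = a 0 * (a 10 * Vs a) - 2 * (a 1 * a 1 * a 3 * a 3 * a 6 * a 11)"
proof -
  interpret all_syzygies "a 0" "D12 a" "D13 a" "D23 a" "F3 a" "U a" "F4 a" "V a" "Vs a" f5 \<psi> \<psi>s H \<phi>
    by (rule assms(1))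
  have v: "D12 a = - (a 3 * a 6)" "D13 a = - (a 1 * a 6)" "D23 a = - (a 1 * a 3)"
    "F3 a = a 0 * a 0 * a 10 + 2 * a 1 * a 3 * a 6" "U a = - (a 1 * a 3 * a 8)"
    "V a = - (a 0 * a 0 * a 8 * a 10) - a 0 * a 1 * a 6 * a 11 - a 1 * a 3 * a 6 * a 8"
    "Vs a = a 1 * a 3 * a 3 * a 8 - a 0 * a 1 * a 3 * a 11"
    by (simp_all add: formulas z algebra_simps power2_eq_square)
  show "f5 = a 0 * (H * a 1 * a 3 * a 8 * a 10) + a 1 * a 1 * a 3 * a 6 * a 11"
    by (rule cancel) (use ef5[unfolded v] H in algebra)
  show "\<psi> = a 0 * (a 10 * V a - 2 * a 1 * a 3 * a 6 * a 8 * a 10) - 2 * (a 1 * a 1 * a 3 * a 6 * a 6 * a 11)"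
    unfolding v by (rule cancel) (use e\<psi>[unfolded v] in algebra)
  show "\<psi>s = a 0 * (a 10 * Vs a) - 2 * (a 1 * a 1 * a 3 * a 3 * a 6 * a 11)"
    unfolding v by (rule cancel) (use e\<psi>s[unfolded v] in algebra)
  show "\<phi> = a 0 * (a 1 * a 3 * a 8 * a 10 * a 11) + (a 1 * a 1 * a 3 * a 6 * a 11 * a 11 - a 1 * a 3 * a 3 * a 8 * a 8 * a 10)"
    by (rule cancel, rule cancel) (use e\<phi>[unfolded v] in algebra)
qed

section \<open>Restriction to the two slices\<close>

definition keep :: "nat set \<Rightarrow> idx \<Rightarrow> poly223" where
  "keep S v = (if number v \<in> S then var v else 0)"

lemma keep_at: "m < 12 \<Longrightarrow> keep S (idx_at m) = (if m \<in> S then X m else 0)"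
  by (simp add: keep_def number_at)

lemma keep_keep: "subst (keep S) (keep T v) = keep (S \<inter> T) v"
  by (simp add: keep_def)

lemma lead_scaled_list:
  "c \<noteq> 0 \<Longrightarrow> lead (const_poly c * prod_list (map X ms)) (listmon (map idx_at ms)) c"
  using lead_mult[OF lead_const[of c] lead_X_list[of ms]] by simp

lemma const_poly_neg_simps:
  "const_poly (- 1) = - 1" "const_poly (- 2) = - 2" "const_poly 2 = 2" "const_poly 4 = 4"
  by (simp_all add: const_poly_simps const_poly_numeral)

fun x_slice_coeff :: "gen \<Rightarrow> complex" where
  "x_slice_coeff GX = 1"
| "x_slice_coeff GD12 = - 1"
| "x_slice_coeff GD13 = - 1"
| "x_slice_coeff GD23 = - 1"
| "x_slice_coeff GF3 = 2"
| "x_slice_coeff GU = - 1"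
| "x_slice_coeff GF4 = 4"
| "x_slice_coeff GV = - 1"
| "x_slice_coeff GVs = 1"
| "x_slice_coeff GF5 = 1"
| "x_slice_coeff GPhi = 1"
| "x_slice_coeff GPsi = - 2"
| "x_slice_coeff GPsis = - 2"

text \<open>Exponents of the restrictions to the subspace of \<open>d\<^sub>2\<^sub>3 = 0\<close> where only \<open>x\<^sub>1\<^sub>1\<^sub>1\<close>, \<open>x\<^sub>1\<^sub>2\<^sub>3\<close>, \<open>x\<^sub>2\<^sub>1\<^sub>2\<close>,
  \<open>x\<^sub>2\<^sub>2\<^sub>1\<close>, \<open>x\<^sub>2\<^sub>2\<^sub>2\<close>, \<open>x\<^sub>2\<^sub>2\<^sub>3\<close> survive.\<close>

fun d23_slice_list :: "gen \<Rightarrow> nat list" where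
  "d23_slice_list GX = [0]"
| "d23_slice_list GD12 = [0, 9]"
| "d23_slice_list GD13 = [0, 7]"
| "d23_slice_list GF3 = [0, 0, 10]"
| "d23_slice_list GU = [0, 5, 7]"
| "d23_slice_list GV = [0, 0, 7, 11]"
| "d23_slice_list GVs = [0, 0, 5, 10]"
| "d23_slice_list _ = []"

text \<open>Multiples of \<open>GF3 * GU\<close> are left out because
  \<open>f3 * u = d13 * v* - d23 * v\<close>.\<close>

definition elementary_monomials :: "gen monomial set" where
  "elementary_monomials = {n. Poly_Mapping.keys n \<subseteq> elementary_gens \<and> (\<forall>k. n \<noteq> listmon [GF3, GU] + k)}"

lemma elementary_monomials_iff:
  "n \<in> elementary_monomials \<longleftrightarrow> Poly_Mapping.keys n \<subseteq> elementary_gens \<and>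
    (Poly_Mapping.lookup n GF3 = 0 \<or> Poly_Mapping.lookup n GU = 0)"
  unfolding elementary_monomials_def using listmon_divides_iff[of n "[GF3, GU]"]
  by (auto simp: Suc_le_eq)

text \<open>The slice gives the sums of the exponent of \<open>v*\<close> with those of
  \<open>f3\<close> and of \<open>u\<close>. One of the latter two is 0, so the exponent of
  \<open>v*\<close> is the smaller sum, and the remaining exponents follow.\<close>

lemma d23_slice_inj:
  "inj_on (linear_monomial (\<lambda>g. listmon (map idx_at (d23_slice_list g)))) {n \<in> elementary_monomials. Poly_Mapping.lookup n GD23 = 0}"
proof (rule inj_onI)
  fix n n' :: "gen monomial"
  assume n: "n \<in> {n \<in> elementary_monomials. Poly_Mapping.lookup n GD23 = 0}"
    and n': "n' \<in> {n \<in> elementary_monomials. Poly_Mapping.lookup n GD23 = 0}"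
    and eq: "linear_monomial (\<lambda>g. listmon (map idx_at (d23_slice_list g))) n = linear_monomial (\<lambda>g. listmon (map idx_at (d23_slice_list g))) n'"
  have less: "set (d23_slice_list g) \<subseteq> {..<12}" for g by (cases g) simp_all
  have sums: "(\<Sum>g\<in>UNIV. Poly_Mapping.lookup n g * count_list (d23_slice_list g) k) = (\<Sum>g\<in>UNIV. Poly_Mapping.lookup n' g * count_list (d23_slice_list g) k)"
    if "k < 12" for k
    using lookup_linear_gen[of d23_slice_list k n] lookup_linear_gen[of d23_slice_list k n'] less that eq by simp
  let ?e = "\<lambda>g. Poly_Mapping.lookup n g" and ?e' = "\<lambda>g. Poly_Mapping.lookup n' g"
  have outside: "?e g = 0" "?e' g = 0" if "g \<notin> elementary_gens" for g
    using n n' that by (auto simp: elementary_monomials_iff in_keys_iff)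
  have d12: "?e GD12 = ?e' GD12" and v: "?e GV = ?e' GV"
    using sums[of 9] sums[of 11] by (simp_all add: sum_gen)
  have f3: "?e GF3 + ?e GVs = ?e' GF3 + ?e' GVs" and u: "?e GU + ?e GVs = ?e' GU + ?e' GVs"
    and d13: "?e GD13 + ?e GU = ?e' GD13 + ?e' GU"
    using sums[of 10] sums[of 5] sums[of 7] v by (simp_all add: sum_gen)
  have x: "?e GX + ?e GD12 + ?e GD13 + 2 * ?e GF3 + ?e GU + 2 * ?e GV + 2 * ?e GVs
    = ?e' GX + ?e' GD12 + ?e' GD13 + 2 * ?e' GF3 + ?e' GU + 2 * ?e' GV + 2 * ?e' GVs"
    using sums[of 0] by (simp add: sum_gen algebra_simps)
  have "?e GF3 = 0 \<or> ?e GU = 0" "?e' GF3 = 0 \<or> ?e' GU = 0"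
    using n n' by (simp_all add: elementary_monomials_iff)
  then have "?e GF3 = ?e' GF3 \<and> ?e GU = ?e' GU \<and> ?e GVs = ?e' GVs" using f3 u by auto
  moreover from this have "?e GD13 = ?e' GD13" "?e GX = ?e' GX" using d13 x d12 v by simp_all
  ultimately show "n = n'"
    using d12 v n n' outside by (intro gen_monomial_eqI) (simp_all add: elementary_gens_def)
qed

context generators_223
begin

text \<open>The restriction is made in two steps: \<open>?t\<close> keeps \<open>x111\<close>, so
  the defining equations stay solvable for the quotients, and \<open>?s\<close> then sets it to
  0.\<close>

lemma x_slice_lead:
  assumes "g \<noteq> GX"
  shows "lead (subst (keep {1, 3, 6, 8, 10, 11}) (\<gamma> g)) (listmon (map idx_at (x_slice_list g))) (x_slice_coeff g)"
proof -
  let ?T = "{0, 1, 3, 6, 8, 10, 11}" and ?S = "{1, 3, 6, 8, 10, 11}"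
  let ?t = "keep ?T" and ?s = "keep ?S"
  let ?a = "\<lambda>m. ?t (idx_at m)"
  have a: "?a 0 = X 0" "?a 1 = X 1" "?a 3 = X 3" "?a 6 = X 6" "?a 8 = X 8" "?a 10 = X 10" "?a 11 = X 11"
    and z: "?a 2 = 0" "?a 4 = 0" "?a 5 = 0" "?a 7 = 0" "?a 9 = 0"
    by (simp_all add: keep_at del: One_nat_def)
  have s0: "?s (idx_at 0) = 0"
    and s: "?s (idx_at 1) = X 1" "?s (idx_at 3) = X 3" "?s (idx_at 6) = X 6" "?s (idx_at 8) = X 8"
    "?s (idx_at 10) = X 10" "?s (idx_at 11) = X 11"
    and sz: "?s (idx_at 2) = 0" "?s (idx_at 4) = 0" "?s (idx_at 5) = 0" "?s (idx_at 7) = 0" "?s (idx_at 9) = 0"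
    by (simp_all add: keep_at del: One_nat_def)
  note E = e0[THEN arg_cong, of "subst ?t", unfolded subst_hom subst_generators subst_const subst_numeral]
    ef4[THEN arg_cong, of "subst ?t", unfolded subst_hom subst_generators subst_const subst_numeral]
    ef5[THEN arg_cong, of "subst ?t", unfolded subst_hom subst_generators subst_const subst_numeral]
    e\<psi>[THEN arg_cong, of "subst ?t", unfolded subst_hom subst_generators subst_const subst_numeral]
    e\<psi>s[THEN arg_cong, of "subst ?t", unfolded subst_hom subst_generators subst_const subst_numeral]
    e\<phi>[THEN arg_cong, of "subst ?t", unfolded subst_hom subst_generators subst_const subst_numeral]
  have syz: "all_syzygies (?a 0) (D12 ?a) (D13 ?a) (D23 ?a) (F3 ?a) (U ?a) (F4 ?a) (V ?a) (Vs ?a)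
    (subst ?t f5) (subst ?t \<psi>) (subst ?t \<psi>s) (const_poly (1/2)) (subst ?t \<phi>)"
  proof unfold_locales
    show "?a 0 \<noteq> 0" by (simp only: a X_nonzero not_False_eq_True)
    show "2 * const_poly (1/2) = (1 :: poly223)" by (rule H)
  qed (rule E)+
  note val = x_slice_values[OF syz z]
  have ss: "subst ?s (subst ?t p) = subst ?s p" for p
    unfolding subst_subst keep_keep by simp
  have sa: "subst ?s (V ?a) = V (\<lambda>m. ?s (idx_at m))" "subst ?s (Vs ?a) = Vs (\<lambda>m. ?s (idx_at m))"
    by (simp_all add: formulas subst_hom keep_keep)
  have im: "subst ?s f5 = X 1 * X 1 * X 3 * X 6 * X 11"
    "subst ?s \<phi> = X 1 * X 1 * X 3 * X 6 * X 11 * X 11 - X 1 * X 3 * X 3 * X 8 * X 8 * X 10"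
    "subst ?s \<psi> = - 2 * (X 1 * X 1 * X 3 * X 6 * X 6 * X 11)"
    "subst ?s \<psi>s = - 2 * (X 1 * X 1 * X 3 * X 3 * X 6 * X 11)"
    unfolding ss[of f5, symmetric] ss[of \<phi>, symmetric] ss[of \<psi>, symmetric] ss[of \<psi>s, symmetric] val
    by (simp_all add: a subst_hom s s0 del: One_nat_def)
  \<comment> \<open>Only \<open>\<phi>\<close> restricts to two terms; the one with the square of
    \<open>x112\<close> leads.\<close>
  have "lead (X 1 * X 1 * X 3 * X 6 * X 11 * X 11 - X 1 * X 3 * X 3 * X 8 * X 8 * X 10)
    (listmon (map idx_at [1, 1, 3, 6, 11, 11])) 1"
  proof -
    have "lead (prod_list (map X [1, 1, 3, 6, 11, 11]) - prod_list (map X [1, 3, 3, 8, 8, 10]))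
      (listmon (map idx_at [1, 1, 3, 6, 11, 11])) 1"
      by (intro lead_diff_below lead_X_list below_X_list) (simp_all add: counts_def)
    then show ?thesis by (simp add: mult.assoc)
  qed
  then have \<phi>: "lead (subst ?s \<phi>) (listmon (map idx_at (x_slice_list GPhi))) (x_slice_coeff GPhi)"
    unfolding im by simp
  have base: "subst ?s (\<gamma> g) = const_poly (x_slice_coeff g) * prod_list (map X (x_slice_list g))" if "g \<noteq> GPhi"
    using that assms
    by (cases g) (simp_all only: \<gamma>_simps im subst_generators, simp_all only: formulas s s0 sz x_slice_coeff.simps x_slice_list.simps
        list.map prod_list.Cons prod_list.Nil const_poly_neg_simps const_poly_simps(2), simp_all add: algebra_simps power2_eq_square)
  have "x_slice_coeff g \<noteq> 0" by (cases g) simp_all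
  then show ?thesis using \<phi> base lead_scaled_list by (cases "g = GPhi") (simp_all only: \<gamma>_simps not_False_eq_True simp_thms)
qed

lemma x_slice_kills: "subst (keep {1, 3, 6, 8, 10, 11}) (\<gamma> GX) = 0"
  unfolding \<gamma>_simps by (simp add: keep_at)

text \<open>This instance divides out \<open>x111\<close> from combinations of irreducible monomials
  and shows that these are independent.\<close>

sublocale x: saturated \<gamma> "keep {1, 3, 6, 8, 10, 11}" GX irreducible_monomials
  "linear_monomial (\<lambda>g. listmon (map idx_at (x_slice_list g)))"
  "\<lambda>n. \<Prod>g\<in>Poly_Mapping.keys n. x_slice_coeff g ^ Poly_Mapping.lookup n g"
proof
  fix n :: "gen monomial" assume "Poly_Mapping.lookup n GX = 0"
  then have "g \<noteq> GX" if "g \<in> Poly_Mapping.keys n" for g using that by (auto simp: in_keys_iff)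
  then show "lead (mono_value (\<lambda>h. subst (keep {1, 3, 6, 8, 10, 11}) (\<gamma> h)) n)
    (linear_monomial (\<lambda>g. listmon (map idx_at (x_slice_list g))) n)
    (\<Prod>g\<in>Poly_Mapping.keys n. x_slice_coeff g ^ Poly_Mapping.lookup n g)"
    by (intro lead_mono_value x_slice_lead)
qed (use x_slice_kills x_slice_inj irreducible_divisor in \<open>simp_all only: \<gamma>_simps X_nonzero not_False_eq_True\<close>)

lemma d23_slice_lead:
  assumes "g \<in> elementary_gens" "g \<noteq> GD23"
  shows "lead (subst (keep {0, 5, 7, 9, 10, 11}) (\<gamma> g)) (listmon (map idx_at (d23_slice_list g)))
    (if g = GU \<or> g = GVs then - 1 else 1)"
proof -
  let ?s = "keep {0, 5, 7, 9, 10, 11}"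
  have s: "?s (idx_at 0) = X 0" "?s (idx_at 5) = X 5" "?s (idx_at 7) = X 7" "?s (idx_at 9) = X 9"
    "?s (idx_at 10) = X 10" "?s (idx_at 11) = X 11"
    and z: "?s (idx_at 1) = 0" "?s (idx_at 2) = 0" "?s (idx_at 3) = 0" "?s (idx_at 4) = 0" "?s (idx_at 6) = 0" "?s (idx_at 8) = 0"
    by (simp_all add: keep_at del: One_nat_def)
  have "subst ?s (\<gamma> g) = const_poly (if g = GU \<or> g = GVs then - 1 else 1) * prod_list (map X (d23_slice_list g))"
    using assms unfolding elementary_gens_def
    by (cases g) (simp_all only: \<gamma>_simps subst_generators, simp_all only: formulas s z d23_slice_list.simps
        list.map prod_list.Cons prod_list.Nil, simp_all add: const_poly_neg_simps const_poly_simps algebra_simps power2_eq_square)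
  moreover have "(if g = GU \<or> g = GVs then - 1 else 1 :: complex) \<noteq> 0" by simp
  ultimately show ?thesis by (simp only: lead_scaled_list not_False_eq_True)
qed

lemma d23_slice_kills: "subst (keep {0, 5, 7, 9, 10, 11}) (\<gamma> GD23) = 0"
  unfolding \<gamma>_simps subst_generators by (simp add: D23_def keep_at)

text \<open>This instance divides out \<open>d23\<close> within the algebra of the eight elementary
  invariants.\<close>

sublocale d23: saturated \<gamma> "keep {0, 5, 7, 9, 10, 11}" GD23 elementary_monomials
  "linear_monomial (\<lambda>g. listmon (map idx_at (d23_slice_list g)))"
  "\<lambda>n. \<Prod>g\<in>Poly_Mapping.keys n. (if g = GU \<or> g = GVs then - 1 else 1) ^ Poly_Mapping.lookup n g"
proof
  fix n assume "n \<in> elementary_monomials" "Poly_Mapping.lookup n GD23 = 0"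
  then have "g \<in> elementary_gens \<and> g \<noteq> GD23" if "g \<in> Poly_Mapping.keys n" for g
    using that by (auto simp: elementary_monomials_iff in_keys_iff)
  then show "lead (mono_value (\<lambda>h. subst (keep {0, 5, 7, 9, 10, 11}) (\<gamma> h)) n)
    (linear_monomial (\<lambda>g. listmon (map idx_at (d23_slice_list g))) n)
    (\<Prod>g\<in>Poly_Mapping.keys n. (if g = GU \<or> g = GVs then - 1 else 1) ^ Poly_Mapping.lookup n g)"
    by (intro lead_mono_value d23_slice_lead) auto
next
  fix n :: "gen monomial" assume "n + Poly_Mapping.single GD23 1 \<in> elementary_monomials"
  then show "n \<in> elementary_monomials"
    by (auto simp: elementary_monomials_iff lookup_add in_keys_iff subset_iff)
qed (use d23_slice_kills d23_slice_inj D_nonzero in \<open>simp_all only: \<gamma>_simps not_False_eq_True\<close>)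

end

section \<open>The relation ideal and the basis\<close>

lemma module_mult: "module ((*) :: 'a::comm_ring_1 \<Rightarrow> 'a \<Rightarrow> 'a)"
  by unfold_locales (simp_all add: algebra_simps)

lemma module_cscale: "module (cscale :: complex \<Rightarrow> 'v cpoly \<Rightarrow> 'v cpoly)"
  by unfold_locales (simp_all add: cscale_def const_poly_simps algebra_simps)

lemma ideal_generated_simps:
  "0 \<in> ideal_generated S" "p \<in> S \<Longrightarrow> p \<in> ideal_generated S"
  "p \<in> ideal_generated S \<Longrightarrow> q \<in> ideal_generated S \<Longrightarrow> p + q \<in> ideal_generated S"
  "p \<in> ideal_generated S \<Longrightarrow> r * p \<in> ideal_generated S"
  unfolding ideal_generated_def
  by (auto intro: module.span_zero[OF module_mult] module.span_base[OF module_mult]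
      module.span_add[OF module_mult] module.span_scale[OF module_mult])

text \<open>A grading for which the left-hand side of every relation exceeds all terms of the right-hand side,
  so that rewriting terminates.\<close>

fun reduction_weight :: "gen \<Rightarrow> nat" where
  "reduction_weight GD13 = 2"
| "reduction_weight GD23 = 1"
| "reduction_weight GF3 = 4"
| "reduction_weight GV = 4"
| "reduction_weight GVs = 4"
| "reduction_weight GF5 = 4"
| "reduction_weight GPsi = 5"
| "reduction_weight GPsis = 6"
| "reduction_weight _ = 0"

lemma reduction_weights:
  "list_all (\<lambda>(h, m, ts). sum_list (map reduction_weight m) < sum_list (map reduction_weight h) \<and>
    list_all (\<lambda>(c, gs). sum_list (map reduction_weight gs) < sum_list (map reduction_weight h)) ts) relation_data"
  by (simp add: relation_data_def)

definition relation_ideal :: "gen cpoly set" where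
  "relation_ideal = ideal_generated
    ((\<lambda>(h, m, ts). prod_list (map var h) - prod_list (map var m) - tail ts) ` set relation_data)"

lemma keys_monomial_poly: "Poly_Mapping.keys (monomial_poly n) = {n}"
  by (simp add: monomial_poly_def)

lemma reduce_mod_relations:
  "\<exists>q'. q - q' \<in> relation_ideal \<and> Poly_Mapping.keys q' \<subseteq> irreducible_monomials"
proof -
  let ?H = "(\<lambda>(h, m, ts). listmon h) ` set relation_data"
  have "\<exists>q'. q - q' \<in> relation_ideal \<and>
    (\<forall>n\<in>Poly_Mapping.keys q'. Poly_Mapping.keys n \<subseteq> UNIV \<and> (\<forall>h\<in>?H. \<forall>k. n \<noteq> h + k))"
  proof (rule reduction[where W = reduction_weight])
    fix w assume "w \<in> ?H"
    then obtain h m ts where r: "(h, m, ts) \<in> set relation_data" "w = listmon h" by auto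
    let ?r = "prod_list (map var m) + tail ts"
    have "monomial_poly w - ?r \<in> relation_ideal"
      unfolding relation_ideal_def r(2) monomial_poly_listmon
      using r(1) by (intro ideal_generated_simps(2)) (force simp: algebra_simps)
    moreover have "weight reduction_weight n < weight reduction_weight w" if "n \<in> Poly_Mapping.keys ?r" for n
    proof -
      have "n = listmon m \<or> n \<in> (\<lambda>(c, gs). listmon gs) ` set ts"
        using that keys_add[of "prod_list (map var m)" "tail ts"] keys_tail[of ts]
        by (auto simp: monomial_poly_listmon[symmetric] keys_monomial_poly)
      moreover have "sum_list (map reduction_weight m) < sum_list (map reduction_weight h)"
        "\<And>c gs. (c, gs) \<in> set ts \<Longrightarrow> sum_list (map reduction_weight gs) < sum_list (map reduction_weight h)"
        using reduction_weights r(1) by (auto simp: list_all_iff)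
      ultimately show ?thesis by (auto simp: r(2) weight_listmon)
    qed
    ultimately show "\<exists>r. monomial_poly w - r \<in> relation_ideal \<and>
      (\<forall>n\<in>Poly_Mapping.keys r. weight reduction_weight n < weight reduction_weight w \<and> Poly_Mapping.keys n \<subseteq> UNIV)"
      by blast
  qed (auto simp: relation_ideal_def intro: ideal_generated_simps)
  then show ?thesis by (auto simp: irreducible_monomials_def)
qed

section \<open>The kernel and the removal of denominators\<close>

context generators_223
begin

lemma relation_ideal_kernel: "q \<in> relation_ideal \<Longrightarrow> subst \<gamma> q = 0"
proof -
  have sub: "module.subspace (*) {q. subst \<gamma> q = 0}"
    by (simp add: module.subspace_def[OF module_mult] subst_hom)
  have "(\<lambda>(h, m, ts). prod_list (map var h) - prod_list (map var m) - tail ts) ` set relation_data \<subseteq> {q. subst \<gamma> q = 0}"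
    using relation_identities by (auto simp: subst_diff)
  then have "relation_ideal \<subseteq> {q. subst \<gamma> q = 0}"
    unfolding relation_ideal_def ideal_generated_def by (rule module.span_minimal[OF module_mult _ sub])
  then show "q \<in> relation_ideal \<Longrightarrow> subst \<gamma> q = 0" by blast
qed

text \<open>Reduction replaces a relation by a combination of irreducible monomials with value 0,
  and independence makes this combination zero.\<close>

lemma kernel_eq: "{q. subst \<gamma> q = 0} = relation_ideal"
proof
  show "relation_ideal \<subseteq> {q. subst \<gamma> q = 0}" using relation_ideal_kernel by blast
  show "{q. subst \<gamma> q = 0} \<subseteq> relation_ideal"
  proof
    fix q assume "q \<in> {q. subst \<gamma> q = 0}"
    moreover obtain q' where q': "q - q' \<in> relation_ideal" "Poly_Mapping.keys q' \<subseteq> irreducible_monomials"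
      using reduce_mod_relations by blast
    ultimately have "subst \<gamma> q' = 0" using relation_ideal_kernel[OF q'(1)] by (simp add: subst_diff)
    then have "q' = 0" using q'(2) x.independent by blast
    then show "q \<in> relation_ideal" using q'(1) by simp
  qed
qed

lemma irreducible_image: "\<exists>q'. Poly_Mapping.keys q' \<subseteq> irreducible_monomials \<and> subst \<gamma> q = subst \<gamma> q'"
proof -
  obtain q' where q': "q - q' \<in> relation_ideal" "Poly_Mapping.keys q' \<subseteq> irreducible_monomials"
    using reduce_mod_relations by blast
  then show ?thesis using relation_ideal_kernel[OF q'(1)] by (auto simp: subst_diff)
qed

text \<open>Rewriting \<open>f3 * u\<close> by \<open>e0\<close> lowers the degree in
  \<open>f3\<close>.\<close>

lemma elementary_image:
  assumes "supported elementary_gens q"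
  shows "\<exists>q'. Poly_Mapping.keys q' \<subseteq> elementary_monomials \<and> subst \<gamma> q = subst \<gamma> q'"
proof -
  let ?K = "{q. subst \<gamma> q = 0}"
  have "\<exists>q'. q - q' \<in> ?K \<and>
    (\<forall>n\<in>Poly_Mapping.keys q'. Poly_Mapping.keys n \<subseteq> elementary_gens \<and> (\<forall>h\<in>{listmon [GF3, GU]}. \<forall>k. n \<noteq> h + k))"
  proof (rule reduction[where W = "\<lambda>g. if g = GF3 then 1 else 0"])
    fix h assume h: "h \<in> {listmon [GF3, GU]}"
    let ?r = "monomial_poly (listmon [GD13, GVs]) - monomial_poly (listmon [GD23, GV])"
    have "monomial_poly h - ?r \<in> ?K"
      using h e0 by (simp add: subst_hom subst_monomial_poly mono_value_listmon generators_eq xvar_eq mult.commute)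
    moreover have "n = listmon [GD13, GVs] \<or> n = listmon [GD23, GV]" if "n \<in> Poly_Mapping.keys ?r" for n
      using that keys_diff[of "monomial_poly (listmon [GD13, GVs])" "monomial_poly (listmon [GD23, GV])"]
      by (auto simp: keys_monomial_poly)
    moreover have "weight (\<lambda>g. if g = GF3 then 1 else 0) (listmon [GD13, GVs]) < weight (\<lambda>g. if g = GF3 then 1 else 0) h"
      "weight (\<lambda>g. if g = GF3 then 1 else 0) (listmon [GD23, GV]) < weight (\<lambda>g. if g = GF3 then 1 else 0) h"
      using h by (simp_all add: weight_listmon)
    moreover have "Poly_Mapping.keys (listmon [GD13, GVs]) \<subseteq> elementary_gens" "Poly_Mapping.keys (listmon [GD23, GV]) \<subseteq> elementary_gens"
      by (auto simp: in_keys_iff lookup_listmon elementary_gens_def split: if_splits)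
    ultimately show "\<exists>r. monomial_poly h - r \<in> ?K \<and> (\<forall>n\<in>Poly_Mapping.keys r.
        weight (\<lambda>g. if g = GF3 then 1 else 0) n < weight (\<lambda>g. if g = GF3 then 1 else 0) h \<and> Poly_Mapping.keys n \<subseteq> elementary_gens)"
      by (intro exI[of _ ?r]) metis
  next
    show "\<forall>n\<in>Poly_Mapping.keys q. Poly_Mapping.keys n \<subseteq> elementary_gens"
      using assms by (simp add: supported_def)
  qed (simp_all add: subst_hom)
  then obtain q' where "subst \<gamma> (q - q') = 0" "Poly_Mapping.keys q' \<subseteq> elementary_monomials"
    by (auto simp: elementary_monomials_def)
  then show ?thesis by (auto simp: subst_diff)
qed

text \<open>First the power of \<open>d23\<close> is divided out among the elementary monomials. The
  quotient is then rewritten in irreducible monomials, where the power of \<open>x111\<close> can be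
  divided out.\<close>

lemma invariant_image:
  assumes "p \<in> A223"
  shows "\<exists>q. Poly_Mapping.keys q \<subseteq> irreducible_monomials \<and> p = subst \<gamma> q"
proof -
  obtain N q0 where q0: "supported elementary_gens q0" "subst \<gamma> q0 = D23 X ^ N * (X 0 ^ (2 * N) * p)"
    using invariant_denominator[OF assms] by blast
  obtain q1 where q1: "Poly_Mapping.keys q1 \<subseteq> elementary_monomials" "subst \<gamma> q0 = subst \<gamma> q1"
    using elementary_image[OF q0(1)] by blast
  have "subst \<gamma> q1 = \<gamma> GD23 ^ N * (X 0 ^ (2 * N) * p)"
    using q0(2) q1(2) by (simp only: \<gamma>_simps)
  from d23.divide_power[OF q1(1) this]
  obtain q2 where q2: "X 0 ^ (2 * N) * p = subst \<gamma> q2" by blast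
  obtain q3 where q3: "Poly_Mapping.keys q3 \<subseteq> irreducible_monomials" "subst \<gamma> q2 = subst \<gamma> q3"
    using irreducible_image by blast
  have "subst \<gamma> q3 = \<gamma> GX ^ (2 * N) * p"
    using q2 q3(2) by (simp only: \<gamma>_simps)
  from x.divide_power[OF q3(1) this] show ?thesis by blast
qed

section \<open>Generation and linear basis\<close>

lemma subst_in_subalgebra:
  assumes "is_subalgebra S" "\<And>g. \<gamma> g \<in> S"
  shows "subst \<gamma> q \<in> S"
proof (induction q rule: cpoly_induct)
  case (const c)
  have "cscale c 1 \<in> S" using assms(1) by (auto simp: is_subalgebra_def)
  then show ?case by (simp add: cscale_def)
qed (use assms in \<open>auto simp: is_subalgebra_def subst_hom\<close>)

lemma A223_subalgebra: "is_subalgebra A223"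
  using A223_closed(1)[of 1] A223_closed by (simp add: is_subalgebra_def cscale_def const_poly_simps)

lemma generate_A223: "is_subalgebra hull (range \<gamma>) = A223"
proof
  show "is_subalgebra hull (range \<gamma>) \<subseteq> A223"
    using A223_subalgebra \<gamma>_in_A223 by (intro hull_minimal) auto
  show "A223 \<subseteq> is_subalgebra hull (range \<gamma>)"
    using invariant_image subst_in_subalgebra unfolding hull_def by blast
qed

text \<open>Independence of a set of values does not exclude that two monomials share a value, so
  their distinctness is recorded separately.\<close>

lemma monomials_inj: "inj_on (subst \<gamma>) (monomial_poly ` irreducible_monomials)"
proof (rule inj_onI, clarify)
  fix m n assume mn: "m \<in> irreducible_monomials" "n \<in> irreducible_monomials"
    "subst \<gamma> (monomial_poly m) = subst \<gamma> (monomial_poly n)"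
  have "monomial_poly m - monomial_poly n = 0"
    using mn keys_diff[of "monomial_poly m" "monomial_poly n"]
    by (intro x.independent) (auto simp: subst_diff keys_monomial_poly)
  then show "monomial_poly m = monomial_poly n" by simp
qed

lemma monomials_independent: "\<not> module.dependent cscale (subst \<gamma> ` monomial_poly ` irreducible_monomials)"
  unfolding module.dependent_explicit[OF module_cscale]
proof (intro notI, elim exE conjE)
  fix S and c :: "poly223 \<Rightarrow> complex"
  assume S: "finite S" "S \<subseteq> subst \<gamma> ` monomial_poly ` irreducible_monomials" "\<exists>v\<in>S. c v \<noteq> 0"
    "(\<Sum>v\<in>S. cscale (c v) v) = 0"
  define f where "f n = subst \<gamma> (monomial_poly n)" for n
  have inj: "inj_on f irreducible_monomials"
  proof -
    have "inj_on monomial_poly irreducible_monomials"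
      by (rule inj_onI) (metis keys_monomial_poly singleton_inject)
    then have "inj_on (subst \<gamma> \<circ> monomial_poly) irreducible_monomials"
      using monomials_inj by (rule comp_inj_on)
    then show ?thesis by (simp add: f_def[abs_def] comp_def)
  qed
  obtain A where A: "A \<subseteq> irreducible_monomials" "S = f ` A"
    using S(2) by (auto simp: image_image f_def[symmetric] subset_image_iff)
  have injA: "inj_on f A" using inj A(1) by (rule inj_on_subset)
  have finA: "finite A" using S(1) finite_imageD[OF _ injA] A(2) by blast
  \<comment> \<open>A dependence among the values is lifted to a polynomial in the generators, to
    which independence of irreducible monomials applies.\<close>
  define q where "q = (\<Sum>n\<in>A. Poly_Mapping.single n (c (f n)))"
  have "Poly_Mapping.keys q \<subseteq> A"
    unfolding q_def by (rule order_trans[OF keys_sum]) (auto split: if_splits)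
  moreover have "subst \<gamma> q = 0"
  proof -
    have "subst \<gamma> q = (\<Sum>n\<in>A. cscale (c (f n)) (f n))"
      by (simp add: q_def subst_sum subst_single f_def subst_monomial_poly cscale_def)
    also have "\<dots> = (\<Sum>v\<in>S. cscale (c v) v)"
      unfolding A(2) by (simp add: sum.reindex[OF injA])
    finally show ?thesis using S(4) by simp
  qed
  ultimately have "q = 0" using A(1) by (intro x.independent) auto
  moreover have "Poly_Mapping.lookup q n = c (f n)" if "n \<in> A" for n
    using that finA by (simp add: q_def lookup_sum lookup_single when_def)
  ultimately show False using S(3) A(2) by auto
qed

lemma monomials_span: "module.span cscale (subst \<gamma> ` monomial_poly ` irreducible_monomials) = A223"
proof
  have "module.subspace cscale A223"
    using A223_closed(1)[of 0] A223_closed by (simp add: module.subspace_def[OF module_cscale] cscale_def const_poly_simps)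
  moreover have "subst \<gamma> ` monomial_poly ` irreducible_monomials \<subseteq> A223"
    using subst_in_subalgebra[OF A223_subalgebra \<gamma>_in_A223] by blast
  ultimately show "module.span cscale (subst \<gamma> ` monomial_poly ` irreducible_monomials) \<subseteq> A223"
    using module.span_minimal[OF module_cscale] by blast
  show "A223 \<subseteq> module.span cscale (subst \<gamma> ` monomial_poly ` irreducible_monomials)"
  proof
    fix p assume "p \<in> A223"
    then obtain q where q: "Poly_Mapping.keys q \<subseteq> irreducible_monomials" "p = subst \<gamma> q"
      using invariant_image by blast
    have "p = (\<Sum>n\<in>Poly_Mapping.keys q. cscale (Poly_Mapping.lookup q n) (subst \<gamma> (monomial_poly n)))"
      by (simp only: q(2) subst_alt[of \<gamma> q] subst_monomial_poly cscale_def)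
    also have "\<dots> \<in> module.span cscale (subst \<gamma> ` monomial_poly ` irreducible_monomials)"
      using q(1) by (intro module.span_sum[OF module_cscale] module.span_scale[OF module_cscale] module.span_base[OF module_cscale]) auto
    finally show "p \<in> module.span cscale (subst \<gamma> ` monomial_poly ` irreducible_monomials)" .
  qed
qed

end

section \<open>The seven families\<close>

lemma monomial_poly_gen:
  "monomial_poly n = var GX ^ Poly_Mapping.lookup n GX * var GD12 ^ Poly_Mapping.lookup n GD12 *
    var GD13 ^ Poly_Mapping.lookup n GD13 * var GD23 ^ Poly_Mapping.lookup n GD23 * var GF3 ^ Poly_Mapping.lookup n GF3 *
    var GU ^ Poly_Mapping.lookup n GU * var GF4 ^ Poly_Mapping.lookup n GF4 * var GV ^ Poly_Mapping.lookup n GV *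
    var GVs ^ Poly_Mapping.lookup n GVs * var GF5 ^ Poly_Mapping.lookup n GF5 * var GPhi ^ Poly_Mapping.lookup n GPhi *
    var GPsi ^ Poly_Mapping.lookup n GPsi * var GPsis ^ Poly_Mapping.lookup n GPsis"
proof -
  have "finite (UNIV :: gen set)" by (simp add: UNIV_gen)
  then have "monomial_poly n = (\<Prod>g\<in>UNIV. var g ^ Poly_Mapping.lookup n g)"
    using single_eq_mono_value[of n 1] mono_value_superset[of UNIV n var]
    by (simp add: monomial_poly_def const_poly_simps)
  then show ?thesis by (simp add: UNIV_gen mult.assoc)
qed

definition gen_monomial :: "(gen \<Rightarrow> nat) \<Rightarrow> gen monomial" where
  "gen_monomial = Abs_poly_mapping"

lemma lookup_gen_monomial: "Poly_Mapping.lookup (gen_monomial f) g = f g"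
proof -
  have "finite (UNIV :: gen set)" by (simp add: UNIV_gen)
  then have "finite {g. f g \<noteq> 0}" by (rule finite_subset[rotated]) simp
  then show ?thesis by (simp add: gen_monomial_def)
qed

lemma gen_monomial_memberI:
  assumes "p = monomial_poly (gen_monomial f)" "gen_monomial f \<in> irreducible_monomials"
  shows "p \<in> monomial_poly ` irreducible_monomials"
  using assms by blast

text \<open>For each family \<open>case_gen\<close> lists the exponents of its monomials in the
  order of the constructors of \<open>gen\<close>.\<close>

lemma basis_monomials_subset: "basis_monomials \<subseteq> monomial_poly ` irreducible_monomials"
  unfolding basis_monomials_def
proof (intro Un_least subsetI; elim CollectE exE conjE)
  fix p a b c d f g k
  assume "p = var GX ^ a * var GD12 ^ b * var GD13 ^ c * var GD23 ^ d * var GF3 * var GU ^ f * var GF4 ^ g * var GPhi ^ k"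
  then show "p \<in> monomial_poly ` irreducible_monomials"
    by (intro gen_monomial_memberI[of _ "case_gen a b c d 1 f g 0 0 0 k 0 0"])
      (simp_all add: monomial_poly_gen lookup_gen_monomial irreducible_lookups)
next
  fix p a b c d f g k
  assume "p = var GX ^ a * var GD12 ^ b * var GD13 ^ c * var GD23 ^ d * var GU ^ f * var GF4 ^ g * var GF5 * var GPhi ^ k"
  then show "p \<in> monomial_poly ` irreducible_monomials"
    by (intro gen_monomial_memberI[of _ "case_gen a b c d 0 f g 0 0 1 k 0 0"])
      (simp_all add: monomial_poly_gen lookup_gen_monomial irreducible_lookups)
next
  fix p a b c f g h k l
  assume "p = var GX ^ a * var GD12 ^ b * var GD13 ^ c * var GU ^ f * var GF4 ^ g * var GV ^ h * var GPhi ^ k * var GPsi ^ l"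
    "h \<ge> (1::nat)" "l \<in> {0, 1::nat}"
  then show "p \<in> monomial_poly ` irreducible_monomials"
    by (intro gen_monomial_memberI[of _ "case_gen a b c 0 0 f g h 0 0 k l 0"])
      (auto simp add: monomial_poly_gen lookup_gen_monomial irreducible_lookups)
next
  fix p a b d f g i k m
  assume "p = var GX ^ a * var GD12 ^ b * var GD23 ^ d * var GU ^ f * var GF4 ^ g * var GVs ^ i * var GPhi ^ k * var GPsis ^ m"
    "i \<ge> (1::nat)" "m \<in> {0, 1::nat}"
  then show "p \<in> monomial_poly ` irreducible_monomials"
    by (intro gen_monomial_memberI[of _ "case_gen a b 0 d 0 f g 0 i 0 k 0 m"])
      (auto simp add: monomial_poly_gen lookup_gen_monomial irreducible_lookups)
next
  fix p a b c d f g k l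
  assume "p = var GX ^ a * var GD12 ^ b * var GD13 ^ c * var GD23 ^ d * var GU ^ f * var GF4 ^ g * var GPhi ^ k * var GPsi ^ l"
    "c \<ge> (1::nat)" "l \<in> {0, 1::nat}"
  then show "p \<in> monomial_poly ` irreducible_monomials"
    by (intro gen_monomial_memberI[of _ "case_gen a b c d 0 f g 0 0 0 k l 0"])
      (auto simp add: monomial_poly_gen lookup_gen_monomial irreducible_lookups)
next
  fix p a b d f g k
  assume "p = var GX ^ a * var GD12 ^ b * var GD23 ^ d * var GU ^ f * var GF4 ^ g * var GPhi ^ k * var GPsi"
  then show "p \<in> monomial_poly ` irreducible_monomials"
    by (intro gen_monomial_memberI[of _ "case_gen a b 0 d 0 f g 0 0 0 k 1 0"])
      (simp_all add: monomial_poly_gen lookup_gen_monomial irreducible_lookups)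
next
  fix p a b d f g k m
  assume "p = var GX ^ a * var GD12 ^ b * var GD23 ^ d * var GU ^ f * var GF4 ^ g * var GPhi ^ k * var GPsis ^ m"
    "m \<in> {0, 1::nat}"
  then show "p \<in> monomial_poly ` irreducible_monomials"
    by (intro gen_monomial_memberI[of _ "case_gen a b 0 d 0 f g 0 0 0 k 0 m"])
      (auto simp add: monomial_poly_gen lookup_gen_monomial irreducible_lookups)
qed

lemma basis_monomialsI:
  "var GX ^ a * var GD12 ^ b * var GD13 ^ c * var GD23 ^ d * var GF3 * var GU ^ f * var GF4 ^ g * var GPhi ^ k \<in> basis_monomials"
  "var GX ^ a * var GD12 ^ b * var GD13 ^ c * var GD23 ^ d * var GU ^ f * var GF4 ^ g * var GF5 * var GPhi ^ k \<in> basis_monomials"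
  "h \<ge> 1 \<Longrightarrow> l \<in> {0, 1} \<Longrightarrow>
    var GX ^ a * var GD12 ^ b * var GD13 ^ c * var GU ^ f * var GF4 ^ g * var GV ^ h * var GPhi ^ k * var GPsi ^ l \<in> basis_monomials"
  "i \<ge> 1 \<Longrightarrow> m \<in> {0, 1} \<Longrightarrow>
    var GX ^ a * var GD12 ^ b * var GD23 ^ d * var GU ^ f * var GF4 ^ g * var GVs ^ i * var GPhi ^ k * var GPsis ^ m \<in> basis_monomials"
  "c \<ge> 1 \<Longrightarrow> l \<in> {0, 1} \<Longrightarrow>
    var GX ^ a * var GD12 ^ b * var GD13 ^ c * var GD23 ^ d * var GU ^ f * var GF4 ^ g * var GPhi ^ k * var GPsi ^ l \<in> basis_monomials"
  "var GX ^ a * var GD12 ^ b * var GD23 ^ d * var GU ^ f * var GF4 ^ g * var GPhi ^ k * var GPsi \<in> basis_monomials"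
  "m \<in> {0, 1} \<Longrightarrow>
    var GX ^ a * var GD12 ^ b * var GD23 ^ d * var GU ^ f * var GF4 ^ g * var GPhi ^ k * var GPsis ^ m \<in> basis_monomials"
  unfolding basis_monomials_def
  subgoal by (rule UnI1, rule UnI1, rule UnI1, rule UnI1, rule UnI1, rule UnI1, blast)
  subgoal by (rule UnI1, rule UnI1, rule UnI1, rule UnI1, rule UnI1, rule UnI2, blast)
  subgoal by (rule UnI1, rule UnI1, rule UnI1, rule UnI1, rule UnI2, blast)
  subgoal by (rule UnI1, rule UnI1, rule UnI1, rule UnI2, blast)
  subgoal by (rule UnI1, rule UnI1, rule UnI2, blast)
  subgoal by (rule UnI1, rule UnI2, blast)
  subgoal by (rule UnI2, blast)
  done

lemma irreducible_in_basis:
  assumes n: "n \<in> irreducible_monomials"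
  shows "monomial_poly n \<in> basis_monomials"
proof -
  let ?e = "Poly_Mapping.lookup n"
  note I = basis_monomialsI(1)[where a = "?e GX" and b = "?e GD12" and c = "?e GD13" and d = "?e GD23" and f = "?e GU" and g = "?e GF4" and k = "?e GPhi"]
    basis_monomialsI(2)[where a = "?e GX" and b = "?e GD12" and c = "?e GD13" and d = "?e GD23" and f = "?e GU" and g = "?e GF4" and k = "?e GPhi"]
    basis_monomialsI(3)[where a = "?e GX" and b = "?e GD12" and c = "?e GD13" and f = "?e GU" and g = "?e GF4" and h = "?e GV" and k = "?e GPhi" and l = "?e GPsi"]
    basis_monomialsI(4)[where a = "?e GX" and b = "?e GD12" and d = "?e GD23" and f = "?e GU" and g = "?e GF4" and i = "?e GVs" and k = "?e GPhi" and m = "?e GPsis"]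
    basis_monomialsI(5)[where a = "?e GX" and b = "?e GD12" and c = "?e GD13" and d = "?e GD23" and f = "?e GU" and g = "?e GF4" and k = "?e GPhi" and l = "?e GPsi"]
    basis_monomialsI(6)[where a = "?e GX" and b = "?e GD12" and d = "?e GD23" and f = "?e GU" and g = "?e GF4" and k = "?e GPhi"]
    basis_monomialsI(7)[where a = "?e GX" and b = "?e GD12" and d = "?e GD23" and f = "?e GU" and g = "?e GF4" and k = "?e GPhi" and m = "?e GPsis"]
  from irreducibleD[OF n] show ?thesis
  proof (cases rule: irreducible_cases)
    case 1
    then show ?thesis using I(1) by (simp add: monomial_poly_gen)
  next
    case 2
    then show ?thesis using I(2) by (simp add: monomial_poly_gen)
  next
    case 3
    then show ?thesis using I(3) by (simp add: monomial_poly_gen Suc_le_eq)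
  next
    case 4
    then show ?thesis using I(3) by (simp add: monomial_poly_gen Suc_le_eq)
  next
    case 5
    then show ?thesis using I(4) by (simp add: monomial_poly_gen Suc_le_eq)
  next
    case 6
    then show ?thesis using I(4) by (simp add: monomial_poly_gen Suc_le_eq)
  next
    case 7
    \<comment> \<open>The families distinguish whether \<open>d13\<close> occurs: if it does, the
      fifth applies, otherwise the seventh with exponent 0 of \<open>\<psi>*\<close>.\<close>
    then show ?thesis using I(5) I(7) by (cases "?e GD13 = 0") (simp_all add: monomial_poly_gen Suc_le_eq)
  next
    case 8
    then show ?thesis using I(5) I(6) by (cases "?e GD13 = 0") (simp_all add: monomial_poly_gen Suc_le_eq)
  next
    case 9
    then show ?thesis using I(7) by (simp add: monomial_poly_gen)
  qed
qed

lemma basis_monomials_eq: "basis_monomials = monomial_poly ` irreducible_monomials"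
  using basis_monomials_subset irreducible_in_basis by blast

section \<open>Leading data, weights and relations of the chosen generators\<close>

context generators_223
begin

lemma leading_generators:
  "leading_coeff (\<gamma> g) = 1" "leading_monomial (\<gamma> g) = listmon (map idx_at (lead_list g))"
  using lead_\<gamma>[of g] by (rule lead_leading_coeff, rule lead_leading_monomial)

lemma highest_weight_generators:
  "highest_weight_vector ((3, 2), (3, 2), (2, 2, 1)) f5"
  "highest_weight_vector ((3, 3), (3, 3), (2, 2, 2)) \<phi>"
  "highest_weight_vector ((3, 3), (4, 2), (3, 2, 1)) \<psi>"
  "highest_weight_vector ((4, 2), (3, 3), (3, 2, 1)) \<psi>s"
proof -
  have nz: "\<gamma> g \<noteq> 0" for g using lead_\<gamma> by (rule lead_nonzero)
  note nz' = nz[of GF5] nz[of GPhi] nz[of GPsi] nz[of GPsis]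
  note A = \<gamma>_in_A223[of GF5] \<gamma>_in_A223[of GPhi] \<gamma>_in_A223[of GPsi] \<gamma>_in_A223[of GPsis]
  have "\<forall>m\<in>Poly_Mapping.keys f5. monomial_weight m = ((3, 2), (3, 2), (2, 2, 1))"
    by (intro ballI weight_vectorI) (use homogeneous_generators(1) in simp_all)
  then show "highest_weight_vector ((3, 2), (3, 2), (2, 2, 1)) f5"
    using nz' A by (simp add: highest_weight_vector_def)
  have "\<forall>m\<in>Poly_Mapping.keys \<phi>. monomial_weight m = ((3, 3), (3, 3), (2, 2, 2))"
    by (intro ballI weight_vectorI) (use homogeneous_generators(2) in simp_all)
  then show "highest_weight_vector ((3, 3), (3, 3), (2, 2, 2)) \<phi>"
    using nz' A by (simp add: highest_weight_vector_def)
  have "\<forall>m\<in>Poly_Mapping.keys \<psi>. monomial_weight m = ((3, 3), (4, 2), (3, 2, 1))"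
    by (intro ballI weight_vectorI) (use homogeneous_generators(3) in simp_all)
  then show "highest_weight_vector ((3, 3), (4, 2), (3, 2, 1)) \<psi>"
    using nz' A by (simp add: highest_weight_vector_def)
  have "\<forall>m\<in>Poly_Mapping.keys \<psi>s. monomial_weight m = ((4, 2), (3, 3), (3, 2, 1))"
    by (intro ballI weight_vectorI) (use homogeneous_generators(4) in simp_all)
  then show "highest_weight_vector ((4, 2), (3, 3), (3, 2, 1)) \<psi>s"
    using nz' A by (simp add: highest_weight_vector_def)
qed

lemma relations_and_kernel:
  "\<exists>t :: nat \<Rightarrow> gen cpoly.
    (\<forall>n < length relation_heads.
      equiv_mod_tail \<gamma> (fst (relation_heads ! n)) (snd (relation_heads ! n)) (t n)) \<and>
    {q. subst \<gamma> q = 0} =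
      ideal_generated {fst (relation_heads ! n) - snd (relation_heads ! n) - t n | n. n < length relation_heads}"
proof -
  define t where "t n = tail (snd (snd (relation_data ! n)))" for n
  have len: "length relation_heads = length relation_data" by (simp add: relation_heads_eq)
  have nth: "\<exists>h m ts. relation_data ! n = (h, m, ts) \<and> (h, m, ts) \<in> set relation_data \<and>
      relation_heads ! n = (prod_list (map var h), prod_list (map var m)) \<and> t n = tail ts"
    if n: "n < length relation_data" for n
  proof -
    obtain h m ts where r: "relation_data ! n = (h, m, ts)" by (cases "relation_data ! n") auto
    moreover have "(h, m, ts) \<in> set relation_data" using nth_mem[OF n] r by simp
    ultimately show ?thesis using n by (simp add: relation_heads_eq t_def)
  qed
  let ?r = "\<lambda>(h, m, ts). prod_list (map var h) - prod_list (map var m) - tail ts"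
  have "{fst (relation_heads ! n) - snd (relation_heads ! n) - t n | n. n < length relation_data}
    = (\<lambda>(h, m, ts). prod_list (map var h) - prod_list (map var m) - tail ts) ` set relation_data"
  proof -
    have "fst (relation_heads ! n) - snd (relation_heads ! n) - t n
      = (\<lambda>(h, m, ts). prod_list (map var h) - prod_list (map var m) - tail ts) (relation_data ! n)"
      if "n < length relation_data" for n
      using nth[OF that] by auto
    then have "{fst (relation_heads ! n) - snd (relation_heads ! n) - t n | n. n < length relation_data}
      = {?r (relation_data ! n) | n. n < length relation_data}" by (metis (no_types, lifting))
    also have "\<dots> = ?r ` set relation_data" unfolding set_conv_nth by blast
    finally show ?thesis .
  qed
  then have "{q. subst \<gamma> q = 0} = ideal_generated {fst (relation_heads ! n) - snd (relation_heads ! n) - t n | n. n < length relation_heads}"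
    unfolding len kernel_eq relation_ideal_def by simp
  moreover have "equiv_mod_tail \<gamma> (fst (relation_heads ! n)) (snd (relation_heads ! n)) (t n)"
    if "n < length relation_heads" for n
    using nth[of n] that relations_equiv_mod_tail by (auto simp: len)
  ultimately show ?thesis by blast
qed

end

theorem theorem4p15:
  shows "\<exists>f5 \<phi> \<psi> \<psi>s :: poly223.
    highest_weight_vector ((3, 2), (3, 2), (2, 2, 1)) f5 \<and> leading_coeff f5 = 1 \<and>
    leading_monomial f5 = xmon 1 1 1 + xmon 1 1 1 + xmon 1 2 2 + xmon 2 1 2 + xmon 2 2 3 \<and>
    highest_weight_vector ((3, 3), (3, 3), (2, 2, 2)) \<phi> \<and> leading_coeff \<phi> = 1 \<and>
    leading_monomial \<phi> = xmon 1 1 1 + xmon 1 1 1 + xmon 1 2 2 + xmon 2 1 2 + xmon 2 2 3 + xmon 2 2 3 \<and>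
    highest_weight_vector ((3, 3), (4, 2), (3, 2, 1)) \<psi> \<and> leading_coeff \<psi> = 1 \<and>
    leading_monomial \<psi> = xmon 1 1 1 + xmon 1 1 1 + xmon 1 1 1 + xmon 2 1 2 + xmon 2 2 2 + xmon 2 2 3 \<and>
    highest_weight_vector ((4, 2), (3, 3), (3, 2, 1)) \<psi>s \<and> leading_coeff \<psi>s = 1 \<and>
    leading_monomial \<psi>s = xmon 1 1 1 + xmon 1 1 1 + xmon 1 1 1 + xmon 1 2 2 + xmon 2 2 2 + xmon 2 2 3 \<and>
    (let \<gamma> = generator f5 \<phi> \<psi> \<psi>s in
      is_subalgebra hull (range \<gamma>) = A223 \<and>
      (\<exists>t :: nat \<Rightarrow> gen cpoly.
        (\<forall>n < length relation_heads.
          equiv_mod_tail \<gamma> (fst (relation_heads ! n)) (snd (relation_heads ! n)) (t n)) \<and>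
        {q. subst \<gamma> q = 0} =
          ideal_generated {fst (relation_heads ! n) - snd (relation_heads ! n) - t n | n.
            n < length relation_heads}) \<and>
      inj_on (subst \<gamma>) basis_monomials \<and>
      \<not> module.dependent cscale (subst \<gamma> ` basis_monomials) \<and>
      module.span cscale (subst \<gamma> ` basis_monomials) = A223)"
proof -
  obtain f5 \<phi> \<psi> \<psi>s where "all_syzygies (X 0) (D12 X) (D13 X) (D23 X) (F3 X) (U X) (F4 X) (V X) (Vs X)
    f5 \<psi> \<psi>s (const_poly (1/2)) \<phi>"
    using generators_exist by blast
  then interpret generators_223 f5 \<psi> \<psi>s \<phi> by (rule generators_223.intro)
  note L = leading_generators[of GF5, unfolded \<gamma>_simps] leading_generators[of GPhi, unfolded \<gamma>_simps]
    leading_generators[of GPsi, unfolded \<gamma>_simps] leading_generators[of GPsis, unfolded \<gamma>_simps]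
  have M: "listmon (map idx_at (lead_list GF5)) = xmon 1 1 1 + xmon 1 1 1 + xmon 1 2 2 + xmon 2 1 2 + xmon 2 2 3"
    "listmon (map idx_at (lead_list GPhi)) = xmon 1 1 1 + xmon 1 1 1 + xmon 1 2 2 + xmon 2 1 2 + xmon 2 2 3 + xmon 2 2 3"
    "listmon (map idx_at (lead_list GPsi)) = xmon 1 1 1 + xmon 1 1 1 + xmon 1 1 1 + xmon 2 1 2 + xmon 2 2 2 + xmon 2 2 3"
    "listmon (map idx_at (lead_list GPsis)) = xmon 1 1 1 + xmon 1 1 1 + xmon 1 1 1 + xmon 1 2 2 + xmon 2 2 2 + xmon 2 2 3"
    by (simp_all add: listmon_simps idx_at_def xmon_def add.assoc)
  show ?thesis
    unfolding Let_def
    using highest_weight_generators L[unfolded M] generate_A223 relations_and_kernel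
      monomials_inj[folded basis_monomials_eq] monomials_independent[folded basis_monomials_eq]
      monomials_span[folded basis_monomials_eq]
    by (intro exI[of _ f5] exI[of _ \<phi>] exI[of _ \<psi>] exI[of _ \<psi>s] conjI) assumption+
qed

end
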